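(* Let $\mathcal C$ be a small category and $\Lambda$ a commutative unital ring. There exists an endofunctor $Q:\mathbf U\mathcal C\to\mathbf U\mathcal C$ together with a natural transformation $Q\to\mathrm{id}$ satisfying: - the components of $Q\to\mathrm{id}$ are trivial fibrations; - the image of $Q$ consists of projective cofibrant complexes of semi-representables. In particular, $Q$ is a cofibrant replacement functor.
   Context: $\mathbf U\mathcal C$ is the category of presheaves on $\mathcal C$ with values in unbounded chain complexes of $\Lambda$-modules (equivalently, unbounded complexes in the category $\mathbf{PSh}(\mathcal C,\Lambda)$ of presheaves of $\Lambda$-modules), with the projective model structure: weak equivalences are objectwise quasi-isomorphisms, fibrations are objectwise degreewise surjections. "Projective cofibrant" means cofibrant in this model structure. For $c\in\mathcal C$, $\Lambda(c)$ is the representable presheaf of $\Lambda$-modules $d\mapsto\Lambda[\mathcal C(d,c)]$. An object of $\mathbf{PSh}(\mathcal C,\Lambda)$ is called semi-representable if it is a small coproduct of representables $\Lambda(c)$. A complex of semi-representables is a complex which is semi-representable in each degree. *)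

theory Defs
  imports "HOL-Algebra.AbelCoset" "HOL-Algebra.Module"
begin

unbundle cardinal_syntax

section \<open>Size\<close>

text \<open>
  HOL has no category of all sets. The role of "the small sets" is played by the sets of
  cardinality less than an uncountable regular cardinal \<open>\<kappa>\<close>, which is a parameter throughout.
  If \<open>\<kappa>\<close> is inaccessible, these are, up to bijection, the elements of a Grothendieck universe.
  Since \<open>\<kappa>\<close> is a relation on the type \<open>'u\<close> carrying the modules, every small set has a copy
  inside \<open>'u\<close>.
\<close>

definition universe :: "'u rel \<Rightarrow> bool" where
  "universe \<kappa> \<longleftrightarrow> Card_order \<kappa> \<and> natLeq <o \<kappa> \<and> regularCard \<kappa>"

definition small :: "'u rel \<Rightarrow> 'a set \<Rightarrow> bool" where
  "small \<kappa> A \<longleftrightarrow> |A| <o \<kappa>"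

lemma universe_cardSuc:
  assumes "infinite (UNIV :: 'a set)"
  shows "universe (cardSuc |UNIV :: 'a set| )"
proof -
  have c: "Cinfinite |UNIV :: 'a set|"
    using assms by (simp add: cinfinite_def card_of_card_order_on Field_card_of)
  have "natLeq \<le>o |UNIV :: 'a set|"
    using assms infinite_iff_natLeq_ordLeq by blast
  moreover have "|UNIV :: 'a set| <o cardSuc |UNIV :: 'a set|"
    by (simp add: cardSuc_greater card_of_Card_order)
  ultimately show ?thesis
    using c by (auto simp: universe_def cardSuc_Card_order intro: regularCard_cardSuc ordLeq_ordLess_trans)
qed


section \<open>Categories\<close>

record ('o, 'm) category =
  Ob :: "'o set"
  Mor :: "'m set"
  Dom :: "'m \<Rightarrow> 'o"
  Cod :: "'m \<Rightarrow> 'o"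
  Ident :: "'o \<Rightarrow> 'm"
  Comp :: "'m \<Rightarrow> 'm \<Rightarrow> 'm"  \<comment> \<open>\<open>Comp C g f\<close> is \<open>g\<close> after \<open>f\<close>\<close>

definition Hom :: "('o, 'm) category \<Rightarrow> 'o \<Rightarrow> 'o \<Rightarrow> 'm set" where
  "Hom C a b = {f \<in> Mor C. Dom C f = a \<and> Cod C f = b}"

locale category =
  fixes C :: "('o, 'm) category"
  assumes Dom_in_Ob: "f \<in> Mor C \<Longrightarrow> Dom C f \<in> Ob C"
    and Cod_in_Ob: "f \<in> Mor C \<Longrightarrow> Cod C f \<in> Ob C"
    and Ident_in_Hom: "a \<in> Ob C \<Longrightarrow> Ident C a \<in> Hom C a a"
    and Comp_in_Hom: "\<lbrakk>f \<in> Hom C a b; g \<in> Hom C b c\<rbrakk> \<Longrightarrow> Comp C g f \<in> Hom C a c"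
    and Comp_Ident_right: "f \<in> Hom C a b \<Longrightarrow> Comp C f (Ident C a) = f"
    and Comp_Ident_left: "f \<in> Hom C a b \<Longrightarrow> Comp C (Ident C b) f = f"
    and Comp_assoc: "\<lbrakk>f \<in> Hom C a b; g \<in> Hom C b c; h \<in> Hom C c d\<rbrakk> \<Longrightarrow>
      Comp C h (Comp C g f) = Comp C (Comp C h g) f"

definition small_category :: "'u rel \<Rightarrow> ('o, 'm) category \<Rightarrow> bool" where
  "small_category \<kappa> C \<longleftrightarrow> category C \<and> small \<kappa> (Ob C) \<and> small \<kappa> (Mor C)"

definition is_functor ::
  "('o, 'm) category \<Rightarrow> ('p, 'n) category \<Rightarrow> ('o \<Rightarrow> 'p) \<Rightarrow> ('m \<Rightarrow> 'n) \<Rightarrow> bool" where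
  "is_functor A B Fo Fm \<longleftrightarrow> category A \<and> category B \<and>
     (\<forall>a\<in>Ob A. Fo a \<in> Ob B) \<and>
     (\<forall>f\<in>Mor A. Fm f \<in> Hom B (Fo (Dom A f)) (Fo (Cod A f))) \<and>
     (\<forall>a\<in>Ob A. Fm (Ident A a) = Ident B (Fo a)) \<and>
     (\<forall>f\<in>Mor A. \<forall>g\<in>Mor A. Cod A f = Dom A g \<longrightarrow>
        Fm (Comp A g f) = Comp B (Fm g) (Fm f))"

definition is_nat_trans ::
  "('o, 'm) category \<Rightarrow> ('p, 'n) category \<Rightarrow> ('o \<Rightarrow> 'p) \<Rightarrow> ('m \<Rightarrow> 'n) \<Rightarrow>
   ('o \<Rightarrow> 'p) \<Rightarrow> ('m \<Rightarrow> 'n) \<Rightarrow> ('o \<Rightarrow> 'n) \<Rightarrow> bool" where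
  "is_nat_trans A B Fo Fm Go Gm \<eta> \<longleftrightarrow>
     is_functor A B Fo Fm \<and> is_functor A B Go Gm \<and>
     (\<forall>a\<in>Ob A. \<eta> a \<in> Hom B (Fo a) (Go a)) \<and>
     (\<forall>f\<in>Mor A. Comp B (\<eta> (Cod A f)) (Fm f) = Comp B (Gm f) (\<eta> (Dom A f)))"

definition initial :: "('o, 'm) category \<Rightarrow> 'o \<Rightarrow> bool" where
  "initial A z \<longleftrightarrow> z \<in> Ob A \<and> (\<forall>a\<in>Ob A. \<exists>!f. f \<in> Hom A z a)"

definition lifting :: "('o, 'm) category \<Rightarrow> 'm \<Rightarrow> 'm \<Rightarrow> bool" where
  "lifting A i p \<longleftrightarrow>
     (\<forall>u \<in> Hom A (Dom A i) (Dom A p). \<forall>v \<in> Hom A (Cod A i) (Cod A p).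
        Comp A p u = Comp A v i \<longrightarrow>
        (\<exists>h \<in> Hom A (Cod A i) (Dom A p). Comp A h i = u \<and> Comp A p h = v))"


section \<open>Modules and complexes of modules\<close>

text \<open>
  The multiplication and unit which HOL-Algebra's record type of modules inherits from rings are
  irrelevant. Linear maps are undefined outside the carrier, so that maps are equal when they
  agree on the carrier.
\<close>

definition linear_maps ::
  "('r, 's) ring_scheme \<Rightarrow> ('r, 'x) module \<Rightarrow> ('r, 'y) module \<Rightarrow> ('x \<Rightarrow> 'y) set" where
  "linear_maps R M N = {f \<in> carrier M \<rightarrow>\<^sub>E carrier N.
     (\<forall>x\<in>carrier M. \<forall>y\<in>carrier M. f (x \<oplus>\<^bsub>M\<^esub> y) = f x \<oplus>\<^bsub>N\<^esub> f y) \<and>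
     (\<forall>a\<in>carrier R. \<forall>x\<in>carrier M. f (a \<odot>\<^bsub>M\<^esub> x) = a \<odot>\<^bsub>N\<^esub> f x)}"

definition direct_sum :: "'i set \<Rightarrow> ('i \<Rightarrow> ('r, 'x) module) \<Rightarrow> ('r, 'i \<Rightarrow> 'x) module" where
  "direct_sum I M =
    \<lparr>carrier = {x \<in> (\<Pi>\<^sub>E i\<in>I. carrier (M i)). finite {i \<in> I. x i \<noteq> \<zero>\<^bsub>M i\<^esub>}},
     monoid.mult = undefined,
     one = undefined,
     zero = (\<lambda>i\<in>I. \<zero>\<^bsub>M i\<^esub>),
     add = (\<lambda>x y. \<lambda>i\<in>I. x i \<oplus>\<^bsub>M i\<^esub> y i),
     module.smult = (\<lambda>a x. \<lambda>i\<in>I. a \<odot>\<^bsub>M i\<^esub> x i)\<rparr>"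

definition regular_module :: "('r, 's) ring_scheme \<Rightarrow> ('r, 'r) module" where
  "regular_module R =
    \<lparr>carrier = carrier R, monoid.mult = monoid.mult R, one = one R, zero = zero R, add = add R,
     module.smult = monoid.mult R\<rparr>"

definition free_module :: "('r, 's) ring_scheme \<Rightarrow> 'i set \<Rightarrow> ('r, 'i \<Rightarrow> 'r) module" where
  "free_module R S = direct_sum S (\<lambda>_. regular_module R)"

record ('r, 'x) chain_complex =
  Deg :: "int \<Rightarrow> ('r, 'x) module"
  Diff :: "int \<Rightarrow> 'x \<Rightarrow> 'x"  \<comment> \<open>\<open>Diff K n\<close> maps \<open>Deg K n\<close> to \<open>Deg K (n - 1)\<close>\<close>

definition is_complex ::
  "'u rel \<Rightarrow> ('r, 's) ring_scheme \<Rightarrow> ('r, 'u) chain_complex \<Rightarrow> bool" where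
  "is_complex \<kappa> R K \<longleftrightarrow>
     (\<forall>n. module R (Deg K n) \<and> small \<kappa> (carrier (Deg K n)) \<and>
          Diff K n \<in> linear_maps R (Deg K n) (Deg K (n - 1)) \<and>
          (\<forall>x\<in>carrier (Deg K n). Diff K (n - 1) (Diff K n x) = \<zero>\<^bsub>Deg K (n - 1 - 1)\<^esub>))"

definition chain_maps ::
  "('r, 's) ring_scheme \<Rightarrow> ('r, 'x) chain_complex \<Rightarrow> ('r, 'y) chain_complex \<Rightarrow>
   (int \<Rightarrow> 'x \<Rightarrow> 'y) set" where
  "chain_maps R K L = {f. \<forall>n. f n \<in> linear_maps R (Deg K n) (Deg L n) \<and>
     (\<forall>x\<in>carrier (Deg K n). f (n - 1) (Diff K n x) = Diff L n (f n x))}"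

definition id_chain :: "('r, 'x) chain_complex \<Rightarrow> int \<Rightarrow> 'x \<Rightarrow> 'x" where
  "id_chain K = (\<lambda>n. \<lambda>x\<in>carrier (Deg K n). x)"

definition comp_chain ::
  "('r, 'x) chain_complex \<Rightarrow> (int \<Rightarrow> 'y \<Rightarrow> 'z) \<Rightarrow> (int \<Rightarrow> 'x \<Rightarrow> 'y) \<Rightarrow> int \<Rightarrow> 'x \<Rightarrow> 'z" where
  "comp_chain K g f = (\<lambda>n. compose (carrier (Deg K n)) (g n) (f n))"

definition cycles :: "('r, 'x) chain_complex \<Rightarrow> int \<Rightarrow> 'x set" where
  "cycles K n = {x \<in> carrier (Deg K n). Diff K n x = \<zero>\<^bsub>Deg K (n - 1)\<^esub>}"

definition boundaries :: "('r, 'x) chain_complex \<Rightarrow> int \<Rightarrow> 'x set" where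
  "boundaries K n = Diff K (n + 1) ` carrier (Deg K (n + 1))"

definition homology :: "('r, 'x) chain_complex \<Rightarrow> int \<Rightarrow> 'x set monoid" where
  "homology K n = ((Deg K n)\<lparr>carrier := cycles K n\<rparr>) A_Mod boundaries K n"

text \<open>The map induced on homology sends the class of a cycle \<open>x\<close> to the class of \<open>f x\<close>.\<close>

definition homology_map ::
  "('r, 'y) chain_complex \<Rightarrow> (int \<Rightarrow> 'x \<Rightarrow> 'y) \<Rightarrow> int \<Rightarrow> 'x set \<Rightarrow> 'y set" where
  "homology_map L f n = (\<lambda>X. \<Union>x\<in>X. boundaries L n +>\<^bsub>Deg L n\<^esub> f n x)"

definition quasi_iso ::
  "('r, 'x) chain_complex \<Rightarrow> ('r, 'y) chain_complex \<Rightarrow> (int \<Rightarrow> 'x \<Rightarrow> 'y) \<Rightarrow> bool" where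
  "quasi_iso K L f \<longleftrightarrow> (\<forall>n. homology_map L f n \<in> iso (homology K n) (homology L n))"


section \<open>Presheaves of modules\<close>

record ('o, 'm, 'r, 'x) presheaf =
  Sec :: "'o \<Rightarrow> ('r, 'x) module"
  Rst :: "'m \<Rightarrow> 'x \<Rightarrow> 'x"

definition is_presheaf ::
  "('o, 'm) category \<Rightarrow> ('r, 's) ring_scheme \<Rightarrow> ('o, 'm, 'r, 'x) presheaf \<Rightarrow> bool" where
  "is_presheaf C R P \<longleftrightarrow>
     (\<forall>c\<in>Ob C. module R (Sec P c)) \<and>
     (\<forall>f\<in>Mor C. Rst P f \<in> linear_maps R (Sec P (Cod C f)) (Sec P (Dom C f))) \<and>
     (\<forall>c\<in>Ob C. \<forall>x\<in>carrier (Sec P c). Rst P (Ident C c) x = x) \<and>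
     (\<forall>f\<in>Mor C. \<forall>g\<in>Mor C. Cod C f = Dom C g \<longrightarrow>
        (\<forall>x\<in>carrier (Sec P (Cod C g)). Rst P (Comp C g f) x = Rst P f (Rst P g x)))"

definition presheaf_maps ::
  "('o, 'm) category \<Rightarrow> ('r, 's) ring_scheme \<Rightarrow> ('o, 'm, 'r, 'x) presheaf \<Rightarrow>
   ('o, 'm, 'r, 'y) presheaf \<Rightarrow> ('o \<Rightarrow> 'x \<Rightarrow> 'y) set" where
  "presheaf_maps C R P P' = {\<phi>.
     (\<forall>c\<in>Ob C. \<phi> c \<in> linear_maps R (Sec P c) (Sec P' c)) \<and>
     (\<forall>f\<in>Mor C. \<forall>x\<in>carrier (Sec P (Cod C f)).
        \<phi> (Dom C f) (Rst P f x) = Rst P' f (\<phi> (Cod C f) x))}"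

definition presheaf_iso ::
  "('o, 'm) category \<Rightarrow> ('r, 's) ring_scheme \<Rightarrow> ('o, 'm, 'r, 'x) presheaf \<Rightarrow>
   ('o, 'm, 'r, 'y) presheaf \<Rightarrow> bool" where
  "presheaf_iso C R P P' \<longleftrightarrow>
     (\<exists>\<phi> \<in> presheaf_maps C R P P'. \<exists>\<psi> \<in> presheaf_maps C R P' P.
        \<forall>c\<in>Ob C. (\<forall>x\<in>carrier (Sec P c). \<psi> c (\<phi> c x) = x) \<and>
                 (\<forall>y\<in>carrier (Sec P' c). \<phi> c (\<psi> c y) = y))"

text \<open>
  Restriction along \<open>f : d \<rightarrow> e\<close> sends the basis element \<open>h : e \<rightarrow> c\<close> to \<open>h \<circ> f\<close>, that is, the
  coefficient at \<open>k : d \<rightarrow> c\<close> is the sum of the coefficients at those \<open>h\<close> with \<open>h \<circ> f = k\<close>.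
\<close>

definition representable ::
  "('o, 'm) category \<Rightarrow> ('r, 's) ring_scheme \<Rightarrow> 'o \<Rightarrow> ('o, 'm, 'r, 'm \<Rightarrow> 'r) presheaf" where
  "representable C R c =
    \<lparr>Sec = (\<lambda>d. free_module R (Hom C d c)),
     Rst = (\<lambda>f. \<lambda>x \<in> carrier (free_module R (Hom C (Cod C f) c)).
        \<lambda>k \<in> Hom C (Dom C f) c.
          finsum R x {h \<in> Hom C (Cod C f) c. x h \<noteq> \<zero>\<^bsub>R\<^esub> \<and> Comp C h f = k})\<rparr>"

definition presheaf_coproduct ::
  "('o, 'm) category \<Rightarrow> 'i set \<Rightarrow> ('i \<Rightarrow> ('o, 'm, 'r, 'x) presheaf) \<Rightarrow>
   ('o, 'm, 'r, 'i \<Rightarrow> 'x) presheaf" where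
  "presheaf_coproduct C I P =
    \<lparr>Sec = (\<lambda>d. direct_sum I (\<lambda>i. Sec (P i) d)),
     Rst = (\<lambda>f. \<lambda>x \<in> carrier (direct_sum I (\<lambda>i. Sec (P i) (Cod C f))).
        \<lambda>i\<in>I. Rst (P i) f (x i))\<rparr>"

definition semi_representable ::
  "'u rel \<Rightarrow> ('o, 'm) category \<Rightarrow> ('r, 's) ring_scheme \<Rightarrow> ('o, 'm, 'r, 'u) presheaf \<Rightarrow> bool" where
  "semi_representable \<kappa> C R P \<longleftrightarrow> is_presheaf C R P \<and>
     (\<exists>(I :: 'u set) c. small \<kappa> I \<and> (\<forall>i\<in>I. c i \<in> Ob C) \<and>
        presheaf_iso C R P (presheaf_coproduct C I (\<lambda>i. representable C R (c i))))"


section \<open>Presheaves of complexes\<close>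

record ('o, 'm, 'r, 'x) cpresheaf =
  Val :: "'o \<Rightarrow> ('r, 'x) chain_complex"
  Res :: "'m \<Rightarrow> int \<Rightarrow> 'x \<Rightarrow> 'x"

definition is_cpresheaf ::
  "'u rel \<Rightarrow> ('o, 'm) category \<Rightarrow> ('r, 's) ring_scheme \<Rightarrow> ('o, 'm, 'r, 'u) cpresheaf \<Rightarrow> bool" where
  "is_cpresheaf \<kappa> C R X \<longleftrightarrow>
     (\<forall>c\<in>Ob C. is_complex \<kappa> R (Val X c)) \<and>
     (\<forall>f\<in>Mor C. Res X f \<in> chain_maps R (Val X (Cod C f)) (Val X (Dom C f))) \<and>
     (\<forall>c\<in>Ob C. Res X (Ident C c) = id_chain (Val X c)) \<and>
     (\<forall>f\<in>Mor C. \<forall>g\<in>Mor C. Cod C f = Dom C g \<longrightarrow>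
        Res X (Comp C g f) = comp_chain (Val X (Cod C g)) (Res X f) (Res X g))"

definition degree_presheaf ::
  "('o, 'm, 'r, 'x) cpresheaf \<Rightarrow> int \<Rightarrow> ('o, 'm, 'r, 'x) presheaf" where
  "degree_presheaf X n = \<lparr>Sec = (\<lambda>c. Deg (Val X c) n), Rst = (\<lambda>f. Res X f n)\<rparr>"

definition cpresheaf_maps ::
  "('o, 'm) category \<Rightarrow> ('r, 's) ring_scheme \<Rightarrow> ('o, 'm, 'r, 'x) cpresheaf \<Rightarrow>
   ('o, 'm, 'r, 'x) cpresheaf \<Rightarrow> ('o \<Rightarrow> int \<Rightarrow> 'x \<Rightarrow> 'x) set" where
  "cpresheaf_maps C R X Y = {\<phi> \<in> extensional (Ob C).
     (\<forall>c\<in>Ob C. \<phi> c \<in> chain_maps R (Val X c) (Val Y c)) \<and>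
     (\<forall>f\<in>Mor C. comp_chain (Val X (Cod C f)) (\<phi> (Dom C f)) (Res X f) =
                comp_chain (Val X (Cod C f)) (Res Y f) (\<phi> (Cod C f)))}"

text \<open>The arrows of \<open>U C\<close> are triples of source, target and underlying map.\<close>

type_synonym ('o, 'm, 'r, 'x) cpresheaf_arrow =
  "('o, 'm, 'r, 'x) cpresheaf \<times> ('o, 'm, 'r, 'x) cpresheaf \<times> ('o \<Rightarrow> int \<Rightarrow> 'x \<Rightarrow> 'x)"

definition UCat ::
  "'u rel \<Rightarrow> ('o, 'm) category \<Rightarrow> ('r, 's) ring_scheme \<Rightarrow>
   (('o, 'm, 'r, 'u) cpresheaf, ('o, 'm, 'r, 'u) cpresheaf_arrow) category" where
  "UCat \<kappa> C R =
    \<lparr>Ob = {X. is_cpresheaf \<kappa> C R X},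
     Mor = {(X, Y, \<phi>). is_cpresheaf \<kappa> C R X \<and> is_cpresheaf \<kappa> C R Y \<and> \<phi> \<in> cpresheaf_maps C R X Y},
     Dom = (\<lambda>(X, Y, \<phi>). X),
     Cod = (\<lambda>(X, Y, \<phi>). Y),
     Ident = (\<lambda>X. (X, X, \<lambda>c\<in>Ob C. id_chain (Val X c))),
     Comp = (\<lambda>(Y, Z, \<psi>) (X, Y', \<phi>). (X, Z, \<lambda>c\<in>Ob C. comp_chain (Val X c) (\<psi> c) (\<phi> c)))\<rparr>"

lemma linear_maps_funcset: "f \<in> linear_maps R M N \<Longrightarrow> x \<in> carrier M \<Longrightarrow> f x \<in> carrier N"
  by (auto simp: linear_maps_def)

lemma id_chain_in_chain_maps:
  assumes "is_complex \<kappa> R K"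
  shows "id_chain K \<in> chain_maps R K K"
proof -
  have m: "module R (Deg K n)" and d: "Diff K n \<in> linear_maps R (Deg K n) (Deg K (n - 1))" for n
    using assms by (auto simp: is_complex_def)
  have "id_chain K n \<in> linear_maps R (Deg K n) (Deg K n)" for n
  proof -
    interpret module R "Deg K n" by (rule m)
    show ?thesis by (auto simp: id_chain_def linear_maps_def)
  qed
  then show ?thesis
    using linear_maps_funcset[OF d] by (auto simp: chain_maps_def id_chain_def)
qed

lemma comp_chain_in_chain_maps:
  assumes K: "is_complex \<kappa> R K" and f: "f \<in> chain_maps R K L" and g: "g \<in> chain_maps R L N"
  shows "comp_chain K g f \<in> chain_maps R K N"
proof -
  have m: "module R (Deg K n)" and d: "Diff K n \<in> linear_maps R (Deg K n) (Deg K (n - 1))" for n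
    using K by (auto simp: is_complex_def)
  have f': "f n \<in> linear_maps R (Deg K n) (Deg L n)"
    and g': "g n \<in> linear_maps R (Deg L n) (Deg N n)" for n
    using f g by (auto simp: chain_maps_def)
  have "comp_chain K g f n \<in> linear_maps R (Deg K n) (Deg N n)" for n
  proof -
    interpret module R "Deg K n" by (rule m)
    show ?thesis
      using f'[of n] g'[of n]
      by (auto simp: comp_chain_def linear_maps_def compose_def PiE_iff extensional_def)
  qed
  moreover have "comp_chain K g f (n - 1) (Diff K n x) = Diff N n (comp_chain K g f n x)"
    if x: "x \<in> carrier (Deg K n)" for n x
    using x f g linear_maps_funcset[OF d x] linear_maps_funcset[OF f' x]
    by (simp add: comp_chain_def compose_def chain_maps_def)
  ultimately show ?thesis by (simp add: chain_maps_def)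
qed

lemma comp_chain_assoc:
  assumes "f \<in> chain_maps R K L"
  shows "comp_chain K h (comp_chain K g f) = comp_chain K (comp_chain L h g) f"
proof -
  have "f n \<in> linear_maps R (Deg K n) (Deg L n)" for n
    using assms by (auto simp: chain_maps_def)
  then show ?thesis
    by (auto simp: comp_chain_def compose_def fun_eq_iff dest: linear_maps_funcset)
qed

lemma comp_chain_id_right:
  assumes "f \<in> chain_maps R K L"
  shows "comp_chain K f (id_chain K) = f"
proof -
  have "f n \<in> extensional (carrier (Deg K n))" for n
    using assms by (auto simp: chain_maps_def linear_maps_def PiE_iff)
  then show ?thesis
    by (auto simp: comp_chain_def compose_def id_chain_def fun_eq_iff extensional_def)
qed

lemma comp_chain_id_left:
  assumes "f \<in> chain_maps R K L"
  shows "comp_chain K (id_chain L) f = f"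
proof -
  have "f n \<in> carrier (Deg K n) \<rightarrow>\<^sub>E carrier (Deg L n)" for n
    using assms by (auto simp: chain_maps_def linear_maps_def)
  then show ?thesis
    by (auto simp: comp_chain_def compose_def id_chain_def fun_eq_iff PiE_iff extensional_def)
qed

lemma cpresheaf_maps_id:
  assumes "category C" "is_cpresheaf \<kappa> C R X"
  shows "(\<lambda>c\<in>Ob C. id_chain (Val X c)) \<in> cpresheaf_maps C R X X"
proof -
  interpret category C by fact
  show ?thesis
    using assms(2)
    by (auto simp: cpresheaf_maps_def is_cpresheaf_def Dom_in_Ob Cod_in_Ob
        comp_chain_id_left comp_chain_id_right intro!: id_chain_in_chain_maps)
qed

lemma cpresheaf_maps_comp:
  assumes C: "category C" and X: "is_cpresheaf \<kappa> C R X" and Y: "is_cpresheaf \<kappa> C R Y"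
    and f: "\<phi> \<in> cpresheaf_maps C R X Y" and g: "\<psi> \<in> cpresheaf_maps C R Y Z"
  shows "(\<lambda>c\<in>Ob C. comp_chain (Val X c) (\<psi> c) (\<phi> c)) \<in> cpresheaf_maps C R X Z"
proof -
  interpret category C by fact
  have "comp_chain (Val X (Cod C f)) (comp_chain (Val X (Dom C f)) (\<psi> (Dom C f)) (\<phi> (Dom C f))) (Res X f)
      = comp_chain (Val X (Cod C f)) (Res Z f) (comp_chain (Val X (Cod C f)) (\<psi> (Cod C f)) (\<phi> (Cod C f)))"
    (is "?l = ?r") if m: "f \<in> Mor C" for f
  proof -
    have o: "Dom C f \<in> Ob C" "Cod C f \<in> Ob C" using m Dom_in_Ob Cod_in_Ob by auto
    have RX: "Res X f \<in> chain_maps R (Val X (Cod C f)) (Val X (Dom C f))"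
      using X m by (auto simp: is_cpresheaf_def)
    have p: "\<phi> c \<in> chain_maps R (Val X c) (Val Y c)" if "c \<in> Ob C" for c
      using f that by (auto simp: cpresheaf_maps_def)
    have n1: "comp_chain (Val X (Cod C f)) (\<phi> (Dom C f)) (Res X f) =
                comp_chain (Val X (Cod C f)) (Res Y f) (\<phi> (Cod C f))"
      using f m by (auto simp: cpresheaf_maps_def)
    have n2: "comp_chain (Val Y (Cod C f)) (\<psi> (Dom C f)) (Res Y f) =
                comp_chain (Val Y (Cod C f)) (Res Z f) (\<psi> (Cod C f))"
      using g m by (auto simp: cpresheaf_maps_def)
    have "?l = comp_chain (Val X (Cod C f)) (\<psi> (Dom C f))
                 (comp_chain (Val X (Cod C f)) (\<phi> (Dom C f)) (Res X f))"
      by (rule comp_chain_assoc[OF RX, symmetric])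
    also have "\<dots> = comp_chain (Val X (Cod C f)) (\<psi> (Dom C f))
                 (comp_chain (Val X (Cod C f)) (Res Y f) (\<phi> (Cod C f)))"
      by (simp add: n1)
    also have "\<dots> = comp_chain (Val X (Cod C f))
                 (comp_chain (Val Y (Cod C f)) (Res Z f) (\<psi> (Cod C f))) (\<phi> (Cod C f))"
      by (simp add: comp_chain_assoc[OF p[OF o(2)]] n2)
    also have "\<dots> = ?r" by (simp add: comp_chain_assoc[OF p[OF o(2)]])
    finally show ?thesis .
  qed
  moreover have "comp_chain (Val X c) (\<psi> c) (\<phi> c) \<in> chain_maps R (Val X c) (Val Z c)"
    if "c \<in> Ob C" for c
    using that X f g
    by (auto simp: is_cpresheaf_def cpresheaf_maps_def intro!: comp_chain_in_chain_maps)
  ultimately show ?thesis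
    by (auto simp: cpresheaf_maps_def Dom_in_Ob Cod_in_Ob)
qed

lemma category_UCat:
  assumes C: "category C"
  shows "category (UCat \<kappa> C R)"
proof (unfold_locales, goal_cases)
  case (5 f a b)
  then show ?case
    by (auto simp: UCat_def Hom_def cpresheaf_maps_def comp_chain_id_right
        intro!: extensionalityI[of _ "Ob C"])
next
  case (6 f a b)
  then show ?case
    by (auto simp: UCat_def Hom_def cpresheaf_maps_def comp_chain_id_left
        intro!: extensionalityI[of _ "Ob C"])
next
  case (7 f a b g c h d)
  then show ?case
    by (auto simp: UCat_def Hom_def cpresheaf_maps_def intro!: restrict_ext comp_chain_assoc)
qed (auto simp: UCat_def Hom_def intro: cpresheaf_maps_id[OF C] cpresheaf_maps_comp[OF C])


section \<open>The projective model structure\<close>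

definition weak_equivalence ::
  "'u rel \<Rightarrow> ('o, 'm) category \<Rightarrow> ('r, 's) ring_scheme \<Rightarrow> ('o, 'm, 'r, 'u) cpresheaf_arrow \<Rightarrow> bool" where
  "weak_equivalence \<kappa> C R = (\<lambda>(X, Y, \<phi>). (X, Y, \<phi>) \<in> Mor (UCat \<kappa> C R) \<and>
     (\<forall>c\<in>Ob C. quasi_iso (Val X c) (Val Y c) (\<phi> c)))"

definition fibration ::
  "'u rel \<Rightarrow> ('o, 'm) category \<Rightarrow> ('r, 's) ring_scheme \<Rightarrow> ('o, 'm, 'r, 'u) cpresheaf_arrow \<Rightarrow> bool" where
  "fibration \<kappa> C R = (\<lambda>(X, Y, \<phi>). (X, Y, \<phi>) \<in> Mor (UCat \<kappa> C R) \<and>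
     (\<forall>c\<in>Ob C. \<forall>n. \<phi> c n ` carrier (Deg (Val X c) n) = carrier (Deg (Val Y c) n)))"

definition trivial_fibration ::
  "'u rel \<Rightarrow> ('o, 'm) category \<Rightarrow> ('r, 's) ring_scheme \<Rightarrow> ('o, 'm, 'r, 'u) cpresheaf_arrow \<Rightarrow> bool" where
  "trivial_fibration \<kappa> C R p \<longleftrightarrow> fibration \<kappa> C R p \<and> weak_equivalence \<kappa> C R p"

definition cofibration ::
  "'u rel \<Rightarrow> ('o, 'm) category \<Rightarrow> ('r, 's) ring_scheme \<Rightarrow> ('o, 'm, 'r, 'u) cpresheaf_arrow \<Rightarrow> bool" where
  "cofibration \<kappa> C R i \<longleftrightarrow> i \<in> Mor (UCat \<kappa> C R) \<and>
     (\<forall>p. trivial_fibration \<kappa> C R p \<longrightarrow> lifting (UCat \<kappa> C R) i p)"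

definition projective_cofibrant ::
  "'u rel \<Rightarrow> ('o, 'm) category \<Rightarrow> ('r, 's) ring_scheme \<Rightarrow> ('o, 'm, 'r, 'u) cpresheaf \<Rightarrow> bool" where
  "projective_cofibrant \<kappa> C R X \<longleftrightarrow> X \<in> Ob (UCat \<kappa> C R) \<and>
     (\<exists>Z i. initial (UCat \<kappa> C R) Z \<and> i \<in> Hom (UCat \<kappa> C R) Z X \<and> cofibration \<kappa> C R i)"

definition complex_of_semi_representables ::
  "'u rel \<Rightarrow> ('o, 'm) category \<Rightarrow> ('r, 's) ring_scheme \<Rightarrow> ('o, 'm, 'r, 'u) cpresheaf \<Rightarrow> bool" where
  "complex_of_semi_representables \<kappa> C R X \<longleftrightarrow> X \<in> Ob (UCat \<kappa> C R) \<and>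
     (\<forall>n. semi_representable \<kappa> C R (degree_presheaf X n))"

definition cofibrant_replacement_functor ::
  "'u rel \<Rightarrow> ('o, 'm) category \<Rightarrow> ('r, 's) ring_scheme \<Rightarrow>
   (('o, 'm, 'r, 'u) cpresheaf \<Rightarrow> ('o, 'm, 'r, 'u) cpresheaf) \<Rightarrow>
   (('o, 'm, 'r, 'u) cpresheaf_arrow \<Rightarrow> ('o, 'm, 'r, 'u) cpresheaf_arrow) \<Rightarrow>
   (('o, 'm, 'r, 'u) cpresheaf \<Rightarrow> ('o, 'm, 'r, 'u) cpresheaf_arrow) \<Rightarrow> bool" where
  "cofibrant_replacement_functor \<kappa> C R Qo Qm q \<longleftrightarrow>
     is_functor (UCat \<kappa> C R) (UCat \<kappa> C R) Qo Qm \<and>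
     is_nat_trans (UCat \<kappa> C R) (UCat \<kappa> C R) Qo Qm (\<lambda>X. X) (\<lambda>f. f) q \<and>
     (\<forall>X\<in>Ob (UCat \<kappa> C R). projective_cofibrant \<kappa> C R (Qo X) \<and> trivial_fibration \<kappa> C R (q X))"

end

theory Submission
  imports Defs
begin

text \<open>
  A map of complexes is surjective and a quasi-isomorphism exactly if it fills spheres: for every
  cycle \<open>z\<close> upstairs and every \<open>x\<close> downstairs whose differential is the image of \<open>z\<close>, some \<open>y\<close> over \<open>x\<close>
  has differential \<open>z\<close> (\<open>fills_spheres_surj\<close>, \<open>fills_spheres_quasi_iso\<close> and
  \<open>surj_quasi_iso_fills_spheres\<close>). The small object argument for the inclusions of spheres into disks
  would therefore produce \<open>Q X\<close> by attaching, again and again, one new free generator for every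
  sphere that has to be filled; as a cycle involves only finitely many generators, countably many
  rounds suffice.

  The proof performs all rounds at once. A generator, here called a cell, is a finite tree that
  records the filling problem it solves: an object \<open>c\<close>, a degree \<open>n\<close>, a section \<open>x\<close> of \<open>X\<close> in degree
  \<open>n\<close> over \<open>c\<close>, and a formal linear combination \<open>l\<close> of restrictions of other cells that is to be its
  boundary. It is valid if \<open>l\<close> is a cycle which \<open>Q X \<rightarrow> X\<close> maps to the differential of \<open>x\<close>. In
  degree \<open>n\<close> and over \<open>c\<close>, \<open>Q X\<close> is the free module on the pairs of a valid cell of degree \<open>n\<close> and an
  arrow from \<open>c\<close> to the object of the cell, so that degreewise \<open>Q X\<close> is a coproduct of
  representables by construction. The augmentation \<open>Q X \<rightarrow> X\<close> sends a cell to its section, and it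
  fills spheres for a tautological reason: the problem \<open>(z, x)\<close> is solved by the cell which records
  it (\<open>augmentation_fills_spheres\<close>).

  Everything else comes from the universal property of \<open>Q X\<close>: a map \<open>Q X \<rightarrow> Y\<close> is the same as a
  choice of values on the cells that respects their boundaries (\<open>cell_map_is_map\<close>,
  \<open>resolution_map_eqI\<close>). A map \<open>X \<rightarrow> Y\<close> relabels the sections recorded in the cells of \<open>X\<close>, which
  makes \<open>Q\<close> a functor. Given a trivial fibration and a map from \<open>Q X\<close> to its target, a lift is chosen
  by recursion over cells: the lifts of the cells in the boundary of \<open>g\<close> combine to a cycle, and any
  filling of it over the image of \<open>g\<close> is an admissible value at \<open>g\<close> (\<open>lift_cell_works\<close>). Since the
  initial complex is zero, these lifts say that \<open>Q X\<close> is cofibrant.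

  It remains to fit \<open>Q X\<close> into the given type of sections. Cells are finite trees labelled by small
  sets, so they form a small set, and all free modules in sight are small. Each of them is carried
  over into \<open>'u\<close> along an injection that depends only on its index set; this makes \<open>Q X\<close> a
  function of \<open>X\<close>, and the module so obtained is used only through its basis.
\<close>

section \<open>Small sets\<close>

lemma small_subset: "small \<kappa> B \<Longrightarrow> A \<subseteq> B \<Longrightarrow> small \<kappa> A"
  unfolding small_def by (meson card_of_mono1 ordLeq_ordLess_trans)

lemma small_image: "small \<kappa> A \<Longrightarrow> small \<kappa> (f ` A)"
  unfolding small_def by (meson card_of_image ordLeq_ordLess_trans)

lemma universe_Cinfinite: "universe \<kappa> \<Longrightarrow> Cinfinite \<kappa>"
  unfolding universe_def using cinfinite_mono natLeq_cinfinite ordLess_imp_ordLeq by blast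

lemma small_finite:
  assumes "universe \<kappa>" "finite A" shows "small \<kappa> A"
proof -
  have "|A| <o natLeq" using assms(2) by (rule finite_iff_ordLess_natLeq[THEN iffD1])
  then show ?thesis
    using assms(1) ordLess_transitive unfolding universe_def small_def by blast
qed

lemma small_countable:
  assumes "universe \<kappa>" shows "small \<kappa> (range (f :: nat \<Rightarrow> 'a))"
proof -
  have "small \<kappa> (UNIV :: nat set)"
    using assms card_of_nat ordIso_ordLess_trans unfolding small_def universe_def by blast
  then show ?thesis by (rule small_image)
qed

text \<open>
  Regularity of the cardinal enters here. Its uncountability adds the case of countable unions, and
  together they make the small sets closed under forming finite lists.
\<close>

lemma small_UN:
  assumes "universe \<kappa>" "small \<kappa> I" "\<And>i. i \<in> I \<Longrightarrow> small \<kappa> (A i)"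
  shows "small \<kappa> (\<Union>i\<in>I. A i)"
  using assms card_of_UNION_ordLess_infinite_Field_regularCard[of \<kappa> I A] universe_Cinfinite
  unfolding small_def universe_def by blast

lemma small_Sigma:
  assumes "universe \<kappa>" "small \<kappa> A" "\<And>a. a \<in> A \<Longrightarrow> small \<kappa> (B a)"
  shows "small \<kappa> (Sigma A B)"
proof -
  have "small \<kappa> (\<Union>a\<in>A. Pair a ` B a)"
    using assms by (intro small_UN small_image)
  then show ?thesis by (rule small_subset) auto
qed

lemma small_lists:
  assumes "universe \<kappa>" "small \<kappa> A" shows "small \<kappa> (lists A)"
proof -
  have *: "small \<kappa> {l \<in> lists A. length l = n}" for n
  proof (induction n)
    case 0
    have "{l \<in> lists A. length l = 0} \<subseteq> {[]}" by auto
    then show ?case by (rule small_subset[OF small_finite[OF assms(1)], rotated]) simp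
  next
    case (Suc n)
    have "{l \<in> lists A. length l = Suc n} \<subseteq> (\<lambda>(a, l). a # l) ` (A \<times> {l \<in> lists A. length l = n})"
      by (auto simp: length_Suc_conv image_iff)
    then show ?case
      by (rule small_subset[rotated]) (intro small_image small_Sigma assms Suc)
  qed
  have "small \<kappa> (\<Union>n\<in>range (\<lambda>n. n). {l \<in> lists A. length l = n})"
    by (intro small_UN small_countable assms(1) *)
  then show ?thesis by (rule small_subset) auto
qed

text \<open>
  The injection is a function of the set alone. Constructions that use it are therefore functions
  of their data, as strict functoriality demands.
\<close>

definition embedding :: "'a set \<Rightarrow> 'a \<Rightarrow> 'u" where
  "embedding A = (SOME j. inj_on j A)"

lemma inj_on_embedding:
  fixes \<kappa> :: "'u rel" and A :: "'a set"
  assumes "universe \<kappa>" "small \<kappa> A"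
  shows "inj_on (embedding A :: 'a \<Rightarrow> 'u) A"
proof -
  have "\<kappa> =o |Field \<kappa>|"
    using assms(1) card_of_Field_ordIso ordIso_symmetric unfolding universe_def by blast
  then have "\<kappa> \<le>o |UNIV :: 'u set|"
    using ordIso_ordLeq_trans[OF _ card_of_mono1[OF subset_UNIV]] by blast
  then have "|A| \<le>o |UNIV :: 'u set|"
    using assms(2) ordLess_imp_ordLeq ordLeq_transitive unfolding small_def by blast
  then obtain j :: "'a \<Rightarrow> 'u" where "inj_on j A"
    by (metis card_of_ordLeq[of A "UNIV :: 'u set"])
  then show ?thesis unfolding embedding_def by (rule someI[of "\<lambda>j. inj_on j A"])
qed


section \<open>Linear combinations and linear maps\<close>

text \<open>
  Linear combinations are indexed by lists, in which a basis element may occur several times. A list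
  can be an argument of a datatype constructor, and it needs no decision about when coefficients are
  equal.
\<close>

definition lincomb :: "('r, 'x) module \<Rightarrow> ('b \<Rightarrow> 'x) \<Rightarrow> ('r \<times> 'b) list \<Rightarrow> 'x" where
  "lincomb M F l = foldr (\<lambda>(r, b) s. r \<odot>\<^bsub>M\<^esub> F b \<oplus>\<^bsub>M\<^esub> s) l \<zero>\<^bsub>M\<^esub>"

definition coeff :: "('r, 's) ring_scheme \<Rightarrow> ('r \<times> 'b) list \<Rightarrow> 'b \<Rightarrow> 'r" where
  "coeff R l b = lincomb (regular_module R) (\<lambda>b'. if b' = b then \<one>\<^bsub>R\<^esub> else \<zero>\<^bsub>R\<^esub>) l"

text \<open>
  A statement about coefficients only: it makes sense before any module containing the symbols \<open>b\<close>
  has been formed, and it forces the linear combination to vanish in every such module.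
\<close>

definition null_combination :: "('r, 's) ring_scheme \<Rightarrow> ('r \<times> 'b) list \<Rightarrow> bool" where
  "null_combination R l \<longleftrightarrow> (\<forall>b. coeff R l b = \<zero>\<^bsub>R\<^esub>)"

lemma lincomb_Nil [simp]: "lincomb M F [] = \<zero>\<^bsub>M\<^esub>"
  and lincomb_Cons [simp]: "lincomb M F ((r, b) # l) = r \<odot>\<^bsub>M\<^esub> F b \<oplus>\<^bsub>M\<^esub> lincomb M F l"
  by (simp_all add: lincomb_def)

lemma lincomb_cong:
  assumes "\<And>r b. (r, b) \<in> set l \<Longrightarrow> F b = G b"
  shows "lincomb M F l = lincomb M G l"
  using assms by (induction l) (auto, metis)

lemma lincomb_map: "lincomb M F (map (map_prod id p) l) = lincomb M (\<lambda>b. F (p b)) l"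
  by (induction l) auto

lemma lincomb_closed:
  assumes "module R M" "set l \<subseteq> carrier R \<times> B" "F \<in> B \<rightarrow> carrier M"
  shows "lincomb M F l \<in> carrier M"
proof -
  interpret module R M by fact
  show ?thesis using assms(2,3) by (induction l) (auto simp: Pi_iff)
qed

lemma lincomb_append:
  assumes "module R M" "set l \<subseteq> carrier R \<times> B" "set l' \<subseteq> carrier R \<times> B" "F \<in> B \<rightarrow> carrier M"
  shows "lincomb M F (l @ l') = lincomb M F l \<oplus>\<^bsub>M\<^esub> lincomb M F l'"
proof -
  interpret module R M by fact
  show ?thesis using assms(2)
  proof (induction l)
    case Nil
    then show ?case using lincomb_closed[OF assms(1,3,4)] by simp
  next
    case (Cons a l)
    obtain r b where a: "a = (r, b)" by force
    have "lincomb M F l \<in> carrier M" "lincomb M F l' \<in> carrier M"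
      using lincomb_closed[OF assms(1) _ assms(4)] Cons.prems assms(3) by auto
    then show ?case using Cons a assms(4) by (auto simp: M.a_assoc Pi_iff)
  qed
qed

lemma lincomb_scale:
  assumes "module R M" "set l \<subseteq> carrier R \<times> B" "F \<in> B \<rightarrow> carrier M" "a \<in> carrier R"
  shows "lincomb M F (map (map_prod ((\<otimes>\<^bsub>R\<^esub>) a) id) l) = a \<odot>\<^bsub>M\<^esub> lincomb M F l"
proof -
  interpret module R M by fact
  show ?thesis using assms(2)
  proof (induction l)
    case Nil
    then show ?case using assms(4) by simp
  next
    case (Cons x l)
    obtain r b where x: "x = (r, b)" by force
    have "lincomb M F l \<in> carrier M"
      using lincomb_closed[OF assms(1) _ assms(3)] Cons.prems by auto
    then show ?case using Cons x assms(3,4) by (auto simp: smult_r_distr smult_assoc1 Pi_iff)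
  qed
qed

lemma linear_mapsD:
  assumes "f \<in> linear_maps R M N"
  shows "x \<in> carrier M \<Longrightarrow> f x \<in> carrier N"
    and "x \<in> carrier M \<Longrightarrow> y \<in> carrier M \<Longrightarrow> f (x \<oplus>\<^bsub>M\<^esub> y) = f x \<oplus>\<^bsub>N\<^esub> f y"
    and "a \<in> carrier R \<Longrightarrow> x \<in> carrier M \<Longrightarrow> f (a \<odot>\<^bsub>M\<^esub> x) = a \<odot>\<^bsub>N\<^esub> f x"
    and "x \<notin> carrier M \<Longrightarrow> f x = undefined"
    and "f \<in> carrier M \<rightarrow>\<^sub>E carrier N"
  using assms by (auto simp: linear_maps_def)

lemma linear_maps_zero:
  assumes "module R M" "module R N" "f \<in> linear_maps R M N"
  shows "f \<zero>\<^bsub>M\<^esub> = \<zero>\<^bsub>N\<^esub>"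
proof -
  interpret M: module R M by fact
  interpret N: module R N by fact
  have "f (\<zero>\<^bsub>R\<^esub> \<odot>\<^bsub>M\<^esub> \<zero>\<^bsub>M\<^esub>) = \<zero>\<^bsub>R\<^esub> \<odot>\<^bsub>N\<^esub> f \<zero>\<^bsub>M\<^esub>"
    using linear_mapsD(3)[OF assms(3)] by blast
  then show ?thesis using linear_mapsD(1)[OF assms(3)] by simp
qed

lemma linear_maps_neg:
  assumes "module R M" "module R N" "f \<in> linear_maps R M N" "x \<in> carrier M"
  shows "f (\<ominus>\<^bsub>M\<^esub> x) = \<ominus>\<^bsub>N\<^esub> f x"
proof -
  interpret M: module R M by fact
  interpret N: module R N by fact
  have "f x \<oplus>\<^bsub>N\<^esub> f (\<ominus>\<^bsub>M\<^esub> x) = \<zero>\<^bsub>N\<^esub>"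
    using linear_mapsD(2)[OF assms(3), of x "\<ominus>\<^bsub>M\<^esub> x"] assms linear_maps_zero[OF assms(1-3)]
    by (simp add: M.r_neg)
  then show ?thesis
    using linear_mapsD(1)[OF assms(3)] assms(4) by (metis M.a_inv_closed N.minus_equality N.a_comm)
qed

lemma linear_map_lincomb:
  assumes "module R M" "module R N" "f \<in> linear_maps R M N" "set l \<subseteq> carrier R \<times> B" "F \<in> B \<rightarrow> carrier M"
  shows "f (lincomb M F l) = lincomb N (\<lambda>b. f (F b)) l"
proof -
  interpret M: module R M by fact
  interpret N: module R N by fact
  show ?thesis using assms(4)
  proof (induction l)
    case Nil
    then show ?case by (simp add: linear_maps_zero[OF assms(1-3)])
  next
    case (Cons x l)
    obtain r b where x: "x = (r, b)" by force
    have "lincomb M F l \<in> carrier M"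
      using lincomb_closed[OF assms(1) _ assms(5)] Cons.prems by auto
    then show ?case using Cons x assms(5) linear_mapsD[OF assms(3)] by (auto simp: Pi_iff)
  qed
qed

lemma module_regular_module:
  assumes "cring R" shows "module R (regular_module R)"
proof -
  interpret cring R by fact
  show ?thesis
    by (rule moduleI)
      (auto simp: regular_module_def m_assoc l_distr r_distr a_ac is_cring
        intro!: abelian_groupI bexI[where x="\<ominus>\<^bsub>R\<^esub> _"] l_neg)
qed

lemma coeff_Nil [simp]: "coeff R [] b = \<zero>\<^bsub>R\<^esub>"
  by (simp add: coeff_def regular_module_def)

lemma coeff_Cons [simp]:
  assumes "cring R" "r \<in> carrier R" "set l \<subseteq> carrier R \<times> B"
  shows "coeff R ((r, b') # l) b = (if b' = b then r else \<zero>\<^bsub>R\<^esub>) \<oplus>\<^bsub>R\<^esub> coeff R l b"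
proof -
  interpret cring R by fact
  show ?thesis using assms by (simp add: coeff_def regular_module_def)
qed

lemma coeff_closed:
  assumes "cring R" "set l \<subseteq> carrier R \<times> B"
  shows "coeff R l b \<in> carrier R"
proof -
  interpret cring R by fact
  show ?thesis
    using lincomb_closed[OF module_regular_module[OF assms(1)] assms(2)]
    by (auto simp: coeff_def regular_module_def)
qed

text \<open>
  Gathering equal terms. This is the step from lists to coefficients, on which the
  well-definedness of linear extensions rests.
\<close>

lemma lincomb_finsum:
  assumes "module R M" "finite S" "S \<subseteq> B" "set l \<subseteq> carrier R \<times> S" "F \<in> B \<rightarrow> carrier M"
  shows "lincomb M F l = (\<Oplus>\<^bsub>M\<^esub>b\<in>S. coeff R l b \<odot>\<^bsub>M\<^esub> F b)"
proof -
  interpret module R M by fact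
  have F: "F b \<in> carrier M" if "b \<in> S" for b using assms that by auto
  show ?thesis using assms(4)
  proof (induction l)
    case Nil
    have "(\<Oplus>\<^bsub>M\<^esub>b\<in>S. \<zero>\<^bsub>R\<^esub> \<odot>\<^bsub>M\<^esub> F b) = (\<Oplus>\<^bsub>M\<^esub>b\<in>S. \<zero>\<^bsub>M\<^esub>)"
      using F by (intro M.finsum_cong') (auto simp: Pi_iff)
    then show ?case by simp
  next
    case (Cons x l)
    obtain r b where x: "x = (r, b)" by force
    have rb: "r \<in> carrier R" "b \<in> S" "set l \<subseteq> carrier R \<times> S" using Cons.prems x by auto
    note c = coeff_closed[OF R.is_cring rb(3)]
    have "(\<Oplus>\<^bsub>M\<^esub>b'\<in>S. coeff R (x # l) b' \<odot>\<^bsub>M\<^esub> F b')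
        = (\<Oplus>\<^bsub>M\<^esub>b'\<in>S. (if b = b' then r \<odot>\<^bsub>M\<^esub> F b' else \<zero>\<^bsub>M\<^esub>) \<oplus>\<^bsub>M\<^esub> coeff R l b' \<odot>\<^bsub>M\<^esub> F b')"
      using F rb c by (intro M.finsum_cong') (auto simp: x R.is_cring smult_l_distr)
    also have "\<dots> = (\<Oplus>\<^bsub>M\<^esub>b'\<in>S. if b = b' then r \<odot>\<^bsub>M\<^esub> F b' else \<zero>\<^bsub>M\<^esub>) \<oplus>\<^bsub>M\<^esub> (\<Oplus>\<^bsub>M\<^esub>b'\<in>S. coeff R l b' \<odot>\<^bsub>M\<^esub> F b')"
      using F rb c by (intro M.finsum_addf) auto
    also have "(\<Oplus>\<^bsub>M\<^esub>b'\<in>S. if b = b' then r \<odot>\<^bsub>M\<^esub> F b' else \<zero>\<^bsub>M\<^esub>) = r \<odot>\<^bsub>M\<^esub> F b"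
      using F rb assms(2) by (intro M.add.finprod_singleton) auto
    finally show ?case using Cons.IH[OF rb(3)] x by simp
  qed
qed

lemma lincomb_eq_of_coeff:
  assumes "module R M" "set l \<subseteq> carrier R \<times> B" "set l' \<subseteq> carrier R \<times> B" "F \<in> B \<rightarrow> carrier M"
    and "\<And>b. b \<in> B \<Longrightarrow> coeff R l b = coeff R l' b"
  shows "lincomb M F l = lincomb M F l'"
proof -
  interpret module R M by fact
  let ?S = "snd ` set l \<union> snd ` set l'"
  have S: "?S \<subseteq> B" using assms(2,3) by auto
  have l: "set l \<subseteq> carrier R \<times> ?S" "set l' \<subseteq> carrier R \<times> ?S" using assms(2,3) by force+
  have "lincomb M F l = (\<Oplus>\<^bsub>M\<^esub>b\<in>?S. coeff R l b \<odot>\<^bsub>M\<^esub> F b)"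
    using assms(1,4) S l by (intro lincomb_finsum[of R M ?S B]) auto
  also have "\<dots> = (\<Oplus>\<^bsub>M\<^esub>b\<in>?S. coeff R l' b \<odot>\<^bsub>M\<^esub> F b)"
    using S assms by (intro M.finsum_cong' refl) (auto intro!: smult_closed coeff_closed R.is_cring)
  also have "\<dots> = lincomb M F l'"
    using assms(1,4) S l by (intro lincomb_finsum[of R M ?S B, symmetric]) auto
  finally show ?thesis .
qed

lemma lincomb_null:
  assumes "module R M" "set l \<subseteq> carrier R \<times> B" "F \<in> B \<rightarrow> carrier M" "null_combination R l"
  shows "lincomb M F l = \<zero>\<^bsub>M\<^esub>"
  using lincomb_eq_of_coeff[OF assms(1,2) _ assms(3), of "[]"] assms(4)
  by (simp add: null_combination_def)

text \<open>
  Renaming symbols, even if distinct ones become equal, only adds coefficients up.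
\<close>

lemma null_combination_map:
  assumes "cring R" "set l \<subseteq> carrier R \<times> B" "null_combination R l"
  shows "null_combination R (map (map_prod id p) l)"
proof -
  interpret cring R by fact
  have "lincomb (regular_module R) (\<lambda>b'. if p b' = b then \<one>\<^bsub>R\<^esub> else \<zero>\<^bsub>R\<^esub>) l = \<zero>\<^bsub>R\<^esub>" for b
    by (subst lincomb_null[OF module_regular_module[OF assms(1)] assms(2) _ assms(3)])
      (auto simp: regular_module_def)
  then show ?thesis by (simp add: null_combination_def coeff_def lincomb_map)
qed


section \<open>Bases and free modules\<close>

text \<open>
  A module may be replaced by an isomorphic copy inside another type, so freeness is expressed by a
  basis map \<open>e\<close> rather than by a concrete model.
\<close>

definition is_basis :: "('r, 's) ring_scheme \<Rightarrow> ('r, 'x) module \<Rightarrow> 'b set \<Rightarrow> ('b \<Rightarrow> 'x) \<Rightarrow> bool" where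
  "is_basis R M B e \<longleftrightarrow> module R M \<and> e \<in> B \<rightarrow> carrier M \<and>
     (\<forall>x\<in>carrier M. \<exists>l. set l \<subseteq> carrier R \<times> B \<and> lincomb M e l = x) \<and>
     (\<forall>l l'. set l \<subseteq> carrier R \<times> B \<longrightarrow> set l' \<subseteq> carrier R \<times> B \<longrightarrow>
        lincomb M e l = lincomb M e l' \<longrightarrow> coeff R l = coeff R l')"

text \<open>
  The value is read off from an arbitrary list expressing the argument; all such lists give the
  same value because they have the same coefficients.
\<close>

definition linear_extension ::
  "('r, 's) ring_scheme \<Rightarrow> ('r, 'x) module \<Rightarrow> 'b set \<Rightarrow> ('b \<Rightarrow> 'x) \<Rightarrow> ('r, 'y) module \<Rightarrow> ('b \<Rightarrow> 'y) \<Rightarrow>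
   'x \<Rightarrow> 'y" where
  "linear_extension R M B e N F =
     (\<lambda>x\<in>carrier M. lincomb N F (SOME l. set l \<subseteq> carrier R \<times> B \<and> lincomb M e l = x))"

lemma is_basisD:
  assumes "is_basis R M B e"
  shows "module R M" and "e \<in> B \<rightarrow> carrier M" and "b \<in> B \<Longrightarrow> e b \<in> carrier M"
  using assms by (auto simp: is_basis_def)

lemma is_basisI:
  assumes "module R M" and "\<And>b. b \<in> B \<Longrightarrow> e b \<in> carrier M"
    and "\<And>x. x \<in> carrier M \<Longrightarrow> \<exists>l. set l \<subseteq> carrier R \<times> B \<and> lincomb M e l = x"
    and "\<And>l l'. set l \<subseteq> carrier R \<times> B \<Longrightarrow> set l' \<subseteq> carrier R \<times> B \<Longrightarrow>
      lincomb M e l = lincomb M e l' \<Longrightarrow> coeff R l = coeff R l'"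
  shows "is_basis R M B e"
  unfolding is_basis_def using assms by (intro conjI ballI allI impI Pi_I) blast+

lemma basis_span:
  assumes "is_basis R M B e" "x \<in> carrier M"
  obtains l where "set l \<subseteq> carrier R \<times> B" "x = lincomb M e l"
  using assms unfolding is_basis_def by metis

lemma basis_null_combination:
  assumes "is_basis R M B e" "set l \<subseteq> carrier R \<times> B"
  shows "lincomb M e l = \<zero>\<^bsub>M\<^esub> \<longleftrightarrow> null_combination R l"
proof
  assume "lincomb M e l = \<zero>\<^bsub>M\<^esub>"
  then have "lincomb M e l = lincomb M e []" by simp
  then have "coeff R l = coeff R []"
    using assms unfolding is_basis_def by (metis empty_set empty_subsetI)
  then show "null_combination R l" by (simp add: null_combination_def)
next
  assume "null_combination R l"
  then show "lincomb M e l = \<zero>\<^bsub>M\<^esub>"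
    using lincomb_null[OF is_basisD(1)[OF assms(1)] assms(2) is_basisD(2)[OF assms(1)]] by simp
qed

lemma linear_extension_lincomb:
  assumes e: "is_basis R M B e" and N: "module R N" and F: "F \<in> B \<rightarrow> carrier N"
    and l: "set l \<subseteq> carrier R \<times> B"
  shows "linear_extension R M B e N F (lincomb M e l) = lincomb N F l"
proof -
  let ?P = "\<lambda>l'. set l' \<subseteq> carrier R \<times> B \<and> lincomb M e l' = lincomb M e l"
  have P: "?P (SOME l'. ?P l')" by (rule someI[of ?P l]) (simp add: l)
  then have "coeff R (SOME l'. ?P l') = coeff R l"
    using e l unfolding is_basis_def by blast
  then have "lincomb N F (SOME l'. ?P l') = lincomb N F l"
    using P by (intro lincomb_eq_of_coeff[OF N _ l F]) auto
  then show ?thesis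
    using lincomb_closed[OF is_basisD(1)[OF e] l is_basisD(2)[OF e]] by (simp add: linear_extension_def)
qed

lemma linear_extension_basis:
  assumes e: "is_basis R M B e" and N: "module R N" and F: "F \<in> B \<rightarrow> carrier N" and b: "b \<in> B"
  shows "linear_extension R M B e N F (e b) = F b"
proof -
  interpret M: module R M by (rule is_basisD[OF e])
  interpret N: module R N by (rule N)
  have "linear_extension R M B e N F (lincomb M e [(\<one>\<^bsub>R\<^esub>, b)]) = lincomb N F [(\<one>\<^bsub>R\<^esub>, b)]"
    using b by (intro linear_extension_lincomb[OF e N F]) simp
  then show ?thesis using is_basisD(3)[OF e b] F b by (auto simp: Pi_iff)
qed

lemma linear_extension_linear:
  assumes e: "is_basis R M B e" and N: "module R N" and F: "F \<in> B \<rightarrow> carrier N"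
  shows "linear_extension R M B e N F \<in> linear_maps R M N"
proof -
  let ?f = "linear_extension R M B e N F"
  note M = is_basisD(1)[OF e] and eB = is_basisD(2)[OF e]
  interpret M: module R M by (rule M)
  have "?f x \<in> carrier N" if x: "x \<in> carrier M" for x
  proof -
    obtain l where l: "set l \<subseteq> carrier R \<times> B" "x = lincomb M e l" by (rule basis_span[OF e x])
    show ?thesis
      unfolding l(2) linear_extension_lincomb[OF e N F l(1)] by (rule lincomb_closed[OF N l(1) F])
  qed
  moreover have "?f (x \<oplus>\<^bsub>M\<^esub> y) = ?f x \<oplus>\<^bsub>N\<^esub> ?f y" if x: "x \<in> carrier M" and y: "y \<in> carrier M" for x y
  proof -
    obtain l where l: "set l \<subseteq> carrier R \<times> B" "x = lincomb M e l" by (rule basis_span[OF e x])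
    obtain k where k: "set k \<subseteq> carrier R \<times> B" "y = lincomb M e k" by (rule basis_span[OF e y])
    have "?f (lincomb M e (l @ k)) = lincomb N F (l @ k)"
      using l k by (intro linear_extension_lincomb[OF e N F]) simp
    then show ?thesis
      using l k
      by (simp add: lincomb_append[OF M l(1) k(1) eB] lincomb_append[OF N l(1) k(1) F]
          linear_extension_lincomb[OF e N F])
  qed
  moreover have "?f (a \<odot>\<^bsub>M\<^esub> x) = a \<odot>\<^bsub>N\<^esub> ?f x" if a: "a \<in> carrier R" and x: "x \<in> carrier M" for a x
  proof -
    obtain l where l: "set l \<subseteq> carrier R \<times> B" "x = lincomb M e l" by (rule basis_span[OF e x])
    have "?f (lincomb M e (map (map_prod ((\<otimes>\<^bsub>R\<^esub>) a) id) l)) = lincomb N F (map (map_prod ((\<otimes>\<^bsub>R\<^esub>) a) id) l)"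
      using l a by (intro linear_extension_lincomb[OF e N F]) auto
    then show ?thesis
      using l a
      by (simp add: lincomb_scale[OF M l(1) eB] lincomb_scale[OF N l(1) F] linear_extension_lincomb[OF e N F])
  qed
  ultimately show ?thesis
    by (auto simp: linear_maps_def linear_extension_def)
qed

lemma linear_maps_eqI:
  assumes e: "is_basis R M B e" and N: "module R N"
    and f: "f \<in> linear_maps R M N" and g: "g \<in> linear_maps R M N"
    and eq: "\<And>b. b \<in> B \<Longrightarrow> f (e b) = g (e b)"
  shows "f = g"
proof
  fix x
  show "f x = g x"
  proof (cases "x \<in> carrier M")
    case True
    obtain l where l: "set l \<subseteq> carrier R \<times> B" "x = lincomb M e l" by (rule basis_span[OF e True])
    note M = is_basisD(1)[OF e] and eB = is_basisD(2)[OF e]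
    have "lincomb N (\<lambda>b. f (e b)) l = lincomb N (\<lambda>b. g (e b)) l"
      using l(1) eq by (intro lincomb_cong) auto
    then show ?thesis
      using linear_map_lincomb[OF M N f l(1) eB] linear_map_lincomb[OF M N g l(1) eB] l(2) by simp
  next
    case False
    then show ?thesis using linear_mapsD(4)[OF f] linear_mapsD(4)[OF g] by simp
  qed
qed

lemma linear_maps_compose:
  assumes "module R M" "f \<in> linear_maps R M N" "g \<in> linear_maps R N P"
  shows "compose (carrier M) g f \<in> linear_maps R M P"
proof -
  interpret module R M by fact
  show ?thesis
    using linear_mapsD[OF assms(2)] linear_mapsD[OF assms(3)]
    by (auto simp: linear_maps_def compose_def)
qed

lemma linear_maps_id:
  assumes "module R M"
  shows "(\<lambda>x\<in>carrier M. x) \<in> linear_maps R M M"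
proof -
  interpret module R M by fact
  show ?thesis by (auto simp: linear_maps_def)
qed

lemma linear_maps_zero_map:
  assumes "module R M" "module R N"
  shows "(\<lambda>x\<in>carrier M. \<zero>\<^bsub>N\<^esub>) \<in> linear_maps R M N"
proof -
  interpret M: module R M by fact
  interpret N: module R N by fact
  show ?thesis by (auto simp: linear_maps_def)
qed

lemma is_basis_linear_bij:
  assumes e: "is_basis R M B e" and N: "module R N"
    and j: "j \<in> linear_maps R M N" "bij_betw j (carrier M) (carrier N)"
  shows "is_basis R N B (\<lambda>b. j (e b))"
proof -
  note M = is_basisD(1)[OF e] and eB = is_basisD(2)[OF e]
  have lc: "lincomb N (\<lambda>b. j (e b)) l = j (lincomb M e l)" if "set l \<subseteq> carrier R \<times> B" for l
    by (rule linear_map_lincomb[OF M N j(1) that eB, symmetric])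
  have "\<exists>l. set l \<subseteq> carrier R \<times> B \<and> lincomb N (\<lambda>b. j (e b)) l = y" if y: "y \<in> carrier N" for y
  proof -
    obtain x where x: "x \<in> carrier M" "y = j x" using j(2) y by (auto simp: bij_betw_def)
    obtain l where "set l \<subseteq> carrier R \<times> B" "x = lincomb M e l" by (rule basis_span[OF e x(1)])
    then show ?thesis using lc x(2) by auto
  qed
  moreover have "coeff R l = coeff R l'"
    if l: "set l \<subseteq> carrier R \<times> B" "set l' \<subseteq> carrier R \<times> B"
      and eq: "lincomb N (\<lambda>b. j (e b)) l = lincomb N (\<lambda>b. j (e b)) l'" for l l'
  proof -
    have "lincomb M e l = lincomb M e l'"
      using eq lc[OF l(1)] lc[OF l(2)] j(2) lincomb_closed[OF M _ eB] l by (auto simp: bij_betw_def inj_on_def)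
    then show ?thesis using e l unfolding is_basis_def by blast
  qed
  moreover have "j (e b) \<in> carrier N" if "b \<in> B" for b
    using is_basisD(3)[OF e that] linear_mapsD(1)[OF j(1)] by blast
  ultimately show ?thesis using N by (intro is_basisI) blast+
qed

lemma coeff_outside:
  assumes "cring R" "set l \<subseteq> carrier R \<times> B" "b \<notin> B"
  shows "coeff R l b = \<zero>\<^bsub>R\<^esub>"
proof -
  interpret cring R by fact
  show ?thesis using assms(2,3)
  proof (induction l)
    case (Cons x l)
    then show ?case using coeff_Cons[OF is_cring, of _ l B] by (cases x) auto
  qed simp
qed

lemma coeff_map_inj:
  assumes "cring R" "set l \<subseteq> carrier R \<times> B" "inj_on p B" "b \<in> B"
  shows "coeff R (map (map_prod id p) l) (p b) = coeff R l b"
proof -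
  interpret cring R by fact
  show ?thesis
    unfolding coeff_def lincomb_map using assms(2-4)
    by (intro lincomb_cong) (auto simp: inj_on_def)
qed

lemma is_basis_reindex:
  assumes e: "is_basis R M B e" and p: "bij_betw p B' B"
  shows "is_basis R M B' (\<lambda>b. e (p b))"
proof -
  interpret module R M by (rule is_basisD[OF e])
  let ?m = "map (map_prod id p)"
  have m: "set (?m l) \<subseteq> carrier R \<times> B" if "set l \<subseteq> carrier R \<times> B'" for l
    using that p by (auto simp: bij_betw_def)
  have "\<exists>l. set l \<subseteq> carrier R \<times> B' \<and> lincomb M (\<lambda>b. e (p b)) l = x" if x: "x \<in> carrier M" for x
  proof -
    let ?q = "inv_into B' p"
    obtain l where l: "set l \<subseteq> carrier R \<times> B" "x = lincomb M e l" by (rule basis_span[OF e x])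
    have "lincomb M (\<lambda>b. e (p (?q b))) l = lincomb M e l"
      using l(1) p by (intro lincomb_cong) (auto simp: bij_betw_inv_into_right)
    then have "lincomb M (\<lambda>b. e (p b)) (map (map_prod id ?q) l) = x"
      using l(2) by (simp add: lincomb_map)
    moreover have "set (map (map_prod id ?q) l) \<subseteq> carrier R \<times> B'"
      using l(1) p by (force simp: bij_betw_def inv_into_into)
    ultimately show ?thesis by blast
  qed
  moreover have "coeff R l = coeff R l'"
    if l: "set l \<subseteq> carrier R \<times> B'" "set l' \<subseteq> carrier R \<times> B'"
      and eq: "lincomb M (\<lambda>b. e (p b)) l = lincomb M (\<lambda>b. e (p b)) l'" for l l'
  proof -
    have "coeff R (?m l) = coeff R (?m l')"
      using e m[OF l(1)] m[OF l(2)] eq unfolding is_basis_def lincomb_map[symmetric] by blast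
    then have "coeff R l b = coeff R l' b" if "b \<in> B'" for b
      using coeff_map_inj[OF R.is_cring l(1) _ that, of p] coeff_map_inj[OF R.is_cring l(2) _ that, of p] p
      by (simp add: bij_betw_def)
    moreover have "coeff R l b = coeff R l' b" if "b \<notin> B'" for b
      using that l by (simp add: coeff_outside[OF R.is_cring])
    ultimately show ?thesis by blast
  qed
  moreover have "e (p b) \<in> carrier M" if "b \<in> B'" for b
    using is_basisD(3)[OF e] p that by (auto simp: bij_betw_def)
  ultimately show ?thesis using is_basisD(1)[OF e] by (intro is_basisI) blast+
qed

lemma direct_sum_sel [simp]:
  "carrier (direct_sum I M) = {x \<in> (\<Pi>\<^sub>E i\<in>I. carrier (M i)). finite {i \<in> I. x i \<noteq> \<zero>\<^bsub>M i\<^esub>}}"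
  "\<zero>\<^bsub>direct_sum I M\<^esub> = (\<lambda>i\<in>I. \<zero>\<^bsub>M i\<^esub>)"
  "x \<oplus>\<^bsub>direct_sum I M\<^esub> y = (\<lambda>i\<in>I. x i \<oplus>\<^bsub>M i\<^esub> y i)"
  "a \<odot>\<^bsub>direct_sum I M\<^esub> x = (\<lambda>i\<in>I. a \<odot>\<^bsub>M i\<^esub> x i)"
  by (simp_all add: direct_sum_def)

lemma module_direct_sum:
  assumes R: "cring R" and M: "\<And>i. i \<in> I \<Longrightarrow> module R (M i)"
  shows "module R (direct_sum I M)"
proof -
  let ?D = "direct_sum I M"
  note ops = module.smult_closed[OF M] abelian_group.a_inv_closed[OF module.axioms(2)[OF M]]
    abelian_monoid.a_closed[OF abelian_group.axioms(1)[OF module.axioms(2)[OF M]]]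
    abelian_monoid.zero_closed[OF abelian_group.axioms(1)[OF module.axioms(2)[OF M]]]
  note l_zero = abelian_monoid.l_zero[OF abelian_group.axioms(1)[OF module.axioms(2)[OF M]]]
  note l_neg = abelian_group.l_neg[OF module.axioms(2)[OF M]]
  note sm0 = module.smult_r_null[OF M]
  have add: "x \<oplus>\<^bsub>?D\<^esub> y \<in> carrier ?D" if x: "x \<in> carrier ?D" and y: "y \<in> carrier ?D" for x y
  proof -
    have "{i \<in> I. x i \<oplus>\<^bsub>M i\<^esub> y i \<noteq> \<zero>\<^bsub>M i\<^esub>} \<subseteq> {i \<in> I. x i \<noteq> \<zero>\<^bsub>M i\<^esub>} \<union> {i \<in> I. y i \<noteq> \<zero>\<^bsub>M i\<^esub>}"
      using l_zero ops(4) by auto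
    then have "finite {i \<in> I. x i \<oplus>\<^bsub>M i\<^esub> y i \<noteq> \<zero>\<^bsub>M i\<^esub>}"
      by (rule finite_subset) (use x y in simp)
    then show ?thesis using x y ops(3) by (auto simp: PiE_iff cong: conj_cong)
  qed
  have smult: "a \<odot>\<^bsub>?D\<^esub> x \<in> carrier ?D" if a: "a \<in> carrier R" and x: "x \<in> carrier ?D" for a x
  proof -
    have "{i \<in> I. a \<odot>\<^bsub>M i\<^esub> x i \<noteq> \<zero>\<^bsub>M i\<^esub>} \<subseteq> {i \<in> I. x i \<noteq> \<zero>\<^bsub>M i\<^esub>}"
      using sm0 a by auto
    then have "finite {i \<in> I. a \<odot>\<^bsub>M i\<^esub> x i \<noteq> \<zero>\<^bsub>M i\<^esub>}"
      by (rule finite_subset) (use x in simp)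
    then show ?thesis using a x ops(1) by (auto simp: PiE_iff cong: conj_cong)
  qed
  have m0: "\<ominus>\<^bsub>M i\<^esub> \<zero>\<^bsub>M i\<^esub> = \<zero>\<^bsub>M i\<^esub>" if "i \<in> I" for i
  proof -
    interpret module R "M i" by (rule M[OF that])
    show ?thesis by simp
  qed
  have neg: "\<exists>y\<in>carrier ?D. y \<oplus>\<^bsub>?D\<^esub> x = \<zero>\<^bsub>?D\<^esub>" if x: "x \<in> carrier ?D" for x
  proof
    have "{i \<in> I. \<ominus>\<^bsub>M i\<^esub> x i \<noteq> \<zero>\<^bsub>M i\<^esub>} \<subseteq> {i \<in> I. x i \<noteq> \<zero>\<^bsub>M i\<^esub>}"
      using m0 by auto
    then have "finite {i \<in> I. \<ominus>\<^bsub>M i\<^esub> x i \<noteq> \<zero>\<^bsub>M i\<^esub>}"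
      by (rule finite_subset) (use x in simp)
    then show "(\<lambda>i\<in>I. \<ominus>\<^bsub>M i\<^esub> x i) \<in> carrier ?D" using x ops(2) by (auto simp: PiE_iff cong: conj_cong)
    show "(\<lambda>i\<in>I. \<ominus>\<^bsub>M i\<^esub> x i) \<oplus>\<^bsub>?D\<^esub> x = \<zero>\<^bsub>?D\<^esub>"
      using x l_neg by (auto simp: PiE_iff intro!: restrict_ext)
  qed
  have "abelian_group ?D"
  proof (rule abelian_groupI)
    show "\<zero>\<^bsub>?D\<^esub> \<in> carrier ?D" using ops(4) by (auto cong: conj_cong)
    show "x \<oplus>\<^bsub>?D\<^esub> y = y \<oplus>\<^bsub>?D\<^esub> x" if "x \<in> carrier ?D" "y \<in> carrier ?D" for x y
      using that abelian_monoid.a_comm[OF abelian_group.axioms(1)[OF module.axioms(2)[OF M]]]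
      by (auto simp: PiE_iff intro!: restrict_ext)
    show "x \<oplus>\<^bsub>?D\<^esub> y \<oplus>\<^bsub>?D\<^esub> z = x \<oplus>\<^bsub>?D\<^esub> (y \<oplus>\<^bsub>?D\<^esub> z)"
      if "x \<in> carrier ?D" "y \<in> carrier ?D" "z \<in> carrier ?D" for x y z
      using that abelian_monoid.a_assoc[OF abelian_group.axioms(1)[OF module.axioms(2)[OF M]]]
      by (auto simp: PiE_iff intro!: restrict_ext)
    show "\<zero>\<^bsub>?D\<^esub> \<oplus>\<^bsub>?D\<^esub> x = x" if "x \<in> carrier ?D" for x
      using that l_zero by (auto simp: PiE_iff extensional_def)
  qed (use add neg in auto)
  then show ?thesis
    by (rule moduleI[OF R _ smult])
      (auto simp: PiE_iff extensional_def fun_eq_iff module.smult_l_distr[OF M] module.smult_r_distr[OF M]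
        module.smult_assoc1[OF M] module.smult_one[OF M])
qed

lemma regular_module_sel [simp]:
  "carrier (regular_module R) = carrier R" "\<zero>\<^bsub>regular_module R\<^esub> = \<zero>\<^bsub>R\<^esub>"
  "x \<oplus>\<^bsub>regular_module R\<^esub> y = x \<oplus>\<^bsub>R\<^esub> y" "a \<odot>\<^bsub>regular_module R\<^esub> x = a \<otimes>\<^bsub>R\<^esub> x"
  by (simp_all add: regular_module_def)

lemma module_free_module: "cring R \<Longrightarrow> module R (free_module R B)"
  unfolding free_module_def by (intro module_direct_sum module_regular_module)

definition unit_vector :: "('r, 's) ring_scheme \<Rightarrow> 'b set \<Rightarrow> 'b \<Rightarrow> 'b \<Rightarrow> 'r" where
  "unit_vector R B b = (\<lambda>i\<in>B. if b = i then \<one>\<^bsub>R\<^esub> else \<zero>\<^bsub>R\<^esub>)"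

lemma unit_vector_closed:
  assumes "cring R" shows "unit_vector R B b \<in> carrier (free_module R B)"
proof -
  interpret cring R by fact
  have "finite {i \<in> B. unit_vector R B b i \<noteq> \<zero>\<^bsub>R\<^esub>}"
    by (rule finite_subset[of _ "{b}"]) (auto simp: unit_vector_def)
  then show ?thesis by (auto simp: free_module_def unit_vector_def cong: conj_cong)
qed

lemma free_module_lincomb:
  assumes "cring R" "set l \<subseteq> carrier R \<times> B'" "B' \<subseteq> B"
  shows "lincomb (free_module R B) (unit_vector R B) l = (\<lambda>b\<in>B. coeff R l b)"
proof -
  interpret cring R by fact
  show ?thesis using assms(2)
  proof (induction l)
    case Nil
    then show ?case by (simp add: free_module_def)
  next
    case (Cons x l)
    then show ?case
      by (cases x) (auto simp: free_module_def unit_vector_def coeff_Cons[OF assms(1)] intro!: restrict_ext)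
  qed
qed

lemma is_basis_free_module:
  assumes "cring R" shows "is_basis R (free_module R B) B (unit_vector R B)"
proof -
  interpret cring R by fact
  have span: "\<exists>l. set l \<subseteq> carrier R \<times> B \<and> lincomb (free_module R B) (unit_vector R B) l = x"
    if x: "x \<in> carrier (free_module R B)" for x
  proof -
    have xB: "x b \<in> carrier R" if "b \<in> B" for b using x that by (auto simp: free_module_def)
    have "finite {b \<in> B. x b \<noteq> \<zero>\<^bsub>R\<^esub>}" using x by (simp add: free_module_def)
    then obtain bs where bs: "set bs = {b \<in> B. x b \<noteq> \<zero>\<^bsub>R\<^esub>}" "distinct bs"
      using finite_distinct_list by blast
    let ?l = "map (\<lambda>b. (x b, b)) bs"
    have l: "set ?l \<subseteq> carrier R \<times> B" using bs xB by auto
    have "coeff R (map (\<lambda>b. (x b, b)) cs) b = (if b \<in> set cs then x b else \<zero>\<^bsub>R\<^esub>)"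
      if "set cs \<subseteq> B" "distinct cs" for cs b
      using that
    proof (induction cs)
      case (Cons c cs)
      have "set (map (\<lambda>b. (x b, b)) cs) \<subseteq> carrier R \<times> B" using Cons.prems xB by auto
      then show ?case using Cons xB by (auto simp: coeff_Cons[OF assms])
    qed simp
    then have "coeff R ?l b = x b" if "b \<in> B" for b using bs that by auto
    then have "lincomb (free_module R B) (unit_vector R B) ?l = x"
      using x by (subst free_module_lincomb[OF assms l]) (auto simp: free_module_def PiE_iff extensional_def)
    then show ?thesis using l by blast
  qed
  have ind: "coeff R l = coeff R l'"
    if l: "set l \<subseteq> carrier R \<times> B" "set l' \<subseteq> carrier R \<times> B"
      and eq: "lincomb (free_module R B) (unit_vector R B) l = lincomb (free_module R B) (unit_vector R B) l'"
    for l l'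
  proof
    fix b
    show "coeff R l b = coeff R l' b"
    proof (cases "b \<in> B")
      case True
      then show ?thesis
        using fun_cong[OF eq, of b] l by (simp add: free_module_lincomb[OF assms, of _ B])
    next
      case False
      then show ?thesis using l by (simp add: coeff_outside[OF assms])
    qed
  qed
  show ?thesis
    by (rule is_basisI[OF module_free_module[OF assms] unit_vector_closed[OF assms]]) (erule span, rule ind)
qed

lemma small_carrier_of_basis:
  assumes "universe \<kappa>" "small \<kappa> (carrier R)" "small \<kappa> B" "is_basis R M B e"
  shows "small \<kappa> (carrier M)"
proof -
  have "carrier M \<subseteq> lincomb M e ` lists (carrier R \<times> B)"
  proof
    fix x assume "x \<in> carrier M"
    then obtain l where "set l \<subseteq> carrier R \<times> B" "x = lincomb M e l" by (rule basis_span[OF assms(4)])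
    then show "x \<in> lincomb M e ` lists (carrier R \<times> B)" by blast
  qed
  then show ?thesis
    by (rule small_subset[rotated]) (intro small_image small_lists small_Sigma assms)
qed

definition transport :: "('x \<Rightarrow> 'y) \<Rightarrow> ('r, 'x) module \<Rightarrow> ('r, 'y) module" where
  "transport j M = (let i = inv_into (carrier M) j in
    \<lparr>carrier = j ` carrier M, monoid.mult = undefined, one = undefined, zero = j \<zero>\<^bsub>M\<^esub>,
     add = (\<lambda>x y. j (i x \<oplus>\<^bsub>M\<^esub> i y)), module.smult = (\<lambda>a x. j (a \<odot>\<^bsub>M\<^esub> i x))\<rparr>)"

lemma module_transport:
  assumes "module R M" "inj_on j (carrier M)"
  shows "module R (transport j M)"
proof -
  interpret module R M by fact
  note [simp] = inv_into_f_f[OF assms(2)]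
  have "abelian_group (transport j M)"
  proof (rule abelian_groupI)
    fix x assume "x \<in> carrier (transport j M)"
    then obtain x' where "x' \<in> carrier M" "x = j x'" by (auto simp: transport_def Let_def)
    then show "\<exists>y\<in>carrier (transport j M). y \<oplus>\<^bsub>transport j M\<^esub> x = \<zero>\<^bsub>transport j M\<^esub>"
      by (intro bexI[of _ "j (\<ominus>\<^bsub>M\<^esub> x')"]) (auto simp: transport_def Let_def M.l_neg)
  qed (auto simp: transport_def Let_def M.a_ac)
  then show ?thesis
    by (rule moduleI[OF R.is_cring])
      (auto simp: transport_def Let_def smult_l_distr smult_r_distr smult_assoc1)
qed

lemma transport_linear_bij:
  assumes "module R M" "inj_on j (carrier M)"
  shows "restrict j (carrier M) \<in> linear_maps R M (transport j M)"
    and "bij_betw (restrict j (carrier M)) (carrier M) (carrier (transport j M))"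
proof -
  interpret module R M by fact
  note [simp] = inv_into_f_f[OF assms(2)]
  show "restrict j (carrier M) \<in> linear_maps R M (transport j M)"
    by (auto simp: linear_maps_def transport_def Let_def)
  show "bij_betw (restrict j (carrier M)) (carrier M) (carrier (transport j M))"
    using assms(2) by (auto simp: bij_betw_def transport_def Let_def inj_on_def)
qed

text \<open>
  The copy of a free module inside \<open>'u\<close>. It has the intended meaning if the free module is small,
  as this makes the embedding injective.
\<close>

definition small_free_module :: "('r, 's) ring_scheme \<Rightarrow> 'b set \<Rightarrow> ('r, 'u) module" where
  "small_free_module R B = transport (embedding (carrier (free_module R B))) (free_module R B)"

definition small_free_basis :: "('r, 's) ring_scheme \<Rightarrow> 'b set \<Rightarrow> 'b \<Rightarrow> 'u" where
  "small_free_basis R B b = embedding (carrier (free_module R B)) (unit_vector R B b)"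

lemma is_basis_small_free_module:
  fixes \<kappa> :: "'u rel"
  assumes "universe \<kappa>" "cring R" "small \<kappa> (carrier R)" "small \<kappa> B"
  shows "is_basis R (small_free_module R B :: ('r, 'u) module) B (small_free_basis R B)"
proof -
  let ?M = "free_module R B" and ?j = "embedding (carrier (free_module R B)) :: _ \<Rightarrow> 'u"
  note basis = is_basis_free_module[OF assms(2), of B]
  have M: "module R ?M" by (rule module_free_module[OF assms(2)])
  have "small \<kappa> (carrier ?M)" by (rule small_carrier_of_basis[OF assms(1,3,4) basis])
  then have j: "inj_on ?j (carrier ?M)" by (rule inj_on_embedding[OF assms(1)])
  have "is_basis R (transport ?j ?M) B (\<lambda>b. restrict ?j (carrier ?M) (unit_vector R B b))"
    by (intro is_basis_linear_bij[OF basis] module_transport[OF M j] transport_linear_bij[OF M j])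
  then show ?thesis
    using unit_vector_closed[OF assms(2), of B]
    by (simp add: small_free_module_def small_free_basis_def[abs_def])
qed


section \<open>Trivial fibrations of complexes\<close>

lemma is_complexD:
  assumes "is_complex \<kappa> R K"
  shows "module R (Deg K n)" and "small \<kappa> (carrier (Deg K n))"
    and "Diff K n \<in> linear_maps R (Deg K n) (Deg K (n - 1))"
    and "x \<in> carrier (Deg K n) \<Longrightarrow> Diff K (n - 1) (Diff K n x) = \<zero>\<^bsub>Deg K (n - 1 - 1)\<^esub>"
  using assms by (auto simp: is_complex_def)

lemma chain_mapsD:
  assumes "f \<in> chain_maps R K L"
  shows "f n \<in> linear_maps R (Deg K n) (Deg L n)"
    and "x \<in> carrier (Deg K n) \<Longrightarrow> f (n - 1) (Diff K n x) = Diff L n (f n x)"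
  using assms by (auto simp: chain_maps_def)

lemma is_complex_zero_closed: "is_complex \<kappa> R K \<Longrightarrow> \<zero>\<^bsub>Deg K n\<^esub> \<in> carrier (Deg K n)"
  by (meson is_complexD(1) module_def abelian_group_def abelian_monoid.zero_closed)

lemma is_complex_Diff_zero:
  assumes "is_complex \<kappa> R K" shows "Diff K n \<zero>\<^bsub>Deg K n\<^esub> = \<zero>\<^bsub>Deg K (n - 1)\<^esub>"
  using linear_maps_zero is_complexD[OF assms] by blast

lemma zero_in_cycles: "is_complex \<kappa> R K \<Longrightarrow> \<zero>\<^bsub>Deg K n\<^esub> \<in> cycles K n"
  by (simp add: cycles_def is_complex_zero_closed is_complex_Diff_zero)

lemma cycles_add:
  assumes K: "is_complex \<kappa> R K" and "x \<in> cycles K n" "y \<in> cycles K n"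
  shows "x \<oplus>\<^bsub>Deg K n\<^esub> y \<in> cycles K n"
proof -
  interpret module R "Deg K n" by (rule is_complexD[OF K])
  interpret N: module R "Deg K (n - 1)" by (rule is_complexD[OF K])
  show ?thesis using assms linear_mapsD(2)[OF is_complexD(3)[OF K]] by (simp add: cycles_def)
qed

lemma cycles_neg:
  assumes K: "is_complex \<kappa> R K" and "x \<in> cycles K n"
  shows "\<ominus>\<^bsub>Deg K n\<^esub> x \<in> cycles K n"
proof -
  interpret module R "Deg K n" by (rule is_complexD[OF K])
  interpret N: module R "Deg K (n - 1)" by (rule is_complexD[OF K])
  show ?thesis
    using assms linear_maps_neg[OF is_complexD(1)[OF K] is_complexD(1)[OF K] is_complexD(3)[OF K]]
    by (simp add: cycles_def)
qed

lemma boundaries_subset_cycles: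
  assumes K: "is_complex \<kappa> R K" shows "boundaries K n \<subseteq> cycles K n"
  using is_complexD(4)[OF K, of _ "n + 1"] linear_mapsD(1)[OF is_complexD(3)[OF K], of _ "n + 1"]
  by (auto simp: boundaries_def cycles_def)

lemma abelian_subgroup_boundaries:
  assumes K: "is_complex \<kappa> R K"
  shows "abelian_subgroup (boundaries K n) ((Deg K n)\<lparr>carrier := cycles K n\<rparr>)" (is "abelian_subgroup _ ?Z")
proof -
  interpret module R "Deg K n" by (rule is_complexD[OF K])
  interpret N: module R "Deg K (n + 1)" by (rule is_complexD[OF K])
  have sub: "x \<in> carrier (Deg K n)" if "x \<in> cycles K n" for x using that by (simp add: cycles_def)
  have d: "Diff K (n + 1) \<in> linear_maps R (Deg K (n + 1)) (Deg K n)"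
    using is_complexD(3)[OF K, of "n + 1"] by simp
  have Z: "abelian_group ?Z"
  proof (rule abelian_groupI)
    fix x assume x: "x \<in> carrier ?Z"
    then show "\<exists>y\<in>carrier ?Z. y \<oplus>\<^bsub>?Z\<^esub> x = \<zero>\<^bsub>?Z\<^esub>"
      using cycles_neg[OF K] sub by (intro bexI[of _ "\<ominus>\<^bsub>Deg K n\<^esub> x"]) (auto simp: M.l_neg)
  qed (use sub in \<open>auto simp: cycles_add[OF K] zero_in_cycles[OF K] M.a_assoc intro: M.a_comm\<close>)
  interpret Z: abelian_group ?Z by (rule Z)
  have inv: "inv\<^bsub>add_monoid ?Z\<^esub> x = \<ominus>\<^bsub>Deg K n\<^esub> x" if "x \<in> cycles K n" for x
    using Z.minus_equality[of "\<ominus>\<^bsub>Deg K n\<^esub> x" x] that cycles_neg[OF K that] sub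
    by (auto simp: M.l_neg a_inv_def)
  have "subgroup (boundaries K n) (add_monoid ?Z)"
  proof (rule group.subgroupI[OF Z.a_group])
    show "boundaries K n \<subseteq> carrier (add_monoid ?Z)"
      using boundaries_subset_cycles[OF K] by simp
    show "boundaries K n \<noteq> {}" using N.zero_closed by (auto simp: boundaries_def)
  next
    fix a assume a: "a \<in> boundaries K n"
    then obtain b where b: "b \<in> carrier (Deg K (n + 1))" "a = Diff K (n + 1) b" by (auto simp: boundaries_def)
    have "\<ominus>\<^bsub>Deg K n\<^esub> a = Diff K (n + 1) (\<ominus>\<^bsub>Deg K (n + 1)\<^esub> b)"
      using linear_maps_neg[OF is_complexD(1)[OF K] is_complexD(1)[OF K] d b(1)] b(2) by simp
    then have "\<ominus>\<^bsub>Deg K n\<^esub> a \<in> boundaries K n" using b by (auto simp: boundaries_def)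
    then show "inv\<^bsub>add_monoid ?Z\<^esub> a \<in> boundaries K n"
      using inv[of a] a boundaries_subset_cycles[OF K, of n] by auto
  next
    fix a b assume "a \<in> boundaries K n" "b \<in> boundaries K n"
    then obtain a' b' where *: "a' \<in> carrier (Deg K (n + 1))" "a = Diff K (n + 1) a'"
      "b' \<in> carrier (Deg K (n + 1))" "b = Diff K (n + 1) b'" by (auto simp: boundaries_def)
    then have "a \<oplus>\<^bsub>Deg K n\<^esub> b = Diff K (n + 1) (a' \<oplus>\<^bsub>Deg K (n + 1)\<^esub> b')"
      using linear_mapsD(2)[OF d] by simp
    then show "a \<otimes>\<^bsub>add_monoid ?Z\<^esub> b \<in> boundaries K n" using * by (auto simp: boundaries_def)
  qed
  then show ?thesis by (intro abelian_subgroupI3 additive_subgroupI Z)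
qed

definition homology_class :: "('r, 'x) chain_complex \<Rightarrow> int \<Rightarrow> 'x \<Rightarrow> 'x set" where
  "homology_class K n x = boundaries K n +>\<^bsub>Deg K n\<^esub> x"

lemma homology_class_alt: "homology_class K n x = (\<lambda>b. b \<oplus>\<^bsub>Deg K n\<^esub> x) ` boundaries K n"
  by (auto simp: homology_class_def a_r_coset_def')

lemma homology_class_restrict:
  "boundaries K n +>\<^bsub>(Deg K n)\<lparr>carrier := cycles K n\<rparr>\<^esub> x = homology_class K n x"
  by (auto simp: homology_class_def a_r_coset_def')

lemma carrier_homology: "carrier (homology K n) = homology_class K n ` cycles K n"
  unfolding homology_def A_FactGroup_def'
  by (auto simp: A_RCOSETS_def' homology_class_restrict)

lemma homology_class_eq_iff:
  assumes K: "is_complex \<kappa> R K" and x: "x \<in> cycles K n" and y: "y \<in> cycles K n"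
  shows "homology_class K n x = homology_class K n y \<longleftrightarrow> (\<exists>b\<in>boundaries K n. x = b \<oplus>\<^bsub>Deg K n\<^esub> y)"
proof -
  let ?Z = "(Deg K n)\<lparr>carrier := cycles K n\<rparr>"
  interpret abelian_subgroup "boundaries K n" ?Z by (rule abelian_subgroup_boundaries[OF K])
  show ?thesis
  proof
    assume eq: "homology_class K n x = homology_class K n y"
    have "x \<in> homology_class K n x"
      using a_rcos_self[of x] x by (simp add: homology_class_restrict)
    then show "\<exists>b\<in>boundaries K n. x = b \<oplus>\<^bsub>Deg K n\<^esub> y" unfolding eq by (auto simp: homology_class_alt)
  next
    assume "\<exists>b\<in>boundaries K n. x = b \<oplus>\<^bsub>Deg K n\<^esub> y"
    then have "x \<in> homology_class K n y" by (auto simp: homology_class_alt)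
    then show "homology_class K n x = homology_class K n y"
      using a_repr_independence'[of x y] y by (simp add: homology_class_restrict)
  qed
qed

lemma homology_class_add:
  assumes K: "is_complex \<kappa> R K" and x: "x \<in> cycles K n" and y: "y \<in> cycles K n"
  shows "homology_class K n x \<otimes>\<^bsub>homology K n\<^esub> homology_class K n y = homology_class K n (x \<oplus>\<^bsub>Deg K n\<^esub> y)"
proof -
  let ?Z = "(Deg K n)\<lparr>carrier := cycles K n\<rparr>"
  interpret abelian_subgroup "boundaries K n" ?Z by (rule abelian_subgroup_boundaries[OF K])
  show ?thesis
    using a_rcos_sum[of x y] x y
    by (simp add: homology_def A_FactGroup_def FactGroup_def set_add_def homology_class_restrict)
qed

lemma chain_map_cycles:
  assumes "is_complex \<kappa> R K" "is_complex \<kappa> R L" "f \<in> chain_maps R K L" "x \<in> cycles K n"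
  shows "f n x \<in> cycles L n"
  using assms linear_mapsD(1)[OF chain_mapsD(1)[OF assms(3)]] chain_mapsD(2)[OF assms(3), of x n]
    linear_maps_zero[OF is_complexD(1)[OF assms(1)] is_complexD(1)[OF assms(2)] chain_mapsD(1)[OF assms(3)]]
  by (auto simp: cycles_def)

lemma chain_map_boundaries:
  assumes "f \<in> chain_maps R K L" "x \<in> boundaries K n"
  shows "f n x \<in> boundaries L n"
  using assms(2) linear_mapsD(1)[OF chain_mapsD(1)[OF assms(1)]] chain_mapsD(2)[OF assms(1), of _ "n + 1"]
  by (auto simp: boundaries_def)

lemma homology_map_class:
  assumes K: "is_complex \<kappa> R K" and L: "is_complex \<kappa> R L" and f: "f \<in> chain_maps R K L"
    and x: "x \<in> cycles K n"
  shows "homology_map L f n (homology_class K n x) = homology_class L n (f n x)"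
proof -
  have "homology_class L n (f n (b \<oplus>\<^bsub>Deg K n\<^esub> x)) = homology_class L n (f n x)"
    if b: "b \<in> boundaries K n" for b
  proof -
    have bZ: "b \<in> cycles K n" using boundaries_subset_cycles[OF K] b by auto
    have "f n (b \<oplus>\<^bsub>Deg K n\<^esub> x) = f n b \<oplus>\<^bsub>Deg L n\<^esub> f n x"
      using linear_mapsD(2)[OF chain_mapsD(1)[OF f]] bZ x by (auto simp: cycles_def)
    then show ?thesis
      using homology_class_eq_iff[OF L chain_map_cycles[OF K L f] chain_map_cycles[OF K L f]]
        cycles_add[OF K bZ x] x chain_map_boundaries[OF f b] by blast
  qed
  moreover have "x \<in> homology_class K n x"
    using homology_class_eq_iff[OF K x x] by (auto simp: homology_class_alt)
  ultimately show ?thesis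
    unfolding homology_map_def homology_class_def[symmetric] by (auto simp: homology_class_alt[of K])
qed

text \<open>
  The right lifting property against the inclusions of spheres into disks, with the disks spelled
  out: \<open>z\<close> is a sphere in \<open>K\<close>, and \<open>x\<close> fills its image in \<open>L\<close>.
\<close>

definition fills_spheres :: "('r, 'x) chain_complex \<Rightarrow> ('r, 'y) chain_complex \<Rightarrow> (int \<Rightarrow> 'x \<Rightarrow> 'y) \<Rightarrow> bool" where
  "fills_spheres K L f \<longleftrightarrow> (\<forall>n. \<forall>z\<in>cycles K (n - 1). \<forall>x\<in>carrier (Deg L n).
     Diff L n x = f (n - 1) z \<longrightarrow> (\<exists>y\<in>carrier (Deg K n). Diff K n y = z \<and> f n y = x))"

lemma fills_spheresD:
  assumes "fills_spheres K L f" "z \<in> cycles K (n - 1)" "x \<in> carrier (Deg L n)" "Diff L n x = f (n - 1) z"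
  obtains y where "y \<in> carrier (Deg K n)" "Diff K n y = z" "f n y = x"
  using assms unfolding fills_spheres_def by blast

text \<open>
  A cycle fills the zero sphere.
\<close>

lemma fills_spheres_surj_cycles:
  assumes K: "is_complex \<kappa> R K" and L: "is_complex \<kappa> R L" and f: "f \<in> chain_maps R K L"
    and fs: "fills_spheres K L f" and x: "x \<in> cycles L n"
  obtains y where "y \<in> cycles K n" "f n y = x"
proof -
  have "f (n - 1) \<zero>\<^bsub>Deg K (n - 1)\<^esub> = \<zero>\<^bsub>Deg L (n - 1)\<^esub>"
    by (rule linear_maps_zero[OF is_complexD(1)[OF K] is_complexD(1)[OF L] chain_mapsD(1)[OF f]])
  then obtain y where "y \<in> carrier (Deg K n)" "Diff K n y = \<zero>\<^bsub>Deg K (n - 1)\<^esub>" "f n y = x"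
    using x fills_spheresD[OF fs zero_in_cycles[OF K], of x n] by (auto simp: cycles_def)
  then show thesis using that by (auto simp: cycles_def)
qed

text \<open>
  The differential of \<open>x\<close> is a cycle, so it has a preimage \<open>z\<close> which is a cycle; now \<open>x\<close> fills the
  image of \<open>z\<close>.
\<close>

lemma fills_spheres_surj:
  assumes K: "is_complex \<kappa> R K" and L: "is_complex \<kappa> R L" and f: "f \<in> chain_maps R K L"
    and fs: "fills_spheres K L f"
  shows "f n ` carrier (Deg K n) = carrier (Deg L n)"
proof
  show "f n ` carrier (Deg K n) \<subseteq> carrier (Deg L n)"
    using linear_mapsD(1)[OF chain_mapsD(1)[OF f]] by auto
  show "carrier (Deg L n) \<subseteq> f n ` carrier (Deg K n)"
  proof
    fix x assume x: "x \<in> carrier (Deg L n)"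
    then have "Diff L n x \<in> cycles L (n - 1)"
      using is_complexD(4)[OF L x] linear_mapsD(1)[OF is_complexD(3)[OF L] x] by (simp add: cycles_def)
    then obtain z where "z \<in> cycles K (n - 1)" "f (n - 1) z = Diff L n x"
      by (rule fills_spheres_surj_cycles[OF K L f fs])
    then show "x \<in> f n ` carrier (Deg K n)"
      using fills_spheresD[OF fs _ x] by (metis image_eqI)
  qed
qed

text \<open>
  Surjectivity on homology is surjectivity on cycles. For injectivity, a cycle whose image bounds is
  a sphere whose image is filled, hence it bounds.
\<close>

lemma fills_spheres_quasi_iso:
  assumes K: "is_complex \<kappa> R K" and L: "is_complex \<kappa> R L" and f: "f \<in> chain_maps R K L"
    and fs: "fills_spheres K L f"
  shows "quasi_iso K L f"
  unfolding quasi_iso_def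
proof
  fix n
  let ?h = "homology_map L f n"
  note cyc = chain_map_cycles[OF K L f] and cls = homology_map_class[OF K L f]
  interpret K: module R "Deg K n" by (rule is_complexD[OF K])
  interpret L: module R "Deg L n" by (rule is_complexD[OF L])
  have add: "f n (x \<oplus>\<^bsub>Deg K n\<^esub> y) = f n x \<oplus>\<^bsub>Deg L n\<^esub> f n y" if "x \<in> cycles K n" "y \<in> cycles K n" for x y
    using that linear_mapsD(2)[OF chain_mapsD(1)[OF f]] by (simp add: cycles_def)
  have "?h \<in> hom (homology K n) (homology L n)"
    by (auto simp: hom_def carrier_homology cls cyc homology_class_add[OF K] homology_class_add[OF L]
        cycles_add[OF K] add)
  moreover have "inj_on ?h (carrier (homology K n))"
  proof (rule inj_onI, unfold carrier_homology, elim imageE, hypsubst)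
    fix x y assume x: "x \<in> cycles K n" and y: "y \<in> cycles K n"
      and eq: "?h (homology_class K n x) = ?h (homology_class K n y)"
    obtain b where b: "b \<in> boundaries L n" "f n x = b \<oplus>\<^bsub>Deg L n\<^esub> f n y"
      using eq homology_class_eq_iff[OF L cyc[OF x] cyc[OF y]] by (auto simp: cls x y)
    let ?z = "x \<oplus>\<^bsub>Deg K n\<^esub> \<ominus>\<^bsub>Deg K n\<^esub> y"
    have z: "?z \<in> cycles K n" by (intro cycles_add[OF K] cycles_neg[OF K] x y)
    have c: "b \<in> carrier (Deg L n)" "f n y \<in> carrier (Deg L n)" "x \<in> carrier (Deg K n)" "y \<in> carrier (Deg K n)"
      using x y cyc[OF y] boundaries_subset_cycles[OF L] b(1) by (auto simp: cycles_def)
    have "f n ?z = b"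
      using add[OF x cycles_neg[OF K y]] b(2) c
        linear_maps_neg[OF K.module_axioms L.module_axioms chain_mapsD(1)[OF f] c(4)]
      by (simp add: L.a_assoc L.r_neg)
    moreover obtain b' where b': "b' \<in> carrier (Deg L (n + 1))" "b = Diff L (n + 1) b'"
      using b(1) by (auto simp: boundaries_def)
    ultimately obtain w where "w \<in> carrier (Deg K (n + 1))" "Diff K (n + 1) w = ?z"
      using fills_spheresD[OF fs, of ?z "n + 1" b'] z by auto
    then have "?z \<in> boundaries K n" unfolding boundaries_def by (metis image_eqI)
    moreover have "x = ?z \<oplus>\<^bsub>Deg K n\<^esub> y" using c by (simp add: K.a_assoc K.l_neg)
    ultimately show "homology_class K n x = homology_class K n y"
      using homology_class_eq_iff[OF K x y] by blast
  qed
  moreover have "?h ` carrier (homology K n) = carrier (homology L n)"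
  proof
    show "?h ` carrier (homology K n) \<subseteq> carrier (homology L n)"
      by (auto simp: carrier_homology cls cyc)
    show "carrier (homology L n) \<subseteq> ?h ` carrier (homology K n)"
    proof (unfold carrier_homology, clarify)
      fix x assume "x \<in> cycles L n"
      then obtain y where "y \<in> cycles K n" "f n y = x" by (rule fills_spheres_surj_cycles[OF K L f fs])
      then show "homology_class L n x \<in> ?h ` homology_class K n ` cycles K n"
        using cls by (metis image_eqI)
    qed
  qed
  ultimately show "?h \<in> iso (homology K n) (homology L n)"
    by (simp add: iso_def bij_betw_def)
qed

text \<open>
  Injectivity on homology yields some filling \<open>y0\<close> of \<open>z\<close>. It need not lie over \<open>x\<close>, but the defect
  is a cycle in \<open>L\<close>, which by surjectivity on homology and on chains is the image of a cycle.
\<close>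

lemma surj_quasi_iso_fills_spheres:
  assumes K: "is_complex \<kappa> R K" and L: "is_complex \<kappa> R L" and f: "f \<in> chain_maps R K L"
    and surj: "\<And>n. f n ` carrier (Deg K n) = carrier (Deg L n)" and qi: "quasi_iso K L f"
  shows "fills_spheres K L f"
  unfolding fills_spheres_def
proof (intro allI ballI impI)
  fix n z x
  assume z: "z \<in> cycles K (n - 1)" and x: "x \<in> carrier (Deg L n)" and eq: "Diff L n x = f (n - 1) z"
  interpret K: module R "Deg K n" by (rule is_complexD[OF K])
  interpret L: module R "Deg L n" by (rule is_complexD[OF L])
  interpret K1: module R "Deg K (n - 1)" by (rule is_complexD[OF K])
  interpret L1: module R "Deg L (n - 1)" by (rule is_complexD[OF L])
  note cyc = chain_map_cycles[OF K L f] and cls = homology_map_class[OF K L f]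
  note bij = qi[unfolded quasi_iso_def, rule_format, unfolded iso_def bij_betw_def]
  note fl = linear_mapsD[OF chain_mapsD(1)[OF f]]
  have "f (n - 1) z \<in> boundaries L (n - 1)" using x eq[symmetric] by (auto simp: boundaries_def)
  moreover have "f (n - 1) z = f (n - 1) z \<oplus>\<^bsub>Deg L (n - 1)\<^esub> f (n - 1) \<zero>\<^bsub>Deg K (n - 1)\<^esub>"
    using cyc[OF z] linear_maps_zero[OF K1.module_axioms L1.module_axioms chain_mapsD(1)[OF f]]
    by (simp add: cycles_def)
  ultimately have "homology_class L (n - 1) (f (n - 1) z)
      = homology_class L (n - 1) (f (n - 1) \<zero>\<^bsub>Deg K (n - 1)\<^esub>)"
    using homology_class_eq_iff[OF L cyc[OF z] cyc[OF zero_in_cycles[OF K]]] by blast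
  then have "homology_map L f (n - 1) (homology_class K (n - 1) z)
      = homology_map L f (n - 1) (homology_class K (n - 1) \<zero>\<^bsub>Deg K (n - 1)\<^esub>)"
    by (simp add: cls z zero_in_cycles[OF K])
  then have "homology_class K (n - 1) z = homology_class K (n - 1) \<zero>\<^bsub>Deg K (n - 1)\<^esub>"
    using bij[of "n - 1"] z zero_in_cycles[OF K, of "n - 1"] by (auto simp: carrier_homology inj_on_def)
  then obtain b where b: "b \<in> boundaries K (n - 1)" "z = b \<oplus>\<^bsub>Deg K (n - 1)\<^esub> \<zero>\<^bsub>Deg K (n - 1)\<^esub>"
    using homology_class_eq_iff[OF K z zero_in_cycles[OF K]] by blast
  moreover have "b \<in> carrier (Deg K (n - 1))"
    using b(1) boundaries_subset_cycles[OF K] by (auto simp: cycles_def)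
  ultimately obtain y0 where y0: "y0 \<in> carrier (Deg K n)" "Diff K n y0 = z"
    by (auto simp: boundaries_def)
  \<comment> \<open>the defect of \<open>y0\<close>\<close>
  let ?x = "x \<oplus>\<^bsub>Deg L n\<^esub> \<ominus>\<^bsub>Deg L n\<^esub> f n y0"
  have fy0: "f n y0 \<in> carrier (Deg L n)" using fl(1) y0 by blast
  have "Diff L n ?x = \<zero>\<^bsub>Deg L (n - 1)\<^esub>"
    using linear_mapsD[OF is_complexD(3)[OF L, of n]] linear_maps_neg[OF L.module_axioms L1.module_axioms is_complexD(3)[OF L] fy0]
      x fy0 eq chain_mapsD(2)[OF f y0(1)] y0(2) cyc[OF z]
    by (simp add: L1.r_neg cycles_def)
  then have x': "?x \<in> cycles L n" using x fy0 by (simp add: cycles_def)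
  then have "homology_class L n ?x \<in> homology_map L f n ` homology_class K n ` cycles K n"
    using bij[of n] by (simp add: carrier_homology)
  then obtain w where w: "w \<in> cycles K n" "homology_class L n ?x = homology_class L n (f n w)"
    by (auto simp: cls)
  then obtain b' where b': "b' \<in> boundaries L n" "?x = b' \<oplus>\<^bsub>Deg L n\<^esub> f n w"
    using homology_class_eq_iff[OF L x' cyc[OF w(1)]] by blast
  then obtain b'' where "b'' \<in> carrier (Deg L (n + 1))" "b' = Diff L (n + 1) b''"
    by (auto simp: boundaries_def)
  moreover then obtain e where "e \<in> carrier (Deg K (n + 1))" "f (n + 1) e = b''"
    using surj[of "n + 1"] by (metis imageE)
  ultimately have e: "Diff K (n + 1) e \<in> boundaries K n" "f n (Diff K (n + 1) e) = b'"
    using chain_mapsD(2)[OF f, of e "n + 1"] by (auto simp: boundaries_def)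
  then have eZ: "Diff K (n + 1) e \<in> cycles K n" using boundaries_subset_cycles[OF K] by blast
  let ?w = "Diff K (n + 1) e \<oplus>\<^bsub>Deg K n\<^esub> w"
  have wZ: "?w \<in> cycles K n" by (intro cycles_add[OF K] eZ w)
  have "f n ?w = ?x" using fl(2) e(2) eZ w(1) b'(2) by (simp add: cycles_def)
  then have "f n (?w \<oplus>\<^bsub>Deg K n\<^esub> y0) = x"
    using fl(2)[of ?w n y0] wZ y0(1) x fy0 by (simp add: cycles_def L.a_assoc L.l_neg)
  moreover have "Diff K n (?w \<oplus>\<^bsub>Deg K n\<^esub> y0) = z"
    using linear_mapsD(2)[OF is_complexD(3)[OF K], of ?w n y0] wZ y0 z by (simp add: cycles_def)
  moreover have "?w \<oplus>\<^bsub>Deg K n\<^esub> y0 \<in> carrier (Deg K n)"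
    using wZ y0 by (simp add: cycles_def)
  ultimately show "\<exists>y\<in>carrier (Deg K n). Diff K n y = z \<and> f n y = x" by blast
qed


section \<open>Cells\<close>

text \<open>
  A cell of degree \<open>n\<close> over the object \<open>c\<close>, with the section of \<open>X\<close> over which it lies. An entry
  \<open>(r, f, g)\<close> of its boundary stands for \<open>r\<close> times the restriction of the cell \<open>g\<close> along
  \<open>f : c \<rightarrow> cell_ob g\<close>. Since cells are finite trees, functions on them can be defined by recursion,
  which replaces an induction over the stages of the small object argument.
\<close>

datatype ('o, 'm, 'r, 'u) cell =
  Cell (cell_ob: 'o) (cell_dim: int) (cell_bd: "('r \<times> 'm \<times> ('o, 'm, 'r, 'u) cell) list") (cell_val: 'u)

locale presheaf_setting = category C
  for C :: "('o, 'm) category" +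
  fixes \<kappa> :: "'u rel" and R :: "('r, 's) ring_scheme"
  assumes universe: "universe \<kappa>"
    and small_Ob: "small \<kappa> (Ob C)" and small_Mor: "small \<kappa> (Mor C)"
    and cring_R: "cring R" and small_R: "small \<kappa> (carrier R)"
begin

lemma HomD: "f \<in> Hom C a b \<Longrightarrow> f \<in> Mor C \<and> Dom C f = a \<and> Cod C f = b \<and> a \<in> Ob C \<and> b \<in> Ob C"
  using Dom_in_Ob Cod_in_Ob by (auto simp: Hom_def)

lemma cpresheaf_complex: "is_cpresheaf \<kappa> C R X \<Longrightarrow> c \<in> Ob C \<Longrightarrow> is_complex \<kappa> R (Val X c)"
  by (simp add: is_cpresheaf_def)

lemma cpresheaf_module: "is_cpresheaf \<kappa> C R X \<Longrightarrow> c \<in> Ob C \<Longrightarrow> module R (Deg (Val X c) n)"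
  using cpresheaf_complex is_complexD(1) by blast

lemma Res_chain_map:
  "is_cpresheaf \<kappa> C R X \<Longrightarrow> f \<in> Hom C a b \<Longrightarrow> Res X f \<in> chain_maps R (Val X b) (Val X a)"
  by (auto simp: is_cpresheaf_def Hom_def)

lemmas Res_linear = chain_mapsD(1)[OF Res_chain_map]
lemmas Res_closed = linear_mapsD(1)[OF Res_linear]
lemmas Res_Diff = chain_mapsD(2)[OF Res_chain_map]

lemma Res_Ident:
  "is_cpresheaf \<kappa> C R X \<Longrightarrow> c \<in> Ob C \<Longrightarrow> x \<in> carrier (Deg (Val X c) n) \<Longrightarrow> Res X (Ident C c) n x = x"
  by (simp add: is_cpresheaf_def id_chain_def)

lemma Res_Comp:
  assumes "is_cpresheaf \<kappa> C R X" "f \<in> Hom C a b" "g \<in> Hom C b c" "x \<in> carrier (Deg (Val X c) n)"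
  shows "Res X (Comp C g f) n x = Res X f n (Res X g n x)"
proof -
  have "Res X (Comp C g f) = comp_chain (Val X c) (Res X f) (Res X g)"
    using assms(1-3) by (auto simp: is_cpresheaf_def Hom_def)
  then show ?thesis using assms(4) by (simp add: comp_chain_def compose_def)
qed

lemma map_chain_map:
  "\<phi> \<in> cpresheaf_maps C R X Y \<Longrightarrow> c \<in> Ob C \<Longrightarrow> \<phi> c \<in> chain_maps R (Val X c) (Val Y c)"
  by (simp add: cpresheaf_maps_def)

lemmas map_linear = chain_mapsD(1)[OF map_chain_map]
lemmas map_closed = linear_mapsD(1)[OF map_linear]
lemmas map_Diff = chain_mapsD(2)[OF map_chain_map]

lemma map_Res:
  assumes "\<phi> \<in> cpresheaf_maps C R X Y" "f \<in> Hom C a b" "x \<in> carrier (Deg (Val X b) n)"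
  shows "\<phi> a n (Res X f n x) = Res Y f n (\<phi> b n x)"
proof -
  have "comp_chain (Val X b) (\<phi> a) (Res X f) = comp_chain (Val X b) (Res Y f) (\<phi> b)"
    using assms(1,2) by (auto simp: cpresheaf_maps_def Hom_def)
  then have "comp_chain (Val X b) (\<phi> a) (Res X f) n x = comp_chain (Val X b) (Res Y f) (\<phi> b) n x" by simp
  then show ?thesis using assms(3) by (simp add: comp_chain_def compose_def)
qed

text \<open>
  Restriction along \<open>f\<close> of formal combinations of restricted cells.
\<close>

definition pull :: "'m \<Rightarrow> ('r \<times> 'm \<times> 'g) list \<Rightarrow> ('r \<times> 'm \<times> 'g) list" where
  "pull f = map (map_prod id (\<lambda>(h, g). (Comp C h f, g)))"

text \<open>
  The differential of a formal combination, before the module in which it lives exists.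
\<close>

definition formal_boundary ::
  "('r \<times> 'm \<times> ('o, 'm, 'r, 'u) cell) list \<Rightarrow> ('r \<times> 'm \<times> ('o, 'm, 'r, 'u) cell) list" where
  "formal_boundary l =
     concat (map (\<lambda>(r, f, g). map (map_prod ((\<otimes>\<^bsub>R\<^esub>) r) id) (pull f (cell_bd g))) l)"

text \<open>
  The boundary must be a cycle lying over the differential of the section \<open>x\<close>. That it is a cycle is
  said through \<open>formal_boundary\<close>, that is, through coefficients: the complex in which it is a cycle
  is generated by the valid cells and cannot be mentioned yet.
\<close>

inductive valid_cell :: "('o, 'm, 'r, 'u) cpresheaf \<Rightarrow> ('o, 'm, 'r, 'u) cell \<Rightarrow> bool"
  for X :: "('o, 'm, 'r, 'u) cpresheaf" where
  "valid_cell X (Cell c n l x)"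
  if "c \<in> Ob C" and "x \<in> carrier (Deg (Val X c) n)"
    and "\<forall>(r, f, g) \<in> set l. r \<in> carrier R \<and> f \<in> Hom C c (cell_ob g) \<and> valid_cell X g \<and> cell_dim g = n - 1"
    and "null_combination R (formal_boundary l)"
    and "Diff (Val X c) n x = lincomb (Deg (Val X c) (n - 1)) (\<lambda>(f, g). Res X f (n - 1) (cell_val g)) l"

text \<open>
  The basis in degree \<open>n\<close> over \<open>c\<close>: the pair \<open>(f, g)\<close> is the restriction of \<open>g\<close> along \<open>f\<close>.
\<close>

definition cells :: "('o, 'm, 'r, 'u) cpresheaf \<Rightarrow> int \<Rightarrow> 'o \<Rightarrow> ('m \<times> ('o, 'm, 'r, 'u) cell) set" where
  "cells X n c = {(f, g). valid_cell X g \<and> cell_dim g = n \<and> f \<in> Hom C c (cell_ob g)}"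

lemma valid_cellD:
  assumes "valid_cell X g"
  shows "cell_ob g \<in> Ob C" and "cell_val g \<in> carrier (Deg (Val X (cell_ob g)) (cell_dim g))"
    and "set (cell_bd g) \<subseteq> carrier R \<times> cells X (cell_dim g - 1) (cell_ob g)"
    and "null_combination R (formal_boundary (cell_bd g))"
    and "Diff (Val X (cell_ob g)) (cell_dim g) (cell_val g) =
      lincomb (Deg (Val X (cell_ob g)) (cell_dim g - 1)) (\<lambda>(f, g'). Res X f (cell_dim g - 1) (cell_val g')) (cell_bd g)"
  using assms by (auto elim!: valid_cell.cases simp: cells_def)

lemma valid_cellI:
  assumes "c \<in> Ob C" "x \<in> carrier (Deg (Val X c) n)" "set l \<subseteq> carrier R \<times> cells X (n - 1) c"
    "null_combination R (formal_boundary l)"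
    "Diff (Val X c) n x = lincomb (Deg (Val X c) (n - 1)) (\<lambda>(f, g). Res X f (n - 1) (cell_val g)) l"
  shows "valid_cell X (Cell c n l x)"
  using assms by (intro valid_cell.intros) (auto simp: cells_def)

lemma valid_cell_induct [consumes 1, case_names cell]:
  assumes "valid_cell X g"
    and step: "\<And>g. valid_cell X g \<Longrightarrow>
      (\<And>f g'. (f, g') \<in> snd ` set (cell_bd g) \<Longrightarrow> valid_cell X g' \<Longrightarrow> cell_dim g' = cell_dim g - 1 \<Longrightarrow>
        f \<in> Hom C (cell_ob g) (cell_ob g') \<Longrightarrow> P g') \<Longrightarrow> P g"
  shows "P g"
  using assms(1)
proof (induction rule: valid_cell.induct)
  case (1 c x n l)
  show ?case
  proof (rule step)
    show "valid_cell X (Cell c n l x)" using 1 by (intro valid_cell.intros) auto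
  qed (use 1 in force)
qed

section \<open>Smallness of the set of cells\<close>

definition sections :: "('o, 'm, 'r, 'u) cpresheaf \<Rightarrow> 'u set" where
  "sections X = (\<Union>(c, n)\<in>Ob C \<times> UNIV. carrier (Deg (Val X c) n))"

primrec cells_of_height :: "('o, 'm, 'r, 'u) cpresheaf \<Rightarrow> nat \<Rightarrow> ('o, 'm, 'r, 'u) cell set" where
  "cells_of_height X 0 = {}"
| "cells_of_height X (Suc k) = (\<lambda>(c, n, l, x). Cell c n l x) `
     (Ob C \<times> UNIV \<times> lists (carrier R \<times> Mor C \<times> cells_of_height X k) \<times> sections X)"

lemma cells_of_height_mono: "i \<le> k \<Longrightarrow> cells_of_height X i \<subseteq> cells_of_height X k"
proof (induction i arbitrary: k)
  case (Suc i)
  then obtain k' where k: "k = Suc k'" "i \<le> k'" by (cases k) auto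
  show ?case
    unfolding k(1) cells_of_height.simps
    by (intro image_mono Sigma_mono lists_mono order_refl Suc.IH k(2))
qed simp

lemma valid_cell_height: "valid_cell X g \<Longrightarrow> \<exists>k. g \<in> cells_of_height X k"
proof (induction rule: valid_cell_induct)
  case (cell g)
  note v = valid_cellD[OF cell.hyps]
  have "\<exists>k. set l \<subseteq> carrier R \<times> Mor C \<times> cells_of_height X k" if "set l \<subseteq> set (cell_bd g)" for l
    using that
  proof (induction l)
    case (Cons a l)
    obtain r f g' where a: "a = (r, f, g')" by (metis prod.exhaust)
    then have "(r, f, g') \<in> set (cell_bd g)" using Cons.prems by simp
    then have *: "r \<in> carrier R" "(f, g') \<in> cells X (cell_dim g - 1) (cell_ob g)" "(f, g') \<in> snd ` set (cell_bd g)"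
      using v(3) by force+
    then have "\<exists>k. g' \<in> cells_of_height X k" by (intro cell.IH) (auto simp: cells_def)
    then obtain i where i: "g' \<in> cells_of_height X i" by blast
    obtain k where k: "set l \<subseteq> carrier R \<times> Mor C \<times> cells_of_height X k" using Cons by auto
    have "g' \<in> cells_of_height X (max i k)" "set l \<subseteq> carrier R \<times> Mor C \<times> cells_of_height X (max i k)"
      using i k cells_of_height_mono[of i "max i k" X] cells_of_height_mono[of k "max i k" X]
      by (auto simp del: cells_of_height.simps)
    then have "set (a # l) \<subseteq> carrier R \<times> Mor C \<times> cells_of_height X (max i k)"
      using * by (auto simp: a cells_def Hom_def)
    then show ?case by blast
  qed simp
  then obtain k where "set (cell_bd g) \<subseteq> carrier R \<times> Mor C \<times> cells_of_height X k" by blast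
  moreover have "cell_val g \<in> sections X" using v(1,2) by (auto simp: sections_def)
  ultimately have "g \<in> cells_of_height X (Suc k)"
    using v(1) by (force intro!: image_eqI[of _ _ "(cell_ob g, cell_dim g, cell_bd g, cell_val g)"] simp: lists_eq_set)
  then show ?case by blast
qed

lemma small_int: "small \<kappa> (UNIV :: int set)"
proof -
  have "(UNIV :: int set) \<subseteq> (\<lambda>(a, b). int a - int b) ` (range (\<lambda>n. n) \<times> range (\<lambda>n. n))"
  proof
    fix x :: int
    obtain m n where "x = int m - int n" by (rule int_diff_cases)
    then show "x \<in> (\<lambda>(a, b). int a - int b) ` (range (\<lambda>n. n) \<times> range (\<lambda>n. n))" by force
  qed
  then show ?thesis
    by (rule small_subset[rotated]) (intro small_image small_Sigma small_countable universe)
qed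

text \<open>
  The cells of bounded height form a small set, since small sets are closed under products and
  finite lists, and there are only countably many heights.
\<close>

lemma small_valid_cells:
  assumes X: "is_cpresheaf \<kappa> C R X" shows "small \<kappa> {g. valid_cell X g}"
proof -
  have "small \<kappa> (sections X)"
    unfolding sections_def
    using is_complexD(2)[OF cpresheaf_complex[OF X]]
    by (intro small_UN small_Sigma universe small_Ob small_int) auto
  then have "small \<kappa> (cells_of_height X k)" for k
  proof (induction k)
    case 0
    show ?case by (simp add: small_finite[OF universe])
  next
    case (Suc k)
    then show ?case
      unfolding cells_of_height.simps
      by (intro small_image small_Sigma small_lists universe small_Ob small_int small_R small_Mor)
  qed
  then have "small \<kappa> (\<Union>k\<in>range (\<lambda>k. k). cells_of_height X k)"
    by (intro small_UN universe small_countable)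
  then show ?thesis by (rule small_subset) (auto dest: valid_cell_height)
qed

lemma small_cells:
  assumes X: "is_cpresheaf \<kappa> C R X" shows "small \<kappa> (cells X n c)"
proof -
  have "cells X n c \<subseteq> Mor C \<times> {g. valid_cell X g}" by (auto simp: cells_def Hom_def)
  then show ?thesis
    by (rule small_subset[rotated]) (intro small_Sigma universe small_Mor small_valid_cells[OF X])
qed

section \<open>The presheaf of complexes generated by the cells\<close>

definition cell_module :: "('o, 'm, 'r, 'u) cpresheaf \<Rightarrow> int \<Rightarrow> 'o \<Rightarrow> ('r, 'u) module" where
  "cell_module X n c = small_free_module R (cells X n c)"

definition cell_basis :: "('o, 'm, 'r, 'u) cpresheaf \<Rightarrow> int \<Rightarrow> 'o \<Rightarrow> 'm \<times> ('o, 'm, 'r, 'u) cell \<Rightarrow> 'u" where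
  "cell_basis X n c = small_free_basis R (cells X n c)"

definition cell_extension ::
  "('o, 'm, 'r, 'u) cpresheaf \<Rightarrow> int \<Rightarrow> 'o \<Rightarrow> ('r, 'u) module \<Rightarrow> ('m \<times> ('o, 'm, 'r, 'u) cell \<Rightarrow> 'u) \<Rightarrow> 'u \<Rightarrow> 'u" where
  "cell_extension X n c = linear_extension R (cell_module X n c) (cells X n c) (cell_basis X n c)"

definition resolution :: "('o, 'm, 'r, 'u) cpresheaf \<Rightarrow> ('o, 'm, 'r, 'u) cpresheaf" where
  "resolution X = \<lparr>
     Val = (\<lambda>c. \<lparr>
       Deg = (\<lambda>n. cell_module X n c),
       Diff = (\<lambda>n. cell_extension X n c (cell_module X (n - 1) c)
         (\<lambda>(f, g). lincomb (cell_module X (n - 1) c) (cell_basis X (n - 1) c) (pull f (cell_bd g))))\<rparr>),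
     Res = (\<lambda>f n. cell_extension X n (Cod C f) (cell_module X n (Dom C f))
       (\<lambda>(h, g). cell_basis X n (Dom C f) (Comp C h f, g)))\<rparr>"

lemma Deg_resolution [simp]: "Deg (Val (resolution X) c) n = cell_module X n c"
  by (simp add: resolution_def)

lemma pull_simps [simp]:
  "pull f [] = []" "pull f ((r, h, g) # l) = (r, Comp C h f, g) # pull f l"
  "pull f (k @ l) = pull f k @ pull f l"
  by (simp_all add: pull_def)

lemma formal_boundary_simps [simp]:
  "formal_boundary [] = []"
  "formal_boundary ((r, f, g) # l) = map (map_prod ((\<otimes>\<^bsub>R\<^esub>) r) id) (pull f (cell_bd g)) @ formal_boundary l"
  by (simp_all add: formal_boundary_def)

lemma cells_pull: "(h, g) \<in> cells X n b \<Longrightarrow> f \<in> Hom C a b \<Longrightarrow> (Comp C h f, g) \<in> cells X n a"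
  by (auto simp: cells_def intro: Comp_in_Hom)

lemma pull_closed:
  "set l \<subseteq> carrier R \<times> cells X n b \<Longrightarrow> f \<in> Hom C a b \<Longrightarrow> set (pull f l) \<subseteq> carrier R \<times> cells X n a"
  by (auto simp: pull_def cells_pull)

lemma cell_bd_closed:
  "(f, g) \<in> cells X n c \<Longrightarrow> set (cell_bd g) \<subseteq> carrier R \<times> cells X (n - 1) (cell_ob g)"
  using valid_cellD(3) by (auto simp: cells_def)

lemma cell_bd_pull_closed:
  "(f, g) \<in> cells X n c \<Longrightarrow> set (pull f (cell_bd g)) \<subseteq> carrier R \<times> cells X (n - 1) c"
  by (rule pull_closed[OF cell_bd_closed]) (auto simp: cells_def)

lemma pull_Comp:
  assumes "set l \<subseteq> carrier R \<times> cells X n c" "f \<in> Hom C a b" "h \<in> Hom C b c"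
  shows "pull (Comp C h f) l = pull f (pull h l)"
  using assms by (auto simp: pull_def cells_def intro!: Comp_assoc)

lemma pull_Ident:
  assumes "set l \<subseteq> carrier R \<times> cells X n c"
  shows "pull (Ident C c) l = l"
  using assms unfolding pull_def
  by (intro map_idI) (auto simp: cells_def intro!: Comp_Ident_right)

lemma pull_formal_boundary:
  assumes "set l \<subseteq> carrier R \<times> cells X n b" "f \<in> Hom C a b"
  shows "formal_boundary (pull f l) = pull f (formal_boundary l)"
  using assms(1)
proof (induction l)
  case Nil
  then show ?case by simp
next
  case (Cons x l)
  obtain r h g where x: "x = (r, h, g)" by (metis prod.exhaust)
  then have g: "(h, g) \<in> cells X n b" using Cons.prems by simp
  have "pull (Comp C h f) (cell_bd g) = pull f (pull h (cell_bd g))"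
    using g by (intro pull_Comp[OF cell_bd_closed[OF g] assms(2)]) (simp add: cells_def)
  moreover have "map (map_prod ((\<otimes>\<^bsub>R\<^esub>) r) id) (pull f k) = pull f (map (map_prod ((\<otimes>\<^bsub>R\<^esub>) r) id) k)"
    for k :: "('r \<times> 'm \<times> ('o, 'm, 'r, 'u) cell) list"
    by (auto simp: pull_def)
  ultimately show ?case using Cons by (simp add: x)
qed

text \<open>
  In any module in which the restricted cells are interpreted by \<open>F\<close>, the formal boundary takes the
  value that the differential of the combination would have.
\<close>

lemma lincomb_formal_boundary:
  assumes M: "module R M" and l: "set l \<subseteq> carrier R \<times> cells X n c" and F: "F \<in> cells X (n - 1) c \<rightarrow> carrier M"
  shows "set (formal_boundary l) \<subseteq> carrier R \<times> cells X (n - 1) c"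
    and "lincomb M F (formal_boundary l) = lincomb M (\<lambda>(f, g). lincomb M F (pull f (cell_bd g))) l"
proof -
  have "set (formal_boundary l) \<subseteq> carrier R \<times> cells X (n - 1) c \<and>
    lincomb M F (formal_boundary l) = lincomb M (\<lambda>(f, g). lincomb M F (pull f (cell_bd g))) l"
    using l
  proof (induction l)
    case Nil
    then show ?case by (simp add: formal_boundary_def)
  next
    case (Cons x l)
    obtain r f g where x: "x = (r, f, g)" by (metis prod.exhaust)
    let ?k = "map (map_prod ((\<otimes>\<^bsub>R\<^esub>) r) id) (pull f (cell_bd g))"
    have r: "r \<in> carrier R" and g: "(f, g) \<in> cells X n c" using Cons.prems x by auto
    have k: "set ?k \<subseteq> carrier R \<times> cells X (n - 1) c"
    proof -
      interpret R: cring R by (rule cring_R)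
      show ?thesis using cell_bd_pull_closed[OF g] r by fastforce
    qed
    have fb: "formal_boundary (x # l) = ?k @ formal_boundary l" by (simp add: x)
    have IH: "set (formal_boundary l) \<subseteq> carrier R \<times> cells X (n - 1) c"
      "lincomb M F (formal_boundary l) = lincomb M (\<lambda>(f, g). lincomb M F (pull f (cell_bd g))) l"
      using Cons by auto
    show ?case
      unfolding fb lincomb_append[OF M k IH(1) F] lincomb_scale[OF M cell_bd_pull_closed[OF g] F r]
      using k IH by (simp add: x)
  qed
  then show "set (formal_boundary l) \<subseteq> carrier R \<times> cells X (n - 1) c"
    and "lincomb M F (formal_boundary l) = lincomb M (\<lambda>(f, g). lincomb M F (pull f (cell_bd g))) l"
    by auto
qed

context
  fixes X :: "('o, 'm, 'r, 'u) cpresheaf"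
  assumes X: "is_cpresheaf \<kappa> C R X"
begin

lemma cell_basis_is_basis: "is_basis R (cell_module X n c) (cells X n c) (cell_basis X n c)"
  unfolding cell_module_def cell_basis_def[abs_def]
  by (rule is_basis_small_free_module[OF universe cring_R small_R small_cells[OF X]])

lemma module_cell_module: "module R (cell_module X n c)"
  by (rule is_basisD[OF cell_basis_is_basis])

lemma cell_basis_funcset: "cell_basis X n c \<in> cells X n c \<rightarrow> carrier (cell_module X n c)"
  by (rule is_basisD[OF cell_basis_is_basis])

lemma cell_basis_closed: "b \<in> cells X n c \<Longrightarrow> cell_basis X n c b \<in> carrier (cell_module X n c)"
  by (rule is_basisD[OF cell_basis_is_basis])

lemma cell_extension_linear:
  "module R N \<Longrightarrow> F \<in> cells X n c \<rightarrow> carrier N \<Longrightarrow>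
    cell_extension X n c N F \<in> linear_maps R (cell_module X n c) N"
  unfolding cell_extension_def by (rule linear_extension_linear[OF cell_basis_is_basis])

lemma cell_extension_basis:
  "module R N \<Longrightarrow> F \<in> cells X n c \<rightarrow> carrier N \<Longrightarrow> b \<in> cells X n c \<Longrightarrow>
    cell_extension X n c N F (cell_basis X n c b) = F b"
  unfolding cell_extension_def by (rule linear_extension_basis[OF cell_basis_is_basis])

lemma cell_extension_lincomb:
  "module R N \<Longrightarrow> F \<in> cells X n c \<rightarrow> carrier N \<Longrightarrow> set l \<subseteq> carrier R \<times> cells X n c \<Longrightarrow>
    cell_extension X n c N F (lincomb (cell_module X n c) (cell_basis X n c) l) = lincomb N F l"
  unfolding cell_extension_def by (rule linear_extension_lincomb[OF cell_basis_is_basis])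

lemmas cell_maps_eqI = linear_maps_eqI[OF cell_basis_is_basis]

lemma cell_boundary_funcset:
  "(\<lambda>(f, g). lincomb (cell_module X (n - 1) c) (cell_basis X (n - 1) c) (pull f (cell_bd g)))
    \<in> cells X n c \<rightarrow> carrier (cell_module X (n - 1) c)"
  using lincomb_closed[OF module_cell_module cell_bd_pull_closed cell_basis_funcset] by auto

lemma Diff_resolution_linear:
  "Diff (Val (resolution X) c) n \<in> linear_maps R (cell_module X n c) (cell_module X (n - 1) c)"
  using cell_extension_linear[OF module_cell_module cell_boundary_funcset] by (simp add: resolution_def)

lemma Diff_cell_basis:
  assumes "(f, g) \<in> cells X n c"
  shows "Diff (Val (resolution X) c) n (cell_basis X n c (f, g)) =
    lincomb (cell_module X (n - 1) c) (cell_basis X (n - 1) c) (pull f (cell_bd g))"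
  using cell_extension_basis[OF module_cell_module cell_boundary_funcset assms] by (simp add: resolution_def)

lemma cell_restriction_funcset:
  "f \<in> Hom C a b \<Longrightarrow>
    (\<lambda>(h, g). cell_basis X n a (Comp C h f, g)) \<in> cells X n b \<rightarrow> carrier (cell_module X n a)"
  using cell_basis_closed[OF cells_pull] by auto

lemma Res_resolution_linear:
  assumes "f \<in> Hom C a b"
  shows "Res (resolution X) f n \<in> linear_maps R (cell_module X n b) (cell_module X n a)"
  using HomD[OF assms] cell_extension_linear[OF module_cell_module cell_restriction_funcset[OF assms]]
  by (simp add: resolution_def)

lemma Res_cell_basis:
  assumes "f \<in> Hom C a b" "(h, g) \<in> cells X n b"
  shows "Res (resolution X) f n (cell_basis X n b (h, g)) = cell_basis X n a (Comp C h f, g)"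
  using HomD[OF assms(1)]
    cell_extension_basis[OF module_cell_module cell_restriction_funcset[OF assms(1)] assms(2)]
  by (simp add: resolution_def)

lemma Res_resolution_lincomb:
  assumes "f \<in> Hom C a b" "set l \<subseteq> carrier R \<times> cells X n b"
  shows "Res (resolution X) f n (lincomb (cell_module X n b) (cell_basis X n b) l) =
    lincomb (cell_module X n a) (cell_basis X n a) (pull f l)"
proof -
  have "Res (resolution X) f n (lincomb (cell_module X n b) (cell_basis X n b) l)
      = lincomb (cell_module X n a) (\<lambda>b'. Res (resolution X) f n (cell_basis X n b b')) l"
    by (rule linear_map_lincomb[OF module_cell_module module_cell_module Res_resolution_linear[OF assms(1)]
          assms(2) cell_basis_funcset])
  also have "\<dots> = lincomb (cell_module X n a) (\<lambda>b'. cell_basis X n a (case b' of (h, g) \<Rightarrow> (Comp C h f, g))) l"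
    using assms(2) Res_cell_basis[OF assms(1)] by (intro lincomb_cong) auto
  finally show ?thesis by (simp add: pull_def lincomb_map)
qed

text \<open>
  On the basis, the square of the differential is the value of the formal boundary of a restriction
  of \<open>cell_bd g\<close>. Validity of \<open>g\<close> makes the coefficients vanish before restriction, and restriction
  is a renaming of symbols.
\<close>

lemma is_complex_resolution: "is_complex \<kappa> R (Val (resolution X) c)"
  unfolding is_complex_def Deg_resolution
proof (intro allI conjI ballI)
  fix n x assume x: "x \<in> carrier (cell_module X n c)"
  let ?d = "Diff (Val (resolution X) c)"
  let ?Z = "\<lambda>x\<in>carrier (cell_module X n c). \<zero>\<^bsub>cell_module X (n - 1 - 1) c\<^esub>"
  have "compose (carrier (cell_module X n c)) (?d (n - 1)) (?d n) = ?Z"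
  proof (rule cell_maps_eqI[of "cell_module X (n - 1 - 1) c"])
    show "?Z \<in> linear_maps R (cell_module X n c) (cell_module X (n - 1 - 1) c)"
      by (rule linear_maps_zero_map[OF module_cell_module module_cell_module])
  next
    fix b assume b: "b \<in> cells X n c"
    obtain f g where fg: "b = (f, g)" by force
    then have f: "f \<in> Hom C c (cell_ob g)" and g: "valid_cell X g" using b by (auto simp: cells_def)
    note l = cell_bd_pull_closed[OF b[unfolded fg]]
    have "?d (n - 1) (?d n (cell_basis X n c b)) =
      lincomb (cell_module X (n - 1 - 1) c) (\<lambda>b'. ?d (n - 1) (cell_basis X (n - 1) c b')) (pull f (cell_bd g))"
      unfolding fg Diff_cell_basis[OF b[unfolded fg]]
      by (rule linear_map_lincomb[OF module_cell_module module_cell_module Diff_resolution_linear l cell_basis_funcset])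
    also have "\<dots> = lincomb (cell_module X (n - 1 - 1) c)
      (\<lambda>(h, g'). lincomb (cell_module X (n - 1 - 1) c) (cell_basis X (n - 1 - 1) c) (pull h (cell_bd g')))
      (pull f (cell_bd g))"
      using l by (intro lincomb_cong) (auto simp: Diff_cell_basis)
    also have "\<dots> = lincomb (cell_module X (n - 1 - 1) c) (cell_basis X (n - 1 - 1) c) (formal_boundary (pull f (cell_bd g)))"
      by (rule lincomb_formal_boundary(2)[OF module_cell_module l cell_basis_funcset, symmetric])
    also have "\<dots> = \<zero>\<^bsub>cell_module X (n - 1 - 1) c\<^esub>"
    proof (rule lincomb_null[OF module_cell_module lincomb_formal_boundary(1)[OF module_cell_module l cell_basis_funcset] cell_basis_funcset])
      show "null_combination R (formal_boundary (pull f (cell_bd g)))"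
        unfolding pull_formal_boundary[OF cell_bd_closed[OF b[unfolded fg]] f]
        unfolding pull_def
        by (rule null_combination_map[OF cring_R lincomb_formal_boundary(1)[OF module_cell_module
                cell_bd_closed[OF b[unfolded fg]] cell_basis_funcset] valid_cellD(4)[OF g]])
    qed
    finally show "compose (carrier (cell_module X n c)) (?d (n - 1)) (?d n) (cell_basis X n c b) =
        ?Z (cell_basis X n c b)"
      using cell_basis_closed[OF b] by (simp add: compose_def)
  qed (rule module_cell_module
      linear_maps_compose[OF module_cell_module Diff_resolution_linear Diff_resolution_linear])+
  then have "compose (carrier (cell_module X n c)) (?d (n - 1)) (?d n) x = ?Z x" by simp
  then show "?d (n - 1) (?d n x) = \<zero>\<^bsub>cell_module X (n - 1 - 1) c\<^esub>"
    using x by (simp add: compose_def)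
qed (auto intro: module_cell_module Diff_resolution_linear
    small_carrier_of_basis[OF universe small_R small_cells[OF X] cell_basis_is_basis])

lemma Res_resolution_chain_map:
  assumes f: "f \<in> Hom C a b"
  shows "Res (resolution X) f \<in> chain_maps R (Val (resolution X) b) (Val (resolution X) a)"
  unfolding chain_maps_def mem_Collect_eq Deg_resolution
proof (intro allI conjI ballI)
  fix n x assume x: "x \<in> carrier (cell_module X n b)"
  let ?l = "compose (carrier (cell_module X n b)) (Res (resolution X) f (n - 1)) (Diff (Val (resolution X) b) n)"
  let ?r = "compose (carrier (cell_module X n b)) (Diff (Val (resolution X) a) n) (Res (resolution X) f n)"
  have "?l = ?r"
  proof (rule cell_maps_eqI[of "cell_module X (n - 1) a"])
    fix b' assume b': "b' \<in> cells X n b"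
    obtain h g where hg: "b' = (h, g)" by force
    note hg' = b'[unfolded hg]
    show "?l (cell_basis X n b b') = ?r (cell_basis X n b b')"
      using Diff_cell_basis[OF hg'] Diff_cell_basis[OF cells_pull[OF hg' f]]
        Res_resolution_lincomb[OF f cell_bd_pull_closed[OF hg']] Res_cell_basis[OF f hg'] cell_basis_closed[OF hg']
        pull_Comp[OF cell_bd_closed[OF hg'] f, of h] hg'
      by (simp add: compose_def hg cells_def)
  qed (rule module_cell_module
      linear_maps_compose[OF module_cell_module Diff_resolution_linear Res_resolution_linear[OF f]]
      linear_maps_compose[OF module_cell_module Res_resolution_linear[OF f] Diff_resolution_linear])+
  then have "?l x = ?r x" by simp
  then show "Res (resolution X) f (n - 1) (Diff (Val (resolution X) b) n x) =
      Diff (Val (resolution X) a) n (Res (resolution X) f n x)"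
    using x by (simp add: compose_def)
qed (rule Res_resolution_linear[OF f])

lemma is_cpresheaf_resolution: "is_cpresheaf \<kappa> C R (resolution X)"
  unfolding is_cpresheaf_def
proof (intro conjI ballI impI)
  fix c assume c: "c \<in> Ob C"
  show "Res (resolution X) (Ident C c) = id_chain (Val (resolution X) c)"
  proof
    fix n
    show "Res (resolution X) (Ident C c) n = id_chain (Val (resolution X) c) n"
      unfolding id_chain_def Deg_resolution
    proof (rule cell_maps_eqI[of "cell_module X n c"])
      fix b assume b: "b \<in> cells X n c"
      then show "Res (resolution X) (Ident C c) n (cell_basis X n c b) =
          (\<lambda>x\<in>carrier (cell_module X n c). x) (cell_basis X n c b)"
        using Res_cell_basis[OF Ident_in_Hom[OF c]] cell_basis_closed[OF b] Comp_Ident_right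
        by (auto simp: cells_def)
    qed (rule module_cell_module linear_maps_id[OF module_cell_module]
        Res_resolution_linear[OF Ident_in_Hom[OF c]])+
  qed
next
  fix f g assume f: "f \<in> Mor C" and g: "g \<in> Mor C" and eq: "Cod C f = Dom C g"
  let ?a = "Dom C f" and ?b = "Dom C g" and ?c = "Cod C g"
  have f': "f \<in> Hom C ?a ?b" and g': "g \<in> Hom C ?b ?c" using f g eq by (auto simp: Hom_def)
  show "Res (resolution X) (Comp C g f) =
      comp_chain (Val (resolution X) ?c) (Res (resolution X) f) (Res (resolution X) g)"
  proof
    fix n
    show "Res (resolution X) (Comp C g f) n =
      comp_chain (Val (resolution X) ?c) (Res (resolution X) f) (Res (resolution X) g) n"
      unfolding comp_chain_def Deg_resolution
    proof (rule cell_maps_eqI[of "cell_module X n ?a"])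
      fix b assume b: "b \<in> cells X n ?c"
      obtain h k where hk: "b = (h, k)" by force
      note b' = b[unfolded hk]
      show "Res (resolution X) (Comp C g f) n (cell_basis X n ?c b) =
        compose (carrier (cell_module X n ?c)) (Res (resolution X) f n) (Res (resolution X) g n) (cell_basis X n ?c b)"
        using Res_cell_basis[OF g' b'] Res_cell_basis[OF f' cells_pull[OF b' g']] cell_basis_closed[OF b']
          Res_cell_basis[OF Comp_in_Hom[OF f' g'] b'] Comp_assoc[OF f' g', of h "cell_ob k"] b'
        by (simp add: compose_def hk cells_def)
    qed (rule module_cell_module Res_resolution_linear[OF Comp_in_Hom[OF f' g']]
        linear_maps_compose[OF module_cell_module Res_resolution_linear[OF g'] Res_resolution_linear[OF f']])+
  qed
qed (auto intro: is_complex_resolution Res_resolution_chain_map simp: Hom_def)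

end

end


section \<open>The universal property and the augmentation\<close>

context presheaf_setting
begin

text \<open>
  Restricting it along \<open>f\<close> gives the basis element \<open>(f, g)\<close>, so it stands for the cell itself.
\<close>

definition generator :: "('o, 'm, 'r, 'u) cpresheaf \<Rightarrow> ('o, 'm, 'r, 'u) cell \<Rightarrow> 'u" where
  "generator X g = cell_basis X (cell_dim g) (cell_ob g) (Ident C (cell_ob g), g)"

text \<open>
  The compatibility which the values of a chain map on the cells must satisfy: the differential of
  the value at \<open>g\<close> is the same combination of restricted values as the boundary of \<open>g\<close> is of
  restricted cells.
\<close>

definition coherent ::
  "('o, 'm, 'r, 'u) cpresheaf \<Rightarrow> ('o, 'm, 'r, 'u) cpresheaf \<Rightarrow> (('o, 'm, 'r, 'u) cell \<Rightarrow> 'u) \<Rightarrow> bool" where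
  "coherent X Y F \<longleftrightarrow> (\<forall>g. valid_cell X g \<longrightarrow>
     F g \<in> carrier (Deg (Val Y (cell_ob g)) (cell_dim g)) \<and>
     Diff (Val Y (cell_ob g)) (cell_dim g) (F g) =
       lincomb (Deg (Val Y (cell_ob g)) (cell_dim g - 1)) (\<lambda>(f, g'). Res Y f (cell_dim g - 1) (F g')) (cell_bd g))"

definition cell_map ::
  "('o, 'm, 'r, 'u) cpresheaf \<Rightarrow> ('o, 'm, 'r, 'u) cpresheaf \<Rightarrow> (('o, 'm, 'r, 'u) cell \<Rightarrow> 'u) \<Rightarrow>
   'o \<Rightarrow> int \<Rightarrow> 'u \<Rightarrow> 'u" where
  "cell_map X Y F = (\<lambda>c\<in>Ob C. \<lambda>n. cell_extension X n c (Deg (Val Y c) n) (\<lambda>(f, g). Res Y f n (F g)))"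

definition augmentation :: "('o, 'm, 'r, 'u) cpresheaf \<Rightarrow> 'o \<Rightarrow> int \<Rightarrow> 'u \<Rightarrow> 'u" where
  "augmentation X = cell_map X X cell_val"

lemma coherentD:
  assumes "coherent X Y F" "valid_cell X g"
  shows "F g \<in> carrier (Deg (Val Y (cell_ob g)) (cell_dim g))"
    and "Diff (Val Y (cell_ob g)) (cell_dim g) (F g) =
       lincomb (Deg (Val Y (cell_ob g)) (cell_dim g - 1)) (\<lambda>(f, g'). Res Y f (cell_dim g - 1) (F g')) (cell_bd g)"
  using assms by (auto simp: coherent_def)

lemma cells_Ident: "valid_cell X g \<Longrightarrow> (Ident C (cell_ob g), g) \<in> cells X (cell_dim g) (cell_ob g)"
  using valid_cellD(1) Ident_in_Hom by (auto simp: cells_def)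

context
  fixes X :: "('o, 'm, 'r, 'u) cpresheaf"
  assumes X: "is_cpresheaf \<kappa> C R X"
begin

lemma generator_closed: "valid_cell X g \<Longrightarrow> generator X g \<in> carrier (cell_module X (cell_dim g) (cell_ob g))"
  unfolding generator_def by (intro cell_basis_closed[OF X] cells_Ident)

lemma cell_basis_generator:
  assumes "(f, g) \<in> cells X n c"
  shows "cell_basis X n c (f, g) = Res (resolution X) f n (generator X g)"
  using Res_cell_basis[OF X, of f c "cell_ob g" "Ident C (cell_ob g)" g n] cells_Ident[of X g] assms
  by (auto simp: generator_def cells_def Comp_Ident_left)

lemma Diff_generator:
  assumes "valid_cell X g"
  shows "Diff (Val (resolution X) (cell_ob g)) (cell_dim g) (generator X g) =
    lincomb (cell_module X (cell_dim g - 1) (cell_ob g))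
      (\<lambda>(f, g'). Res (resolution X) f (cell_dim g - 1) (generator X g')) (cell_bd g)"
proof -
  have "lincomb (cell_module X (cell_dim g - 1) (cell_ob g)) (cell_basis X (cell_dim g - 1) (cell_ob g)) (cell_bd g)
    = lincomb (cell_module X (cell_dim g - 1) (cell_ob g))
      (\<lambda>(f, g'). Res (resolution X) f (cell_dim g - 1) (generator X g')) (cell_bd g)"
    using valid_cellD(3)[OF assms] by (intro lincomb_cong) (auto simp: cell_basis_generator)
  then show ?thesis
    using Diff_cell_basis[OF X cells_Ident[OF assms]] pull_Ident[OF valid_cellD(3)[OF assms]]
    by (simp add: generator_def)
qed

text \<open>
  Uniqueness in the universal property: the restrictions of the generators form bases.
\<close>

lemma resolution_map_eqI:
  assumes Y: "is_cpresheaf \<kappa> C R Y"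
    and \<phi>: "\<phi> \<in> cpresheaf_maps C R (resolution X) Y" and \<psi>: "\<psi> \<in> cpresheaf_maps C R (resolution X) Y"
    and eq: "\<And>g. valid_cell X g \<Longrightarrow>
      \<phi> (cell_ob g) (cell_dim g) (generator X g) = \<psi> (cell_ob g) (cell_dim g) (generator X g)"
  shows "\<phi> = \<psi>"
proof (rule extensionalityI[of _ "Ob C"])
  fix c assume c: "c \<in> Ob C"
  show "\<phi> c = \<psi> c"
  proof
    fix n
    show "\<phi> c n = \<psi> c n"
    proof (rule cell_maps_eqI[OF X])
      show "module R (Deg (Val Y c) n)" by (rule cpresheaf_module[OF Y c])
      show "\<phi> c n \<in> linear_maps R (cell_module X n c) (Deg (Val Y c) n)"
        "\<psi> c n \<in> linear_maps R (cell_module X n c) (Deg (Val Y c) n)"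
        using map_linear[OF \<phi> c, of n] map_linear[OF \<psi> c, of n] by simp_all
      fix b assume b: "b \<in> cells X n c"
      obtain f g where fg: "b = (f, g)" by force
      then have *: "valid_cell X g" "cell_dim g = n" "f \<in> Hom C c (cell_ob g)" using b by (auto simp: cells_def)
      show "\<phi> c n (cell_basis X n c b) = \<psi> c n (cell_basis X n c b)"
        using map_Res[OF \<phi> *(3), of "generator X g" n] map_Res[OF \<psi> *(3), of "generator X g" n]
          generator_closed[OF *(1)] eq[OF *(1)] *(2) cell_basis_generator[OF b[unfolded fg]] by (simp add: fg)
    qed
  qed
qed (use \<phi> \<psi> in \<open>auto simp: cpresheaf_maps_def\<close>)

context
  fixes Y :: "('o, 'm, 'r, 'u) cpresheaf" and F :: "('o, 'm, 'r, 'u) cell \<Rightarrow> 'u"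
  assumes Y: "is_cpresheaf \<kappa> C R Y" and F: "coherent X Y F"
begin

lemma coherent_funcset: "(\<lambda>(f, g). Res Y f n (F g)) \<in> cells X n c \<rightarrow> carrier (Deg (Val Y c) n)"
  using coherentD(1)[OF F] Res_closed[OF Y] by (auto simp: cells_def)

lemma cell_map_linear: "c \<in> Ob C \<Longrightarrow> cell_map X Y F c n \<in> linear_maps R (cell_module X n c) (Deg (Val Y c) n)"
  using cell_extension_linear[OF X cpresheaf_module[OF Y] coherent_funcset] by (simp add: cell_map_def)

lemma cell_map_lincomb:
  "c \<in> Ob C \<Longrightarrow> set l \<subseteq> carrier R \<times> cells X n c \<Longrightarrow>
    cell_map X Y F c n (lincomb (cell_module X n c) (cell_basis X n c) l) =
    lincomb (Deg (Val Y c) n) (\<lambda>(f, g). Res Y f n (F g)) l"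
  using cell_extension_lincomb[OF X cpresheaf_module[OF Y] coherent_funcset] by (simp add: cell_map_def)

lemma cell_map_basis:
  "c \<in> Ob C \<Longrightarrow> (f, g) \<in> cells X n c \<Longrightarrow> cell_map X Y F c n (cell_basis X n c (f, g)) = Res Y f n (F g)"
  using cell_extension_basis[OF X cpresheaf_module[OF Y] coherent_funcset, of c "(f, g)" n]
  by (simp add: cell_map_def)

lemma cell_map_generator:
  "valid_cell X g \<Longrightarrow> cell_map X Y F (cell_ob g) (cell_dim g) (generator X g) = F g"
  using cell_map_basis[OF _ cells_Ident] Res_Ident[OF Y] coherentD(1)[OF F] valid_cellD(1)
  by (simp add: generator_def)

lemma cell_map_Diff:
  assumes c: "c \<in> Ob C" and x: "x \<in> carrier (cell_module X n c)"
  shows "cell_map X Y F c (n - 1) (Diff (Val (resolution X) c) n x) = Diff (Val Y c) n (cell_map X Y F c n x)"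
proof -
  let ?l = "compose (carrier (cell_module X n c)) (cell_map X Y F c (n - 1)) (Diff (Val (resolution X) c) n)"
  let ?r = "compose (carrier (cell_module X n c)) (Diff (Val Y c) n) (cell_map X Y F c n)"
  note YC = is_complexD(3)[OF cpresheaf_complex[OF Y]]
  have "?l = ?r"
  proof (rule cell_maps_eqI[OF X, of "Deg (Val Y c) (n - 1)"])
    fix b assume b: "b \<in> cells X n c"
    obtain f g where fg: "b = (f, g)" by force
    note b' = b[unfolded fg]
    have g: "valid_cell X g" "cell_dim g = n" and f: "f \<in> Hom C c (cell_ob g)" using b' by (auto simp: cells_def)
    note d = valid_cellD(1)[OF g(1)]
    note l = cell_bd_closed[OF b']
    have FR: "(\<lambda>(h, g'). Res Y h (n - 1) (F g')) \<in> cells X (n - 1) (cell_ob g) \<rightarrow> carrier (Deg (Val Y (cell_ob g)) (n - 1))"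
      by (rule coherent_funcset)
    have Rff: "Res Y (Comp C h f) (n - 1) (F g') = Res Y f (n - 1) (Res Y h (n - 1) (F g'))"
      if "(h, g') \<in> cells X (n - 1) (cell_ob g)" for h g'
      using that coherentD(1)[OF F, of g'] Res_Comp[OF Y f, of h "cell_ob g'" "F g'" "n - 1"]
      by (auto simp: cells_def)
    have "cell_map X Y F c (n - 1) (Diff (Val (resolution X) c) n (cell_basis X n c (f, g)))
        = lincomb (Deg (Val Y c) (n - 1)) (\<lambda>(h, g'). Res Y h (n - 1) (F g')) (pull f (cell_bd g))"
      by (simp add: Diff_cell_basis[OF X b'] cell_map_lincomb[OF c cell_bd_pull_closed[OF b']])
    also have "\<dots> = lincomb (Deg (Val Y c) (n - 1)) (\<lambda>b. Res Y f (n - 1) ((\<lambda>(h, g'). Res Y h (n - 1) (F g')) b)) (cell_bd g)"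
      unfolding pull_def lincomb_map
      using l Rff by (intro lincomb_cong) auto
    also have "\<dots> = Res Y f (n - 1) (lincomb (Deg (Val Y (cell_ob g)) (n - 1)) (\<lambda>(h, g'). Res Y h (n - 1) (F g')) (cell_bd g))"
      by (rule linear_map_lincomb[OF cpresheaf_module[OF Y d] cpresheaf_module[OF Y c] Res_linear[OF Y f] l FR, symmetric])
    also have "\<dots> = Diff (Val Y c) n (Res Y f n (F g))"
      using coherentD(1)[OF F g(1)] Res_Diff[OF Y f]
      by (simp add: g(2) coherentD(2)[OF F g(1), unfolded g(2), symmetric])
    finally show "?l (cell_basis X n c b) = ?r (cell_basis X n c b)"
      using cell_basis_closed[OF X b] cell_map_basis[OF c b'] by (simp add: compose_def fg)
  qed (rule cpresheaf_module[OF Y c]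
      linear_maps_compose[OF module_cell_module[OF X] Diff_resolution_linear[OF X] cell_map_linear[OF c]]
      linear_maps_compose[OF module_cell_module[OF X] cell_map_linear[OF c] YC[OF c]])+
  then have "?l x = ?r x" by simp
  then show ?thesis using x by (simp add: compose_def)
qed

text \<open>
  Existence in the universal property. Linear extension makes every compatibility a statement about
  restricted cells; for the differential this is coherence, moved along a restriction.
\<close>

lemma cell_map_is_map: "cell_map X Y F \<in> cpresheaf_maps C R (resolution X) Y"
  unfolding cpresheaf_maps_def mem_Collect_eq
proof (intro conjI ballI)
  show "cell_map X Y F \<in> extensional (Ob C)" by (simp add: cell_map_def)
  show "cell_map X Y F c \<in> chain_maps R (Val (resolution X) c) (Val Y c)" if "c \<in> Ob C" for c
    using cell_map_linear[OF that] cell_map_Diff[OF that] by (simp add: chain_maps_def)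
  fix f assume "f \<in> Mor C"
  define a b where "a = Dom C f" and "b = Cod C f"
  have f: "f \<in> Hom C a b" using \<open>f \<in> Mor C\<close> by (simp add: Hom_def a_def b_def)
  then have ab: "a \<in> Ob C" "b \<in> Ob C" using HomD by auto
  show "comp_chain (Val (resolution X) b) (cell_map X Y F a) (Res (resolution X) f) =
      comp_chain (Val (resolution X) b) (Res Y f) (cell_map X Y F b)"
    unfolding comp_chain_def Deg_resolution
  proof
    fix n
    show "compose (carrier (cell_module X n b)) (cell_map X Y F a n) (Res (resolution X) f n) =
        compose (carrier (cell_module X n b)) (Res Y f n) (cell_map X Y F b n)"
    proof (rule cell_maps_eqI[OF X, of "Deg (Val Y a) n"])
      fix b' assume b': "b' \<in> cells X n b"
      obtain h g where hg: "b' = (h, g)" by force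
      note b'' = b'[unfolded hg]
      show "compose (carrier (cell_module X n b)) (cell_map X Y F a n) (Res (resolution X) f n) (cell_basis X n b b') =
          compose (carrier (cell_module X n b)) (Res Y f n) (cell_map X Y F b n) (cell_basis X n b b')"
        using cell_basis_closed[OF X b''] cell_map_basis[OF ab(2) b''] Res_cell_basis[OF X f b'']
          cell_map_basis[OF ab(1) cells_pull[OF b'' f]] Res_Comp[OF Y f, of h "cell_ob g" "F g" n]
          coherentD(1)[OF F, of g] b''
        by (auto simp: compose_def hg cells_def)
    qed (rule cpresheaf_module[OF Y ab(1)]
        linear_maps_compose[OF module_cell_module[OF X] Res_resolution_linear[OF X f] cell_map_linear[OF ab(1)]]
        linear_maps_compose[OF module_cell_module[OF X] cell_map_linear[OF ab(2)] Res_linear[OF Y f]])+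
  qed
qed

end

lemma coherent_cell_val: "coherent X X cell_val"
  using valid_cellD(2,5) by (auto simp: coherent_def)

text \<open>
  A cycle \<open>z\<close> of the resolution is a combination \<open>l\<close> of restricted cells. That it is a cycle and maps
  to the differential of \<open>x\<close> says exactly that the cell with boundary \<open>l\<close> and section \<open>x\<close> is
  valid, and its generator is the required filling.
\<close>

lemma augmentation_fills_spheres:
  assumes c: "c \<in> Ob C"
  shows "fills_spheres (Val (resolution X) c) (Val X c) (augmentation X c)"
  unfolding fills_spheres_def augmentation_def
proof (intro allI ballI impI)
  fix n z x
  assume z: "z \<in> cycles (Val (resolution X) c) (n - 1)" and x: "x \<in> carrier (Deg (Val X c) n)"
    and eq: "Diff (Val X c) n x = cell_map X X cell_val c (n - 1) z"
  have zM: "z \<in> carrier (cell_module X (n - 1) c)"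
    and dz: "Diff (Val (resolution X) c) (n - 1) z = \<zero>\<^bsub>cell_module X (n - 1 - 1) c\<^esub>"
    using z by (simp_all add: cycles_def)
  obtain l where l: "set l \<subseteq> carrier R \<times> cells X (n - 1) c"
    and zl: "z = lincomb (cell_module X (n - 1) c) (cell_basis X (n - 1) c) l"
    by (rule basis_span[OF cell_basis_is_basis[OF X] zM])
  note fb = lincomb_formal_boundary[OF module_cell_module[OF X] l cell_basis_funcset[OF X]]
  have "Diff (Val (resolution X) c) (n - 1) z = lincomb (cell_module X (n - 1 - 1) c)
      (\<lambda>b. Diff (Val (resolution X) c) (n - 1) (cell_basis X (n - 1) c b)) l"
    unfolding zl by (rule linear_map_lincomb[OF module_cell_module[OF X] module_cell_module[OF X]
          Diff_resolution_linear[OF X] l cell_basis_funcset[OF X]])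
  also have "\<dots> = lincomb (cell_module X (n - 1 - 1) c) (cell_basis X (n - 1 - 1) c) (formal_boundary l)"
    unfolding fb(2) using l by (intro lincomb_cong) (auto simp: Diff_cell_basis[OF X])
  finally have null: "null_combination R (formal_boundary l)"
    using basis_null_combination[OF cell_basis_is_basis[OF X] fb(1)] dz by simp
  let ?g = "Cell c n l x"
  have "Diff (Val X c) n x = lincomb (Deg (Val X c) (n - 1)) (\<lambda>(f, g). Res X f (n - 1) (cell_val g)) l"
    unfolding eq zl by (rule cell_map_lincomb[OF X coherent_cell_val c l])
  then have g: "valid_cell X ?g" by (intro valid_cellI c x l null)
  have "Diff (Val (resolution X) c) n (generator X ?g) = z"
    using Diff_cell_basis[OF X cells_Ident[OF g]] pull_Ident[OF l] zl by (simp add: generator_def)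
  then show "\<exists>y\<in>carrier (Deg (Val (resolution X) c) n).
      Diff (Val (resolution X) c) n y = z \<and> cell_map X X cell_val c n y = x"
    using generator_closed[OF g] cell_map_generator[OF X coherent_cell_val g]
    by (intro bexI[of _ "generator X ?g"]) simp_all
qed

end

end


section \<open>Functoriality\<close>

primrec map_cell :: "('o \<Rightarrow> int \<Rightarrow> 'u \<Rightarrow> 'v) \<Rightarrow> ('o, 'm, 'r, 'u) cell \<Rightarrow> ('o, 'm, 'r, 'v) cell" where
  "map_cell \<phi> (Cell c n l x) = Cell c n (map (map_prod id (map_prod id (map_cell \<phi>))) l) (\<phi> c n x)"

lemma map_cell_sel [simp]:
  "cell_ob (map_cell \<phi> g) = cell_ob g" "cell_dim (map_cell \<phi> g) = cell_dim g"
  "cell_bd (map_cell \<phi> g) = map (map_prod id (map_prod id (map_cell \<phi>))) (cell_bd g)"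
  "cell_val (map_cell \<phi> g) = \<phi> (cell_ob g) (cell_dim g) (cell_val g)"
  by (cases g; simp)+

context presheaf_setting
begin

lemma pull_map_cell:
  "pull f (map (map_prod id (map_prod id q)) l) = map (map_prod id (map_prod id q)) (pull f l)"
  by (induction l) auto

lemma formal_boundary_map_cell:
  "formal_boundary (map (map_prod id (map_prod id (map_cell \<phi>))) l) =
   map (map_prod id (map_prod id (map_cell \<phi>))) (formal_boundary l)"
  by (induction l) (auto simp: pull_map_cell)

text \<open>
  The boundary remains a cycle because the relabelling of cells is a renaming of symbols, and it
  remains over the differential of the section because the map is natural and a chain map.
\<close>

lemma valid_map_cell:
  assumes X: "is_cpresheaf \<kappa> C R X" and Y: "is_cpresheaf \<kappa> C R Y" and \<phi>: "\<phi> \<in> cpresheaf_maps C R X Y"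
  shows "valid_cell X g \<Longrightarrow> valid_cell Y (map_cell \<phi> g)"
proof (induction rule: valid_cell_induct)
  case (cell g)
  let ?c = "cell_ob g" and ?n = "cell_dim g" and ?l = "cell_bd g"
  let ?m = "map (map_prod id (map_prod id (map_cell \<phi>)))"
  note v = valid_cellD[OF cell.hyps]
  have "valid_cell Y (Cell ?c ?n (?m ?l) (\<phi> ?c ?n (cell_val g)))"
  proof (rule valid_cellI[OF v(1)])
    show "\<phi> ?c ?n (cell_val g) \<in> carrier (Deg (Val Y ?c) ?n)" by (rule map_closed[OF \<phi> v(1,2)])
    have "valid_cell Y (map_cell \<phi> g')" if "(r, f, g') \<in> set ?l" for r f g'
    proof (rule cell.IH)
      show "(f, g') \<in> snd ` set ?l" using that by force
    qed (use v(3) that in \<open>auto simp: cells_def\<close>)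
    then show "set (?m ?l) \<subseteq> carrier R \<times> cells Y (?n - 1) ?c"
      using v(3) by (auto simp: cells_def)
    show "null_combination R (formal_boundary (?m ?l))"
      unfolding formal_boundary_map_cell
      by (rule null_combination_map[OF cring_R lincomb_formal_boundary(1)[OF module_cell_module[OF X] v(3)
              cell_basis_funcset[OF X]] v(4)])
    have "Diff (Val Y ?c) ?n (\<phi> ?c ?n (cell_val g)) = \<phi> ?c (?n - 1) (Diff (Val X ?c) ?n (cell_val g))"
      using map_Diff[OF \<phi> v(1,2)] by simp
    also have "\<dots> = lincomb (Deg (Val Y ?c) (?n - 1))
        (\<lambda>b. \<phi> ?c (?n - 1) ((\<lambda>(f, g'). Res X f (?n - 1) (cell_val g')) b)) ?l"
      unfolding v(5)
      by (rule linear_map_lincomb[OF cpresheaf_module[OF X v(1)] cpresheaf_module[OF Y v(1)] map_linear[OF \<phi> v(1)] v(3)])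
        (intro coherent_funcset coherent_cell_val X)
    also have "\<dots> = lincomb (Deg (Val Y ?c) (?n - 1)) (\<lambda>(f, g'). Res Y f (?n - 1) (cell_val g')) (?m ?l)"
      unfolding lincomb_map
    proof (rule lincomb_cong, clarify)
      fix r f g' assume "(r, f, g') \<in> set ?l"
      then have g': "valid_cell X g'" "cell_dim g' = ?n - 1" "f \<in> Hom C ?c (cell_ob g')"
        using v(3) by (auto simp: cells_def)
      show "\<phi> ?c (?n - 1) (Res X f (?n - 1) (cell_val g')) =
        (case map_prod id (map_cell \<phi>) (f, g') of (f, g') \<Rightarrow> Res Y f (?n - 1) (cell_val g'))"
        using map_Res[OF \<phi> g'(3), of "cell_val g'" "?n - 1"] valid_cellD(2)[OF g'(1)] g'(2) by simp
    qed
    finally show "Diff (Val Y ?c) ?n (\<phi> ?c ?n (cell_val g)) =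
        lincomb (Deg (Val Y ?c) (?n - 1)) (\<lambda>(f, g'). Res Y f (?n - 1) (cell_val g')) (?m ?l)" .
  qed
  moreover have "map_cell \<phi> g = Cell ?c ?n (?m ?l) (\<phi> ?c ?n (cell_val g))" by (cases g) simp
  ultimately show ?case by simp
qed

definition resolution_map ::
  "('o, 'm, 'r, 'u) cpresheaf \<Rightarrow> ('o, 'm, 'r, 'u) cpresheaf \<Rightarrow> ('o \<Rightarrow> int \<Rightarrow> 'u \<Rightarrow> 'u) \<Rightarrow> 'o \<Rightarrow> int \<Rightarrow> 'u \<Rightarrow> 'u" where
  "resolution_map X Y \<phi> = cell_map X (resolution Y) (\<lambda>g. generator Y (map_cell \<phi> g))"

context
  fixes X Y \<phi>
  assumes X: "is_cpresheaf \<kappa> C R X" and Y: "is_cpresheaf \<kappa> C R Y" and \<phi>: "\<phi> \<in> cpresheaf_maps C R X Y"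
begin

lemma coherent_map_cell: "coherent X (resolution Y) (\<lambda>g. generator Y (map_cell \<phi> g))"
  unfolding coherent_def
proof (intro allI impI conjI)
  fix g assume g: "valid_cell X g"
  note v = valid_map_cell[OF X Y \<phi> g]
  show "generator Y (map_cell \<phi> g) \<in> carrier (Deg (Val (resolution Y) (cell_ob g)) (cell_dim g))"
    using generator_closed[OF Y v] by simp
  show "Diff (Val (resolution Y) (cell_ob g)) (cell_dim g) (generator Y (map_cell \<phi> g)) =
    lincomb (Deg (Val (resolution Y) (cell_ob g)) (cell_dim g - 1))
      (\<lambda>(f, g'). Res (resolution Y) f (cell_dim g - 1) (generator Y (map_cell \<phi> g'))) (cell_bd g)"
    using Diff_generator[OF Y v] by (auto simp: lincomb_map intro!: lincomb_cong)
qed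

lemma resolution_map_is_map: "resolution_map X Y \<phi> \<in> cpresheaf_maps C R (resolution X) (resolution Y)"
  unfolding resolution_map_def by (rule cell_map_is_map[OF X is_cpresheaf_resolution[OF Y] coherent_map_cell])

lemma resolution_map_generator:
  "valid_cell X g \<Longrightarrow>
    resolution_map X Y \<phi> (cell_ob g) (cell_dim g) (generator X g) = generator Y (map_cell \<phi> g)"
  unfolding resolution_map_def
  by (rule cell_map_generator[OF X is_cpresheaf_resolution[OF Y] coherent_map_cell])

end

lemma augmentation_is_map:
  "is_cpresheaf \<kappa> C R X \<Longrightarrow> augmentation X \<in> cpresheaf_maps C R (resolution X) X"
  unfolding augmentation_def by (rule cell_map_is_map[OF _ _ coherent_cell_val])

lemma augmentation_generator:
  "is_cpresheaf \<kappa> C R X \<Longrightarrow> valid_cell X g \<Longrightarrow>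
    augmentation X (cell_ob g) (cell_dim g) (generator X g) = cell_val g"
  unfolding augmentation_def by (rule cell_map_generator[OF _ _ coherent_cell_val])

lemma comp_generator:
  assumes "is_cpresheaf \<kappa> C R X" "valid_cell X g"
  shows "(\<lambda>c\<in>Ob C. comp_chain (Val (resolution X) c) (\<psi> c) (\<phi> c)) (cell_ob g) (cell_dim g) (generator X g) =
    \<psi> (cell_ob g) (cell_dim g) (\<phi> (cell_ob g) (cell_dim g) (generator X g))"
  using generator_closed[OF assms] valid_cellD(1)[OF assms(2)] by (simp add: comp_chain_def compose_def)

text \<open>
  Uniqueness in the universal property reduces this law, and the one for composition, to an identity
  between cells, proved by induction along boundaries.
\<close>

lemma resolution_map_id:
  assumes X: "is_cpresheaf \<kappa> C R X"
  shows "resolution_map X X (\<lambda>c\<in>Ob C. id_chain (Val X c)) = (\<lambda>c\<in>Ob C. id_chain (Val (resolution X) c))"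
proof (rule resolution_map_eqI[OF X is_cpresheaf_resolution[OF X]])
  let ?i = "\<lambda>c\<in>Ob C. id_chain (Val X c)"
  note i = cpresheaf_maps_id[OF category_axioms X]
  show "resolution_map X X ?i \<in> cpresheaf_maps C R (resolution X) (resolution X)"
    by (rule resolution_map_is_map[OF X X i])
  show "(\<lambda>c\<in>Ob C. id_chain (Val (resolution X) c)) \<in> cpresheaf_maps C R (resolution X) (resolution X)"
    by (rule cpresheaf_maps_id[OF category_axioms is_cpresheaf_resolution[OF X]])
  fix g assume g: "valid_cell X g"
  have "map_cell ?i g = g"
    using g
  proof (induction rule: valid_cell_induct)
    case (cell g)
    note v = valid_cellD[OF cell.hyps]
    have "map_cell ?i g' = g'" if "(r, f, g') \<in> set (cell_bd g)" for r f g'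
    proof (rule cell.IH)
      show "(f, g') \<in> snd ` set (cell_bd g)" using that by force
    qed (use v(3) that in \<open>auto simp: cells_def\<close>)
    then have "map (map_prod id (map_prod id (map_cell ?i))) (cell_bd g) = cell_bd g"
      by (intro map_idI) auto
    moreover have "?i (cell_ob g) (cell_dim g) (cell_val g) = cell_val g"
      using v(1,2) by (simp add: id_chain_def)
    ultimately show ?case by (intro cell.expand) (simp only: map_cell_sel simp_thms)
  qed
  then show "resolution_map X X ?i (cell_ob g) (cell_dim g) (generator X g) =
      (\<lambda>c\<in>Ob C. id_chain (Val (resolution X) c)) (cell_ob g) (cell_dim g) (generator X g)"
    using resolution_map_generator[OF X X i g] generator_closed[OF X g] valid_cellD(1)[OF g]
    by (simp add: id_chain_def)
qed

lemma resolution_map_comp: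
  assumes X: "is_cpresheaf \<kappa> C R X" and Y: "is_cpresheaf \<kappa> C R Y" and Z: "is_cpresheaf \<kappa> C R Z"
    and \<phi>: "\<phi> \<in> cpresheaf_maps C R X Y" and \<psi>: "\<psi> \<in> cpresheaf_maps C R Y Z"
  shows "resolution_map X Z (\<lambda>c\<in>Ob C. comp_chain (Val X c) (\<psi> c) (\<phi> c)) =
    (\<lambda>c\<in>Ob C. comp_chain (Val (resolution X) c) (resolution_map Y Z \<psi> c) (resolution_map X Y \<phi> c))"
proof (rule resolution_map_eqI[OF X is_cpresheaf_resolution[OF Z]])
  let ?c = "\<lambda>c\<in>Ob C. comp_chain (Val X c) (\<psi> c) (\<phi> c)"
  note c = cpresheaf_maps_comp[OF category_axioms X Y \<phi> \<psi>]
  show "resolution_map X Z ?c \<in> cpresheaf_maps C R (resolution X) (resolution Z)"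
    by (rule resolution_map_is_map[OF X Z c])
  show "(\<lambda>c\<in>Ob C. comp_chain (Val (resolution X) c) (resolution_map Y Z \<psi> c) (resolution_map X Y \<phi> c))
      \<in> cpresheaf_maps C R (resolution X) (resolution Z)"
    by (rule cpresheaf_maps_comp[OF category_axioms is_cpresheaf_resolution[OF X] is_cpresheaf_resolution[OF Y]
          resolution_map_is_map[OF X Y \<phi>] resolution_map_is_map[OF Y Z \<psi>]])
  fix g assume g: "valid_cell X g"
  have "map_cell ?c g = map_cell \<psi> (map_cell \<phi> g)"
    using g
  proof (induction rule: valid_cell_induct)
    case (cell g)
    note v = valid_cellD[OF cell.hyps]
    have "map_cell ?c g' = map_cell \<psi> (map_cell \<phi> g')" if "(r, f, g') \<in> set (cell_bd g)" for r f g'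
    proof (rule cell.IH)
      show "(f, g') \<in> snd ` set (cell_bd g)" using that by force
    qed (use v(3) that in \<open>auto simp: cells_def\<close>)
    then have "map (map_prod id (map_prod id (map_cell ?c))) (cell_bd g) =
        map (map_prod id (map_prod id (map_cell \<psi>))) (map (map_prod id (map_prod id (map_cell \<phi>))) (cell_bd g))"
      by auto
    moreover have "?c (cell_ob g) (cell_dim g) (cell_val g) =
        \<psi> (cell_ob g) (cell_dim g) (\<phi> (cell_ob g) (cell_dim g) (cell_val g))"
      using v(1,2) by (simp add: comp_chain_def compose_def)
    ultimately show ?case by (intro cell.expand) (simp only: map_cell_sel simp_thms)
  qed
  then show "resolution_map X Z ?c (cell_ob g) (cell_dim g) (generator X g) =
      (\<lambda>c\<in>Ob C. comp_chain (Val (resolution X) c) (resolution_map Y Z \<psi> c) (resolution_map X Y \<phi> c))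
        (cell_ob g) (cell_dim g) (generator X g)"
    using resolution_map_generator[OF X Z c g] resolution_map_generator[OF X Y \<phi> g]
      resolution_map_generator[OF Y Z \<psi> valid_map_cell[OF X Y \<phi> g]]
    unfolding comp_generator[OF X g] by simp
qed

lemma augmentation_natural:
  assumes X: "is_cpresheaf \<kappa> C R X" and Y: "is_cpresheaf \<kappa> C R Y" and \<phi>: "\<phi> \<in> cpresheaf_maps C R X Y"
  shows "(\<lambda>c\<in>Ob C. comp_chain (Val (resolution X) c) (augmentation Y c) (resolution_map X Y \<phi> c)) =
    (\<lambda>c\<in>Ob C. comp_chain (Val (resolution X) c) (\<phi> c) (augmentation X c))" (is "?l = ?r")
proof (rule resolution_map_eqI[OF X Y])
  note QX = is_cpresheaf_resolution[OF X] and QY = is_cpresheaf_resolution[OF Y]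
  show "?l \<in> cpresheaf_maps C R (resolution X) Y"
    by (rule cpresheaf_maps_comp[OF category_axioms QX QY resolution_map_is_map[OF X Y \<phi>] augmentation_is_map[OF Y]])
  show "?r \<in> cpresheaf_maps C R (resolution X) Y"
    by (rule cpresheaf_maps_comp[OF category_axioms QX X augmentation_is_map[OF X] \<phi>])
  fix g assume g: "valid_cell X g"
  show "?l (cell_ob g) (cell_dim g) (generator X g) = ?r (cell_ob g) (cell_dim g) (generator X g)"
    using resolution_map_generator[OF X Y \<phi> g] augmentation_generator[OF X g]
      augmentation_generator[OF Y valid_map_cell[OF X Y \<phi> g]]
    unfolding comp_generator[OF X g] by simp
qed

definition resolution_arrow ::
  "('o, 'm, 'r, 'u) cpresheaf_arrow \<Rightarrow> ('o, 'm, 'r, 'u) cpresheaf_arrow" where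
  "resolution_arrow = (\<lambda>(X, Y, \<phi>). (resolution X, resolution Y, resolution_map X Y \<phi>))"

definition augmentation_arrow :: "('o, 'm, 'r, 'u) cpresheaf \<Rightarrow> ('o, 'm, 'r, 'u) cpresheaf_arrow" where
  "augmentation_arrow X = (resolution X, X, augmentation X)"

lemma functor_resolution: "is_functor (UCat \<kappa> C R) (UCat \<kappa> C R) resolution resolution_arrow"
  unfolding is_functor_def
proof (intro conjI category_UCat[OF category_axioms])
qed (auto simp: UCat_def Hom_def resolution_arrow_def resolution_map_id resolution_map_comp
      is_cpresheaf_resolution resolution_map_is_map)

lemma nat_trans_augmentation:
  "is_nat_trans (UCat \<kappa> C R) (UCat \<kappa> C R) resolution resolution_arrow (\<lambda>X. X) (\<lambda>f. f) augmentation_arrow"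
  unfolding is_nat_trans_def
proof (intro conjI ballI)
  show "is_functor (UCat \<kappa> C R) (UCat \<kappa> C R) resolution resolution_arrow" by (rule functor_resolution)
  show "is_functor (UCat \<kappa> C R) (UCat \<kappa> C R) (\<lambda>X. X) (\<lambda>f. f)"
    using category_UCat[OF category_axioms, of \<kappa> R] category.Dom_in_Ob category.Cod_in_Ob
    by (auto simp: is_functor_def Hom_def)
qed (auto simp: UCat_def Hom_def resolution_arrow_def augmentation_arrow_def
    is_cpresheaf_resolution augmentation_is_map augmentation_natural)

lemma trivial_fibrationD:
  assumes "trivial_fibration \<kappa> C R (X, Y, \<phi>)"
  shows "is_cpresheaf \<kappa> C R X" "is_cpresheaf \<kappa> C R Y" "\<phi> \<in> cpresheaf_maps C R X Y"
    and "c \<in> Ob C \<Longrightarrow> fills_spheres (Val X c) (Val Y c) (\<phi> c)"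
proof -
  show *: "is_cpresheaf \<kappa> C R X" "is_cpresheaf \<kappa> C R Y" "\<phi> \<in> cpresheaf_maps C R X Y"
    using assms by (auto simp: trivial_fibration_def fibration_def UCat_def)
  show "fills_spheres (Val X c) (Val Y c) (\<phi> c)" if c: "c \<in> Ob C"
    using assms c
    by (intro surj_quasi_iso_fills_spheres[OF cpresheaf_complex[OF *(1) c] cpresheaf_complex[OF *(2) c] map_chain_map[OF *(3) c]])
      (auto simp: trivial_fibration_def fibration_def weak_equivalence_def)
qed

lemma trivial_fibration_augmentation:
  assumes X: "is_cpresheaf \<kappa> C R X"
  shows "trivial_fibration \<kappa> C R (augmentation_arrow X)"
proof -
  note QX = is_cpresheaf_resolution[OF X]
  have "(resolution X, X, augmentation X) \<in> Mor (UCat \<kappa> C R)"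
    using X QX augmentation_is_map by (simp add: UCat_def)
  moreover have "augmentation X c n ` carrier (Deg (Val (resolution X) c) n) = carrier (Deg (Val X c) n)"
    "quasi_iso (Val (resolution X) c) (Val X c) (augmentation X c)" if c: "c \<in> Ob C" for c n
  proof -
    note a = cpresheaf_complex[OF QX c] cpresheaf_complex[OF X c] map_chain_map[OF augmentation_is_map[OF X] c]
      augmentation_fills_spheres[OF X c]
    show "augmentation X c n ` carrier (Deg (Val (resolution X) c) n) = carrier (Deg (Val X c) n)"
      by (rule fills_spheres_surj[OF a])
    show "quasi_iso (Val (resolution X) c) (Val X c) (augmentation X c)"
      by (rule fills_spheres_quasi_iso[OF a])
  qed
  ultimately show ?thesis
    by (simp add: trivial_fibration_def fibration_def weak_equivalence_def augmentation_arrow_def)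
qed

end


section \<open>Cofibrancy\<close>

context presheaf_setting
begin

text \<open>
  The single element of the zero modules is \<open>undefined\<close>, the value that linear maps have outside the
  carrier. So constant functions serve as differentials and restrictions.
\<close>

definition zero_cpresheaf :: "('o, 'm, 'r, 'u) cpresheaf" where
  "zero_cpresheaf = \<lparr>
     Val = (\<lambda>c. \<lparr>
       Deg = (\<lambda>n. \<lparr>carrier = {undefined}, monoid.mult = undefined, one = undefined, zero = undefined,
         add = (\<lambda>x y. undefined), module.smult = (\<lambda>a x. undefined)\<rparr>),
       Diff = (\<lambda>n x. undefined)\<rparr>),
     Res = (\<lambda>f n x. undefined)\<rparr>"

lemma is_cpresheaf_zero: "is_cpresheaf \<kappa> C R zero_cpresheaf"
proof -
  have "module R (Deg (Val zero_cpresheaf c) n)" for c n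
    by (rule moduleI[OF cring_R]) (auto simp: zero_cpresheaf_def intro!: abelian_groupI)
  then show ?thesis
    using small_finite[OF universe, of "{undefined :: 'u}"]
    by (auto simp: is_cpresheaf_def is_complex_def chain_maps_def linear_maps_def zero_cpresheaf_def
        id_chain_def comp_chain_def compose_def restrict_def fun_eq_iff)
qed

definition zero_map :: "('o, 'm, 'r, 'u) cpresheaf \<Rightarrow> 'o \<Rightarrow> int \<Rightarrow> 'u \<Rightarrow> 'u" where
  "zero_map X = (\<lambda>c\<in>Ob C. \<lambda>n. \<lambda>x\<in>carrier (Deg (Val zero_cpresheaf c) n). \<zero>\<^bsub>Deg (Val X c) n\<^esub>)"

lemma zero_map_is_map:
  assumes X: "is_cpresheaf \<kappa> C R X"
  shows "zero_map X \<in> cpresheaf_maps C R zero_cpresheaf X"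
  unfolding cpresheaf_maps_def mem_Collect_eq
proof (intro conjI ballI)
  show "zero_map X \<in> extensional (Ob C)" by (simp add: zero_map_def)
  show "zero_map X c \<in> chain_maps R (Val zero_cpresheaf c) (Val X c)" if c: "c \<in> Ob C" for c
    using linear_maps_zero_map[OF cpresheaf_module[OF is_cpresheaf_zero c] cpresheaf_module[OF X c]] c
      is_complex_Diff_zero[OF cpresheaf_complex[OF X c]]
      linear_mapsD(1)[OF is_complexD(3)[OF cpresheaf_complex[OF is_cpresheaf_zero c]]]
    by (auto simp: chain_maps_def zero_map_def)
  fix f assume "f \<in> Mor C"
  then have f: "f \<in> Hom C (Dom C f) (Cod C f)" by (simp add: Hom_def)
  show "comp_chain (Val zero_cpresheaf (Cod C f)) (zero_map X (Dom C f)) (Res zero_cpresheaf f) =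
      comp_chain (Val zero_cpresheaf (Cod C f)) (Res X f) (zero_map X (Cod C f))"
    using HomD[OF f] Res_closed[OF is_cpresheaf_zero f]
      linear_maps_zero[OF cpresheaf_module[OF X] cpresheaf_module[OF X] Res_linear[OF X f]]
    by (auto simp: comp_chain_def compose_def zero_map_def fun_eq_iff)
qed

lemma zero_map_unique:
  assumes X: "is_cpresheaf \<kappa> C R X" and \<phi>: "\<phi> \<in> cpresheaf_maps C R zero_cpresheaf X"
  shows "\<phi> = zero_map X"
proof (rule extensionalityI[of _ "Ob C"])
  fix c assume c: "c \<in> Ob C"
  show "\<phi> c = zero_map X c"
  proof (intro ext)
    fix n x
    note l = map_linear[OF \<phi> c, of n]
    have "carrier (Deg (Val zero_cpresheaf c) n) = {\<zero>\<^bsub>Deg (Val zero_cpresheaf c) n\<^esub>}"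
      by (simp add: zero_cpresheaf_def)
    then show "\<phi> c n x = zero_map X c n x"
      using c linear_maps_zero[OF cpresheaf_module[OF is_cpresheaf_zero c] cpresheaf_module[OF X c] l]
        linear_mapsD(4)[OF l, of x] by (auto simp: zero_map_def)
  qed
qed (use \<phi> in \<open>auto simp: cpresheaf_maps_def zero_map_def\<close>)

lemma initial_zero: "initial (UCat \<kappa> C R) zero_cpresheaf"
  unfolding initial_def
proof (intro conjI ballI)
  show "zero_cpresheaf \<in> Ob (UCat \<kappa> C R)" by (simp add: UCat_def is_cpresheaf_zero)
  fix X assume "X \<in> Ob (UCat \<kappa> C R)"
  then have X: "is_cpresheaf \<kappa> C R X" by (simp add: UCat_def)
  show "\<exists>!f. f \<in> Hom (UCat \<kappa> C R) zero_cpresheaf X"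
  proof (rule ex1I)
    show "(zero_cpresheaf, X, zero_map X) \<in> Hom (UCat \<kappa> C R) zero_cpresheaf X"
      by (simp add: Hom_def UCat_def X is_cpresheaf_zero zero_map_is_map)
  qed (auto simp: Hom_def UCat_def zero_map_unique[OF X])
qed

definition lift_condition ::
  "('o, 'm, 'r, 'u) cpresheaf \<Rightarrow> ('o \<Rightarrow> int \<Rightarrow> 'u \<Rightarrow> 'u) \<Rightarrow> 'o \<Rightarrow> int \<Rightarrow> 'u \<Rightarrow> 'u \<Rightarrow> 'u \<Rightarrow> bool" where
  "lift_condition E p c n z b y \<longleftrightarrow>
     y \<in> carrier (Deg (Val E c) n) \<and> Diff (Val E c) n y = z \<and> p c n y = b"

text \<open>
  The default \<open>\<zero>\<close> keeps the value in the right module even if no filling exists. In this way the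
  lifts of all cells, not only of those for which the choice is known to succeed, can be inserted
  into \<open>lincomb_formal_boundary\<close>.
\<close>

primrec lift_cell ::
  "('o, 'm, 'r, 'u) cpresheaf \<Rightarrow> ('o \<Rightarrow> int \<Rightarrow> 'u \<Rightarrow> 'u) \<Rightarrow> (('o, 'm, 'r, 'u) cell \<Rightarrow> 'u) \<Rightarrow>
   ('o, 'm, 'r, 'u) cell \<Rightarrow> 'u" where
  "lift_cell E p w (Cell c n l x) =
    (let z = lincomb (Deg (Val E c) (n - 1)) (\<lambda>(f, y). Res E f (n - 1) y)
               (map (map_prod id (map_prod id (lift_cell E p w))) l);
         P = lift_condition E p c n z (w (Cell c n l x))
     in if \<exists>y. P y then SOME y. P y else \<zero>\<^bsub>Deg (Val E c) n\<^esub>)"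

lemma lift_cell_closed:
  assumes E: "is_cpresheaf \<kappa> C R E" and g: "cell_ob g \<in> Ob C"
  shows "lift_cell E p w g \<in> carrier (Deg (Val E (cell_ob g)) (cell_dim g))"
proof (cases g)
  case (Cell c n l x)
  define P where "P = lift_condition E p c n (lincomb (Deg (Val E c) (n - 1)) (\<lambda>(f, y). Res E f (n - 1) y)
               (map (map_prod id (map_prod id (lift_cell E p w))) l)) (w (Cell c n l x))"
  have "lift_cell E p w g = (if \<exists>y. P y then SOME y. P y else \<zero>\<^bsub>Deg (Val E c) n\<^esub>)"
    by (simp only: Cell lift_cell.simps Let_def P_def)
  moreover have "(SOME y. P y) \<in> carrier (Deg (Val E c) n)" if "\<exists>y. P y"
    using someI_ex[OF that] unfolding P_def lift_condition_def by blast
  ultimately show ?thesis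
    using is_complex_zero_closed[OF cpresheaf_complex[OF E g], of "cell_dim g"] by (simp add: Cell)
qed

lemma lift_cell_condition:
  assumes "lift_condition E p (cell_ob g) (cell_dim g)
    (lincomb (Deg (Val E (cell_ob g)) (cell_dim g - 1))
      (\<lambda>(f, g'). Res E f (cell_dim g - 1) (lift_cell E p w g')) (cell_bd g)) (w g) y"
  shows "lift_condition E p (cell_ob g) (cell_dim g)
    (lincomb (Deg (Val E (cell_ob g)) (cell_dim g - 1))
      (\<lambda>(f, g'). Res E f (cell_dim g - 1) (lift_cell E p w g')) (cell_bd g)) (w g) (lift_cell E p w g)"
proof (cases g)
  case (Cell c n l x)
  define P where "P = lift_condition E p c n (lincomb (Deg (Val E c) (n - 1)) (\<lambda>(f, y). Res E f (n - 1) y)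
               (map (map_prod id (map_prod id (lift_cell E p w))) l)) (w (Cell c n l x))"
  have "lincomb M (\<lambda>(f, y). Res E f (n - 1) y) (map (map_prod id (map_prod id (lift_cell E p w))) l) =
      lincomb M (\<lambda>(f, g'). Res E f (n - 1) (lift_cell E p w g')) l" for M
    unfolding lincomb_map by (intro lincomb_cong) auto
  then have eq: "P = lift_condition E p (cell_ob g) (cell_dim g)
    (lincomb (Deg (Val E (cell_ob g)) (cell_dim g - 1))
      (\<lambda>(f, g'). Res E f (cell_dim g - 1) (lift_cell E p w g')) (cell_bd g)) (w g)"
    by (simp add: P_def Cell)
  have l: "lift_cell E p w g = (if \<exists>y. P y then SOME y. P y else \<zero>\<^bsub>Deg (Val E c) n\<^esub>)"
    by (simp only: Cell lift_cell.simps Let_def P_def)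
  have "\<exists>y. P y" using assms eq by auto
  then have "P (lift_cell E p w g)" unfolding l by (simp add: someI_ex)
  then show ?thesis by (simp add: eq)
qed

context
  fixes X E B p v w
  assumes X: "is_cpresheaf \<kappa> C R X" and p: "trivial_fibration \<kappa> C R (E, B, p)"
    and v: "v \<in> cpresheaf_maps C R (resolution X) B"
    and w_def: "w = (\<lambda>g. v (cell_ob g) (cell_dim g) (generator X g))"
begin

text \<open>
  By induction, the lifts of the cells in the boundary of \<open>g\<close> satisfy the condition. Hence they
  combine to a cycle \<open>?z\<close> over the differential of \<open>w g\<close>, and the trivial fibration fills it.
\<close>

lemma lift_cell_works:
  assumes "valid_cell X g"
  shows "lift_condition E p (cell_ob g) (cell_dim g)
    (lincomb (Deg (Val E (cell_ob g)) (cell_dim g - 1))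
      (\<lambda>(f, g'). Res E f (cell_dim g - 1) (lift_cell E p w g')) (cell_bd g)) (w g) (lift_cell E p w g)"
  using assms
proof (induction rule: valid_cell_induct)
  case (cell g)
  note E = trivial_fibrationD(1)[OF p] and B = trivial_fibrationD(2)[OF p] and pm = trivial_fibrationD(3)[OF p]
  let ?c = "cell_ob g" and ?n = "cell_dim g" and ?l = "cell_bd g"
  let ?s = "lift_cell E p w"
  let ?G = "\<lambda>n (f, g'). Res E f n (?s g')"
  let ?z = "lincomb (Deg (Val E ?c) (?n - 1)) (?G (?n - 1)) ?l"
  note V = valid_cellD[OF cell.hyps]
  note c = V(1) and l = V(3)
  have G: "?G n \<in> cells X n c \<rightarrow> carrier (Deg (Val E c) n)" for n c
    using lift_cell_closed[OF E] valid_cellD(1) Res_closed[OF E] by (auto simp: cells_def)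
  have bd: "valid_cell X g'" "cell_dim g' = ?n - 1" "f \<in> Hom C ?c (cell_ob g')"
    "Diff (Val E (cell_ob g')) (?n - 1) (?s g') =
      lincomb (Deg (Val E (cell_ob g')) (?n - 1 - 1)) (?G (?n - 1 - 1)) (cell_bd g')"
    "p (cell_ob g') (?n - 1) (?s g') = w g'" "?s g' \<in> carrier (Deg (Val E (cell_ob g')) (?n - 1))"
    if "(r, f, g') \<in> set ?l" for r f g'
  proof -
    show g': "valid_cell X g'" "cell_dim g' = ?n - 1" "f \<in> Hom C ?c (cell_ob g')"
      using that l by (auto simp: cells_def)
    have "(f, g') \<in> snd ` set ?l" using that by force
    from cell.IH[OF this g'] show "Diff (Val E (cell_ob g')) (?n - 1) (?s g') =
      lincomb (Deg (Val E (cell_ob g')) (?n - 1 - 1)) (?G (?n - 1 - 1)) (cell_bd g')"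
      "p (cell_ob g') (?n - 1) (?s g') = w g'" "?s g' \<in> carrier (Deg (Val E (cell_ob g')) (?n - 1))"
      by (simp_all add: lift_condition_def g'(2))
  qed
  \<comment> \<open>\<open>?z\<close> is a cycle: its differential is the value of a formal boundary with zero coefficients\<close>
  have "Diff (Val E ?c) (?n - 1) (Res E f (?n - 1) (?s g')) =
      lincomb (Deg (Val E ?c) (?n - 1 - 1)) (?G (?n - 1 - 1)) (pull f (cell_bd g'))"
    if m: "(r, f, g') \<in> set ?l" for r f g'
  proof -
    note b = bd[OF m]
    note l' = valid_cellD(3)[OF b(1), unfolded b(2)]
    have "Diff (Val E ?c) (?n - 1) (Res E f (?n - 1) (?s g')) =
        Res E f (?n - 1 - 1) (lincomb (Deg (Val E (cell_ob g')) (?n - 1 - 1)) (?G (?n - 1 - 1)) (cell_bd g'))"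
      using Res_Diff[OF E b(3,6)] b(4) by simp
    also have "\<dots> = lincomb (Deg (Val E ?c) (?n - 1 - 1)) (\<lambda>b. Res E f (?n - 1 - 1) (?G (?n - 1 - 1) b)) (cell_bd g')"
      by (rule linear_map_lincomb[OF cpresheaf_module[OF E valid_cellD(1)[OF b(1)]] cpresheaf_module[OF E c]
            Res_linear[OF E b(3)] l' G])
    also have "\<dots> = lincomb (Deg (Val E ?c) (?n - 1 - 1)) (?G (?n - 1 - 1)) (pull f (cell_bd g'))"
      unfolding pull_def lincomb_map
    proof (rule lincomb_cong)
      fix r' hk assume "(r', hk) \<in> set (cell_bd g')"
      moreover obtain h k where hk: "hk = (h, k)" by force
      ultimately have k: "valid_cell X k" "cell_dim k = ?n - 1 - 1" "h \<in> Hom C (cell_ob g') (cell_ob k)"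
        using l' by (auto simp: cells_def)
      show "Res E f (?n - 1 - 1) (?G (?n - 1 - 1) hk) =
          ?G (?n - 1 - 1) (case hk of (h, g) \<Rightarrow> (Comp C h f, g))"
        using Res_Comp[OF E b(3) k(3), of "?s k" "?n - 1 - 1"] lift_cell_closed[OF E valid_cellD(1)[OF k(1)], of p w] k(2)
        by (simp add: hk)
    qed
    finally show ?thesis .
  qed
  then have "Diff (Val E ?c) (?n - 1) ?z =
      lincomb (Deg (Val E ?c) (?n - 1 - 1))
        (\<lambda>(f, g'). lincomb (Deg (Val E ?c) (?n - 1 - 1)) (?G (?n - 1 - 1)) (pull f (cell_bd g'))) ?l"
    unfolding linear_map_lincomb[OF cpresheaf_module[OF E c] cpresheaf_module[OF E c]
        is_complexD(3)[OF cpresheaf_complex[OF E c]] l G]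
    by (intro lincomb_cong) auto
  also have "\<dots> = lincomb (Deg (Val E ?c) (?n - 1 - 1)) (?G (?n - 1 - 1)) (formal_boundary ?l)"
    by (rule lincomb_formal_boundary(2)[OF cpresheaf_module[OF E c] l G, symmetric])
  also have "\<dots> = \<zero>\<^bsub>Deg (Val E ?c) (?n - 1 - 1)\<^esub>"
    by (rule lincomb_null[OF cpresheaf_module[OF E c]
          lincomb_formal_boundary(1)[OF cpresheaf_module[OF E c] l G] G V(4)])
  finally have z: "?z \<in> cycles (Val E ?c) (?n - 1)"
    using lincomb_closed[OF cpresheaf_module[OF E c] l G] by (simp add: cycles_def)
  \<comment> \<open>\<open>p\<close> commutes with restriction and so does \<open>v\<close>, which turns the lifts into generators\<close>
  have "p ?c (?n - 1) ?z = lincomb (Deg (Val B ?c) (?n - 1)) (\<lambda>b. p ?c (?n - 1) (?G (?n - 1) b)) ?l"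
    by (rule linear_map_lincomb[OF cpresheaf_module[OF E c] cpresheaf_module[OF B c] map_linear[OF pm c] l G])
  also have "\<dots> = lincomb (Deg (Val B ?c) (?n - 1))
      (\<lambda>b. v ?c (?n - 1) ((\<lambda>(f, g'). Res (resolution X) f (?n - 1) (generator X g')) b)) ?l"
  proof (rule lincomb_cong, clarify)
    fix r f g' assume m: "(r, f, g') \<in> set ?l"
    note b = bd[OF m]
    have "v ?c (?n - 1) (Res (resolution X) f (?n - 1) (generator X g')) =
        Res B f (?n - 1) (v (cell_ob g') (?n - 1) (generator X g'))"
      using generator_closed[OF X b(1)] b(2) by (intro map_Res[OF v b(3)]) simp
    also have "\<dots> = Res B f (?n - 1) (p (cell_ob g') (?n - 1) (?s g'))"
      unfolding b(5) by (simp add: w_def b(2))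
    also have "\<dots> = p ?c (?n - 1) (Res E f (?n - 1) (?s g'))"
      by (rule map_Res[OF pm b(3,6), symmetric])
    finally show "p ?c (?n - 1) (Res E f (?n - 1) (?s g')) =
        v ?c (?n - 1) (Res (resolution X) f (?n - 1) (generator X g'))" by simp
  qed
  also have "\<dots> = v ?c (?n - 1) (lincomb (cell_module X (?n - 1) ?c)
      (\<lambda>(f, g'). Res (resolution X) f (?n - 1) (generator X g')) ?l)"
  proof (rule linear_map_lincomb[OF module_cell_module[OF X] cpresheaf_module[OF B c] _ l, symmetric])
    show "v ?c (?n - 1) \<in> linear_maps R (cell_module X (?n - 1) ?c) (Deg (Val B ?c) (?n - 1))"
      using map_linear[OF v c] by simp
    show "(\<lambda>(f, g'). Res (resolution X) f (?n - 1) (generator X g'))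
        \<in> cells X (?n - 1) ?c \<rightarrow> carrier (cell_module X (?n - 1) ?c)"
      using cell_basis_closed[OF X] cell_basis_generator[OF X] by fastforce
  qed
  also have "\<dots> = Diff (Val B ?c) ?n (w g)"
    using map_Diff[OF v c, of "generator X g" ?n] generator_closed[OF X cell.hyps] Diff_generator[OF X cell.hyps]
    by (simp add: w_def)
  finally have "Diff (Val B ?c) ?n (w g) = p ?c (?n - 1) ?z" by simp
  moreover have "w g \<in> carrier (Deg (Val B ?c) ?n)"
    using map_closed[OF v c, of "generator X g" ?n] generator_closed[OF X cell.hyps] by (simp add: w_def)
  ultimately obtain y where "y \<in> carrier (Deg (Val E ?c) ?n)" "Diff (Val E ?c) ?n y = ?z" "p ?c ?n y = w g"
    using fills_spheresD[OF trivial_fibrationD(4)[OF p c] z] by blast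
  then have "lift_condition E p ?c ?n ?z (w g) y" by (simp add: lift_condition_def)
  then show ?case by (rule lift_cell_condition)
qed

lemma lift_exists:
  obtains h where "h \<in> cpresheaf_maps C R (resolution X) E"
    "(\<lambda>c\<in>Ob C. comp_chain (Val (resolution X) c) (p c) (h c)) = v"
proof
  note E = trivial_fibrationD(1)[OF p] and B = trivial_fibrationD(2)[OF p] and pm = trivial_fibrationD(3)[OF p]
  have coh: "coherent X E (lift_cell E p w)"
    using lift_cell_works by (simp add: coherent_def lift_condition_def)
  show h: "cell_map X E (lift_cell E p w) \<in> cpresheaf_maps C R (resolution X) E" (is "?h \<in> _")
    by (rule cell_map_is_map[OF X E coh])
  show "(\<lambda>c\<in>Ob C. comp_chain (Val (resolution X) c) (p c) (?h c)) = v"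
  proof (rule resolution_map_eqI[OF X B _ v])
    show "(\<lambda>c\<in>Ob C. comp_chain (Val (resolution X) c) (p c) (?h c)) \<in> cpresheaf_maps C R (resolution X) B"
      by (rule cpresheaf_maps_comp[OF category_axioms is_cpresheaf_resolution[OF X] E h pm])
    fix g assume g: "valid_cell X g"
    show "(\<lambda>c\<in>Ob C. comp_chain (Val (resolution X) c) (p c) (?h c)) (cell_ob g) (cell_dim g) (generator X g) =
        v (cell_ob g) (cell_dim g) (generator X g)"
      unfolding comp_generator[OF X g] cell_map_generator[OF X E coh g]
      using lift_cell_works[OF g] by (simp add: lift_condition_def w_def)
  qed
qed

end

text \<open>
  Maps out of the zero complex are unique, so the upper triangle of a lifting problem commutes for
  any map \<open>h\<close>, and the lower one is the lift of the map \<open>v\<close>.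
\<close>

lemma projective_cofibrant_resolution:
  assumes X: "is_cpresheaf \<kappa> C R X"
  shows "projective_cofibrant \<kappa> C R (resolution X)"
proof -
  note QX = is_cpresheaf_resolution[OF X]
  let ?i = "(zero_cpresheaf, resolution X, zero_map (resolution X))"
  have i: "?i \<in> Hom (UCat \<kappa> C R) zero_cpresheaf (resolution X)"
    by (simp add: Hom_def UCat_def is_cpresheaf_zero QX zero_map_is_map)
  have "lifting (UCat \<kappa> C R) ?i P" if P: "trivial_fibration \<kappa> C R P" for P
    unfolding lifting_def
  proof (intro ballI impI)
    obtain E B p where P_def: "P = (E, B, p)" by (metis prod.exhaust)
    note p = P[unfolded P_def]
    note E = trivial_fibrationD(1)[OF p] and B = trivial_fibrationD(2)[OF p] and pm = trivial_fibrationD(3)[OF p]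
    fix u' v' assume "u' \<in> Hom (UCat \<kappa> C R) (Dom (UCat \<kappa> C R) ?i) (Dom (UCat \<kappa> C R) P)"
      and "v' \<in> Hom (UCat \<kappa> C R) (Cod (UCat \<kappa> C R) ?i) (Cod (UCat \<kappa> C R) P)"
    then obtain u v where u: "u' = (zero_cpresheaf, E, u)" "u \<in> cpresheaf_maps C R zero_cpresheaf E"
      and v: "v' = (resolution X, B, v)" "v \<in> cpresheaf_maps C R (resolution X) B"
      by (auto simp: UCat_def Hom_def P_def)
    obtain h where h: "h \<in> cpresheaf_maps C R (resolution X) E"
      "(\<lambda>c\<in>Ob C. comp_chain (Val (resolution X) c) (p c) (h c)) = v"
      by (rule lift_exists[OF X p v(2) refl])
    have "(\<lambda>c\<in>Ob C. comp_chain (Val zero_cpresheaf c) (h c) (zero_map (resolution X) c)) = zero_map E"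
      by (rule zero_map_unique[OF E cpresheaf_maps_comp[OF category_axioms is_cpresheaf_zero QX zero_map_is_map[OF QX] h(1)]])
    moreover have "u = zero_map E" by (rule zero_map_unique[OF E u(2)])
    ultimately show "\<exists>h\<in>Hom (UCat \<kappa> C R) (Cod (UCat \<kappa> C R) ?i) (Dom (UCat \<kappa> C R) P).
        Comp (UCat \<kappa> C R) h ?i = u' \<and> Comp (UCat \<kappa> C R) P h = v'"
      using h E QX by (intro bexI[of _ "(resolution X, E, h)"]) (auto simp: UCat_def Hom_def P_def u v)
  qed
  then have "cofibration \<kappa> C R ?i"
    using i by (simp add: cofibration_def Hom_def)
  then show ?thesis
    unfolding projective_cofibrant_def using i initial_zero QX by (auto simp: UCat_def)
qed

end


section \<open>Semi-representability\<close>

text \<open>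
  This is the shape in which restriction of representables expresses its coefficients.
\<close>

lemma coeff_map_finsum:
  assumes R: "cring R" and l: "set l \<subseteq> carrier R \<times> B"
  shows "coeff R (map (map_prod id q) l) b' = finsum R (coeff R l) {b \<in> B. coeff R l b \<noteq> \<zero>\<^bsub>R\<^esub> \<and> q b = b'}"
proof -
  interpret cring R by (rule R)
  let ?S = "snd ` set l" and ?T = "{b \<in> B. coeff R l b \<noteq> \<zero>\<^bsub>R\<^esub> \<and> q b = b'}"
  let ?F = "\<lambda>b. if q b = b' then \<one>\<^bsub>R\<^esub> else \<zero>\<^bsub>R\<^esub>"
  have lS: "set l \<subseteq> carrier R \<times> ?S" using l by force
  have c: "coeff R l b \<in> carrier R" for b by (rule coeff_closed[OF R l])
  have T: "?T \<subseteq> ?S" using coeff_outside[OF R lS] by auto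
  have "coeff R (map (map_prod id q) l) b' = (\<Oplus>\<^bsub>regular_module R\<^esub>b\<in>?S. coeff R l b \<odot>\<^bsub>regular_module R\<^esub> ?F b)"
    unfolding coeff_def[of R "map (map_prod id q) l"] lincomb_map
    by (rule lincomb_finsum[OF module_regular_module[OF R] _ subset_refl lS]) auto
  also have "\<dots> = (\<Oplus>\<^bsub>R\<^esub>b\<in>?S. coeff R l b \<otimes>\<^bsub>R\<^esub> ?F b)"
    by (simp add: finsum_def finprod_def regular_module_def)
  also have "\<dots> = finsum R (coeff R l) ?T"
    using T c l by (intro add.finprod_mono_neutral_cong_right) auto
  finally show ?thesis .
qed

lemma free_module_sel [simp]:
  "carrier (free_module R B) = {x \<in> B \<rightarrow>\<^sub>E carrier R. finite {b \<in> B. x b \<noteq> \<zero>\<^bsub>R\<^esub>}}"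
  "\<zero>\<^bsub>free_module R B\<^esub> = (\<lambda>b\<in>B. \<zero>\<^bsub>R\<^esub>)"
  "x \<oplus>\<^bsub>free_module R B\<^esub> y = (\<lambda>b\<in>B. x b \<oplus>\<^bsub>R\<^esub> y b)"
  "a \<odot>\<^bsub>free_module R B\<^esub> x = (\<lambda>b\<in>B. a \<otimes>\<^bsub>R\<^esub> x b)"
  by (simp_all add: free_module_def)

definition curry_vector :: "'i set \<Rightarrow> ('i \<Rightarrow> 'b set) \<Rightarrow> ('i \<times> 'b \<Rightarrow> 'r) \<Rightarrow> 'i \<Rightarrow> 'b \<Rightarrow> 'r" where
  "curry_vector I S x = (\<lambda>i\<in>I. \<lambda>b\<in>S i. x (i, b))"

lemma curry_vector_closed:
  assumes "x \<in> carrier (free_module R (Sigma I S))"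
  shows "curry_vector I S x \<in> carrier (direct_sum I (\<lambda>i. free_module R (S i)))"
proof -
  have fin: "finite {p \<in> Sigma I S. x p \<noteq> \<zero>\<^bsub>R\<^esub>}" using assms by simp
  have "finite {b \<in> S i. x (i, b) \<noteq> \<zero>\<^bsub>R\<^esub>}" if "i \<in> I" for i
    by (rule finite_subset[OF _ finite_imageI[OF fin, of snd]]) (use that in force)
  moreover have "finite {i \<in> I. (\<lambda>b\<in>S i. x (i, b)) \<noteq> (\<lambda>b\<in>S i. \<zero>\<^bsub>R\<^esub>)}"
  proof (rule finite_subset[OF _ finite_imageI[OF fin, of fst]], clarify)
    fix i assume i: "i \<in> I" "(\<lambda>b\<in>S i. x (i, b)) \<noteq> (\<lambda>b\<in>S i. \<zero>\<^bsub>R\<^esub>)"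
    then obtain b where "b \<in> S i" "x (i, b) \<noteq> \<zero>\<^bsub>R\<^esub>" by (meson restrict_ext)
    then show "i \<in> fst ` {p \<in> Sigma I S. x p \<noteq> \<zero>\<^bsub>R\<^esub>}"
      using i(1) by (intro image_eqI[of _ _ "(i, b)"]) auto
  qed
  ultimately show ?thesis
    using assms by (auto simp: curry_vector_def PiE_iff cong: conj_cong)
qed

text \<open>
  Currying identifies the free module on a disjoint union with the direct sum of free modules that
  occurs in a coproduct of representables.
\<close>

lemma curry_vector_linear_bij:
  fixes R :: "('r, 's) ring_scheme" and I :: "'i set" and S :: "'i \<Rightarrow> 'b set"
  defines "j \<equiv> restrict (curry_vector I S) (carrier (free_module R (Sigma I S)))"
  assumes R: "cring R"
  shows "j \<in> linear_maps R (free_module R (Sigma I S)) (direct_sum I (\<lambda>i. free_module R (S i)))"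
    and "bij_betw j (carrier (free_module R (Sigma I S))) (carrier (direct_sum I (\<lambda>i. free_module R (S i))))"
proof -
  let ?M = "free_module R (Sigma I S)" and ?N = "direct_sum I (\<lambda>i. free_module R (S i))"
  interpret M: module R ?M by (rule module_free_module[OF R])
  have jx: "j x = curry_vector I S x" if "x \<in> carrier ?M" for x using that by (simp only: j_def restrict_apply')
  have ext: "j \<in> extensional (carrier ?M)" by (simp add: j_def)
  show "j \<in> linear_maps R ?M ?N"
    unfolding linear_maps_def mem_Collect_eq PiE_iff
  proof (intro conjI ballI ext)
    fix x assume x: "x \<in> carrier ?M"
    then show "j x \<in> carrier ?N" using curry_vector_closed jx by metis
    fix y assume y: "y \<in> carrier ?M"
    show "j (x \<oplus>\<^bsub>?M\<^esub> y) = j x \<oplus>\<^bsub>?N\<^esub> j y"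
      unfolding jx[OF x] jx[OF y] jx[OF M.a_closed[OF x y]]
      by (auto simp: curry_vector_def intro!: restrict_ext)
  next
    fix a x assume a: "a \<in> carrier R" and x: "x \<in> carrier ?M"
    show "j (a \<odot>\<^bsub>?M\<^esub> x) = a \<odot>\<^bsub>?N\<^esub> j x"
      unfolding jx[OF x] jx[OF M.smult_closed[OF a x]]
      by (auto simp: curry_vector_def intro!: restrict_ext)
  qed
  have "inj_on j (carrier ?M)"
  proof (rule inj_onI)
    fix x y assume x: "x \<in> carrier ?M" and y: "y \<in> carrier ?M" and "j x = j y"
    then have eq: "curry_vector I S x = curry_vector I S y" using jx by metis
    have "x (i, b) = y (i, b)" if "i \<in> I" "b \<in> S i" for i b
      using fun_cong[OF fun_cong[OF eq, of i], of b] that by (simp add: curry_vector_def)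
    then show "x = y"
      using x y by (intro extensionalityI[of _ "Sigma I S"]) (auto simp: PiE_iff)
  qed
  moreover have "y \<in> j ` carrier ?M" if y: "y \<in> carrier ?N" for y
  proof -
    let ?x = "\<lambda>p\<in>Sigma I S. y (fst p) (snd p)"
    have "{p \<in> Sigma I S. y (fst p) (snd p) \<noteq> \<zero>\<^bsub>R\<^esub>} \<subseteq>
        (SIGMA i:{i \<in> I. y i \<noteq> (\<lambda>b\<in>S i. \<zero>\<^bsub>R\<^esub>)}. {b \<in> S i. y i b \<noteq> \<zero>\<^bsub>R\<^esub>})"
      by (auto dest: fun_cong)
    moreover have "finite \<dots>" using y by (intro finite_SigmaI) (auto simp: PiE_iff)
    ultimately have "finite {p \<in> Sigma I S. y (fst p) (snd p) \<noteq> \<zero>\<^bsub>R\<^esub>}" by (rule finite_subset)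
    then have x: "?x \<in> carrier ?M" using y by (auto simp: PiE_iff cong: conj_cong)
    have "curry_vector I S ?x = (\<lambda>i\<in>I. restrict (y i) (S i))"
      by (auto simp: curry_vector_def intro!: restrict_ext)
    also have "\<dots> = restrict y I"
      using y by (intro restrict_ext extensional_restrict) (auto simp: PiE_iff)
    also have "\<dots> = y" using y by (intro extensional_restrict) (auto simp: PiE_iff)
    finally have "curry_vector I S ?x = y" .
    then have "j ?x = y" by (simp only: jx[OF x])
    then show ?thesis using x by (rule image_eqI[OF sym])
  qed
  ultimately show "bij_betw j (carrier ?M) (carrier ?N)"
    using linear_mapsD(1)[OF \<open>j \<in> linear_maps R ?M ?N\<close>] by (auto simp: bij_betw_def simp del: free_module_sel direct_sum_sel)
qed

definition direct_sum_basis ::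
  "('r, 's) ring_scheme \<Rightarrow> 'i set \<Rightarrow> ('i \<Rightarrow> 'b set) \<Rightarrow> 'i \<times> 'b \<Rightarrow> 'i \<Rightarrow> 'b \<Rightarrow> 'r" where
  "direct_sum_basis R I S p = curry_vector I S (unit_vector R (Sigma I S) p)"

lemma is_basis_direct_sum:
  assumes R: "cring R"
  shows "is_basis R (direct_sum I (\<lambda>i. free_module R (S i))) (Sigma I S) (direct_sum_basis R I S)"
    and "set l \<subseteq> carrier R \<times> Sigma I S \<Longrightarrow>
      lincomb (direct_sum I (\<lambda>i. free_module R (S i))) (direct_sum_basis R I S) l =
      (\<lambda>i\<in>I. \<lambda>b\<in>S i. coeff R l (i, b))"
proof -
  let ?M = "free_module R (Sigma I S)" and ?N = "direct_sum I (\<lambda>i. free_module R (S i))"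
  let ?j = "restrict (curry_vector I S) (carrier ?M)"
  note j = curry_vector_linear_bij[OF R, of I S]
  note e = is_basis_free_module[OF R, of "Sigma I S"]
  have N: "module R ?N" by (intro module_direct_sum module_free_module R)
  have je: "direct_sum_basis R I S = (\<lambda>p. ?j (unit_vector R (Sigma I S) p))"
    by (rule ext) (simp only: direct_sum_basis_def restrict_apply'[OF unit_vector_closed[OF R]])
  show "is_basis R ?N (Sigma I S) (direct_sum_basis R I S)"
    unfolding je by (rule is_basis_linear_bij[OF e N j])
  assume l: "set l \<subseteq> carrier R \<times> Sigma I S"
  have "lincomb ?N (direct_sum_basis R I S) l = ?j (lincomb ?M (unit_vector R (Sigma I S)) l)"
    unfolding je by (rule linear_map_lincomb[OF is_basisD(1)[OF e] N j(1) l is_basisD(2)[OF e], symmetric])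
  also have "\<dots> = curry_vector I S (lincomb ?M (unit_vector R (Sigma I S)) l)"
    by (rule restrict_apply', rule lincomb_closed[OF is_basisD(1)[OF e] l is_basisD(2)[OF e]])
  also have "\<dots> = (\<lambda>i\<in>I. \<lambda>b\<in>S i. coeff R l (i, b))"
    by (auto simp: free_module_lincomb[OF R l] curry_vector_def intro!: restrict_ext)
  finally show "lincomb ?N (direct_sum_basis R I S) l = (\<lambda>i\<in>I. \<lambda>b\<in>S i. coeff R l (i, b))" .
qed

text \<open>
  Stated for combinations rather than for basis elements, the formula includes the linearity of the
  restriction. The definition of representables hides it, as they sum over a set which depends on the
  argument.
\<close>

lemma (in category) coproduct_of_representables_lincomb:
  assumes R: "cring R" and f: "f \<in> Hom C a b" and l: "set l \<subseteq> carrier R \<times> (SIGMA i:I. Hom C b (c i))"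
  defines "P \<equiv> presheaf_coproduct C I (\<lambda>i. representable C R (c i))"
  shows "Rst P f (lincomb (Sec P b) (direct_sum_basis R I (\<lambda>i. Hom C b (c i))) l) =
    lincomb (Sec P a) (direct_sum_basis R I (\<lambda>i. Hom C a (c i))) (map (map_prod id (\<lambda>(i, h). (i, Comp C h f))) l)"
proof -
  have Sec: "Sec P d = direct_sum I (\<lambda>i. free_module R (Hom C d (c i)))" for d
    by (simp add: P_def presheaf_coproduct_def representable_def)
  let ?x = "\<lambda>i\<in>I. \<lambda>h\<in>Hom C b (c i). coeff R l (i, h)"
  let ?l = "map (map_prod id (\<lambda>(i, h). (i, Comp C h f))) l"
  note e = is_basis_direct_sum[OF R, where I = I and S = "\<lambda>i. Hom C b (c i)"]
  have x: "lincomb (Sec P b) (direct_sum_basis R I (\<lambda>i. Hom C b (c i))) l = ?x"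
    unfolding Sec by (rule e(2)[OF l])
  have l': "set ?l \<subseteq> carrier R \<times> (SIGMA i:I. Hom C a (c i))"
    using l f by (auto intro: Comp_in_Hom)
  have xc: "?x \<in> carrier (direct_sum I (\<lambda>i. free_module R (Hom C b (c i))))"
    using lincomb_closed[OF is_basisD(1)[OF e(1)] l is_basisD(2)[OF e(1)]] unfolding e(2)[OF l] .
  have DC: "Dom C f = a" "Cod C f = b" using f by (auto simp: Hom_def)
  have "Rst P f ?x = (\<lambda>i\<in>I. Rst (representable C R (c i)) f (?x i))"
  proof -
    have "Rst P f = (\<lambda>x\<in>carrier (direct_sum I (\<lambda>i. free_module R (Hom C b (c i)))).
        \<lambda>i\<in>I. Rst (representable C R (c i)) f (x i))"
      unfolding DC[symmetric]
      by (simp add: P_def presheaf_coproduct_def representable_def del: free_module_sel direct_sum_sel)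
    then show ?thesis by (simp only: restrict_apply'[OF xc])
  qed
  also have "\<dots> = (\<lambda>i\<in>I. \<lambda>k\<in>Hom C a (c i). coeff R ?l (i, k))"
  proof (rule restrict_ext)
    fix i assume i: "i \<in> I"
    let ?xi = "\<lambda>h\<in>Hom C b (c i). coeff R l (i, h)"
    have xi: "?xi \<in> carrier (free_module R (Hom C b (c i)))"
    proof -
      have "?x \<in> (\<Pi>\<^sub>E i\<in>I. carrier (free_module R (Hom C b (c i))))"
        using xc unfolding direct_sum_sel mem_Collect_eq by (rule conjunct1)
      from PiE_mem[OF this i] show ?thesis by (simp only: restrict_apply'[OF i])
    qed
    have fs: "finsum R ?xi {h \<in> Hom C b (c i). ?xi h \<noteq> \<zero>\<^bsub>R\<^esub> \<and> Comp C h f = k} = coeff R ?l (i, k)"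
      (is "finsum R ?xi ?H = _") for k
    proof -
      interpret R: cring R by (rule R)
      let ?T = "{p \<in> (SIGMA i:I. Hom C b (c i)). coeff R l p \<noteq> \<zero>\<^bsub>R\<^esub> \<and> (\<lambda>(i, h). (i, Comp C h f)) p = (i, k)}"
      have T: "?T = Pair i ` ?H" using i by (auto simp: image_iff)
      have "coeff R ?l (i, k) = finsum R (coeff R l) ?T" by (rule coeff_map_finsum[OF R l])
      also have "\<dots> = finsum R (\<lambda>h. coeff R l (i, h)) ?H"
        unfolding T using coeff_closed[OF R l] by (intro R.add.finprod_reindex) (auto simp: inj_on_def)
      also have "\<dots> = finsum R ?xi ?H"
        using coeff_closed[OF R l] by (intro R.add.finprod_cong') auto
      finally show ?thesis by simp
    qed
    show "Rst (representable C R (c i)) f (?x i) = (\<lambda>k\<in>Hom C a (c i). coeff R ?l (i, k))"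
      using xi i fs by (simp add: representable_def DC del: free_module_sel)
  qed
  also have "\<dots> = lincomb (Sec P a) (direct_sum_basis R I (\<lambda>i. Hom C a (c i))) ?l"
    unfolding Sec by (rule is_basis_direct_sum(2)[OF R l', symmetric])
  finally show ?thesis unfolding x .
qed

text \<open>
  The linear extensions of the bijection between the two bases are inverse to each other. They are
  natural because both restrictions act on the common index set by the same \<open>q\<close>.
\<close>

lemma presheaf_isoI_bases:
  assumes C: "category C"
    and e: "\<And>c. c \<in> Ob C \<Longrightarrow> is_basis R (Sec P c) (B c) (e c)"
    and e': "\<And>c. c \<in> Ob C \<Longrightarrow> is_basis R (Sec P' c) (B c) (e' c)"
    and q: "\<And>f b. f \<in> Mor C \<Longrightarrow> b \<in> B (Cod C f) \<Longrightarrow> q f b \<in> B (Dom C f)"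
    and P: "\<And>f l. f \<in> Mor C \<Longrightarrow> set l \<subseteq> carrier R \<times> B (Cod C f) \<Longrightarrow>
      Rst P f (lincomb (Sec P (Cod C f)) (e (Cod C f)) l) = lincomb (Sec P (Dom C f)) (e (Dom C f)) (map (map_prod id (q f)) l)"
    and P': "\<And>f l. f \<in> Mor C \<Longrightarrow> set l \<subseteq> carrier R \<times> B (Cod C f) \<Longrightarrow>
      Rst P' f (lincomb (Sec P' (Cod C f)) (e' (Cod C f)) l) = lincomb (Sec P' (Dom C f)) (e' (Dom C f)) (map (map_prod id (q f)) l)"
  shows "presheaf_iso C R P P'"
proof -
  interpret category C by (rule C)
  define \<phi> where "\<phi> c = linear_extension R (Sec P c) (B c) (e c) (Sec P' c) (e' c)" for c
  define \<psi> where "\<psi> c = linear_extension R (Sec P' c) (B c) (e' c) (Sec P c) (e c)" for c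
  have \<phi>: "\<phi> c (lincomb (Sec P c) (e c) l) = lincomb (Sec P' c) (e' c) l"
    and \<psi>: "\<psi> c (lincomb (Sec P' c) (e' c) l) = lincomb (Sec P c) (e c) l"
    if c: "c \<in> Ob C" and l: "set l \<subseteq> carrier R \<times> B c" for c l
    unfolding \<phi>_def \<psi>_def
    using linear_extension_lincomb[OF e[OF c] is_basisD(1,2)[OF e'[OF c]] l]
      linear_extension_lincomb[OF e'[OF c] is_basisD(1,2)[OF e[OF c]] l] by blast+
  have ql: "set (map (map_prod id (q f)) l) \<subseteq> carrier R \<times> B (Dom C f)"
    if "f \<in> Mor C" "set l \<subseteq> carrier R \<times> B (Cod C f)" for f l
    using that q by force
  have "\<phi> \<in> presheaf_maps C R P P'"
    unfolding presheaf_maps_def mem_Collect_eq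
  proof (intro conjI ballI)
    show "\<phi> c \<in> linear_maps R (Sec P c) (Sec P' c)" if "c \<in> Ob C" for c
      unfolding \<phi>_def by (rule linear_extension_linear[OF e[OF that] is_basisD(1,2)[OF e'[OF that]]])
    fix f x assume f: "f \<in> Mor C" and x: "x \<in> carrier (Sec P (Cod C f))"
    obtain l where l: "set l \<subseteq> carrier R \<times> B (Cod C f)" "x = lincomb (Sec P (Cod C f)) (e (Cod C f)) l"
      by (rule basis_span[OF e[OF Cod_in_Ob[OF f]] x])
    then show "\<phi> (Dom C f) (Rst P f x) = Rst P' f (\<phi> (Cod C f) x)"
      unfolding l(2) P[OF f l(1)] P'[OF f l(1)] \<phi>[OF Cod_in_Ob[OF f] l(1)] \<phi>[OF Dom_in_Ob[OF f] ql[OF f l(1)]]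
      by simp
  qed
  moreover have "\<psi> \<in> presheaf_maps C R P' P"
    unfolding presheaf_maps_def mem_Collect_eq
  proof (intro conjI ballI)
    show "\<psi> c \<in> linear_maps R (Sec P' c) (Sec P c)" if "c \<in> Ob C" for c
      unfolding \<psi>_def by (rule linear_extension_linear[OF e'[OF that] is_basisD(1,2)[OF e[OF that]]])
    fix f x assume f: "f \<in> Mor C" and x: "x \<in> carrier (Sec P' (Cod C f))"
    obtain l where l: "set l \<subseteq> carrier R \<times> B (Cod C f)" "x = lincomb (Sec P' (Cod C f)) (e' (Cod C f)) l"
      by (rule basis_span[OF e'[OF Cod_in_Ob[OF f]] x])
    then show "\<psi> (Dom C f) (Rst P' f x) = Rst P f (\<psi> (Cod C f) x)"
      unfolding l(2) P[OF f l(1)] P'[OF f l(1)] \<psi>[OF Cod_in_Ob[OF f] l(1)] \<psi>[OF Dom_in_Ob[OF f] ql[OF f l(1)]]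
      by simp
  qed
  moreover have "\<psi> c (\<phi> c x) = x" if c: "c \<in> Ob C" and x: "x \<in> carrier (Sec P c)" for c x
    by (rule basis_span[OF e[OF c] x]) (simp add: \<phi> \<psi> c)
  moreover have "\<phi> c (\<psi> c x) = x" if c: "c \<in> Ob C" and x: "x \<in> carrier (Sec P' c)" for c x
    by (rule basis_span[OF e'[OF c] x]) (simp add: \<phi> \<psi> c)
  ultimately show ?thesis unfolding presheaf_iso_def by blast
qed

context presheaf_setting
begin

lemma is_presheaf_degree_presheaf:
  assumes X: "is_cpresheaf \<kappa> C R X"
  shows "is_presheaf C R (degree_presheaf X n)"
  unfolding is_presheaf_def degree_presheaf_def
  using cpresheaf_module[OF X] Res_linear[OF X] Res_Ident[OF X] Res_Comp[OF X]
  by (auto simp: Hom_def)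

text \<open>
  The summands are indexed by the cells \<open>g\<close> of degree \<open>n\<close>, renamed into \<open>'u\<close>: an arrow
  \<open>f : d \<rightarrow> cell_ob g\<close> is a basis element of the representable of \<open>cell_ob g\<close> at \<open>d\<close>, and the pair
  \<open>(f, g)\<close> is one of the resolution.
\<close>

lemma semi_representable_resolution:
  assumes X: "is_cpresheaf \<kappa> C R X"
  shows "semi_representable \<kappa> C R (degree_presheaf (resolution X) n)"
proof -
  define \<Gamma> where "\<Gamma> = {g. valid_cell X g \<and> cell_dim g = n}"
  define \<iota> where "\<iota> = (embedding \<Gamma> :: _ \<Rightarrow> 'u)"
  define I where "I = \<iota> ` \<Gamma>"
  define c where "c i = cell_ob (inv_into \<Gamma> \<iota> i)" for i
  have sm: "small \<kappa> \<Gamma>" by (rule small_subset[OF small_valid_cells[OF X]]) (auto simp: \<Gamma>_def)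
  have inj: "inj_on \<iota> \<Gamma>" unfolding \<iota>_def by (rule inj_on_embedding[OF universe sm])
  have c: "c (\<iota> g) = cell_ob g" if "g \<in> \<Gamma>" for g using that inj by (simp add: c_def)
  let ?P = "presheaf_coproduct C I (\<lambda>i. representable C R (c i))"
  let ?p = "\<lambda>(f, g). (\<iota> g, f)"
  have p: "bij_betw ?p (cells X n d) (SIGMA i:I. Hom C d (c i))" for d
    unfolding bij_betw_def
  proof
    show "inj_on ?p (cells X n d)"
      using inj by (auto simp: inj_on_def cells_def \<Gamma>_def)
    show "?p ` cells X n d = (SIGMA i:I. Hom C d (c i))"
    proof (intro equalityI subsetI)
      fix x assume "x \<in> ?p ` cells X n d"
      then show "x \<in> (SIGMA i:I. Hom C d (c i))" using c by (auto simp: cells_def I_def \<Gamma>_def)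
    next
      fix x assume "x \<in> (SIGMA i:I. Hom C d (c i))"
      then obtain g f where "g \<in> \<Gamma>" "x = (\<iota> g, f)" "f \<in> Hom C d (cell_ob g)" using c by (auto simp: I_def)
      then show "x \<in> ?p ` cells X n d" by (intro image_eqI[of _ _ "(f, g)"]) (auto simp: cells_def \<Gamma>_def)
    qed
  qed
  let ?e = "\<lambda>d b. direct_sum_basis R I (\<lambda>i. Hom C d (c i)) (?p b)"
  have Sec: "Sec ?P d = direct_sum I (\<lambda>i. free_module R (Hom C d (c i)))" for d
    by (simp add: presheaf_coproduct_def representable_def)
  have "presheaf_iso C R (degree_presheaf (resolution X) n) ?P"
  proof (rule presheaf_isoI_bases[OF category_axioms, where B = "cells X n" and e = "cell_basis X n" and e' = ?e
        and q = "\<lambda>f (h, g). (Comp C h f, g)"])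
    fix d
    show "is_basis R (Sec (degree_presheaf (resolution X) n) d) (cells X n d) (cell_basis X n d)"
      using cell_basis_is_basis[OF X] by (simp add: degree_presheaf_def)
    show "is_basis R (Sec ?P d) (cells X n d) (?e d)"
      unfolding Sec by (rule is_basis_reindex[OF is_basis_direct_sum(1)[OF cring_R] p])
  next
    fix f assume "f \<in> Mor C"
    then have f: "f \<in> Hom C (Dom C f) (Cod C f)" by (simp add: Hom_def)
    show "(\<lambda>f (h, g). (Comp C h f, g)) f b \<in> cells X n (Dom C f)" if "b \<in> cells X n (Cod C f)" for b
      using cells_pull[OF _ f] that by (cases b) simp
    fix l assume l: "set l \<subseteq> carrier R \<times> cells X n (Cod C f)"
    show "Rst (degree_presheaf (resolution X) n) f
          (lincomb (Sec (degree_presheaf (resolution X) n) (Cod C f)) (cell_basis X n (Cod C f)) l) =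
        lincomb (Sec (degree_presheaf (resolution X) n) (Dom C f)) (cell_basis X n (Dom C f))
          (map (map_prod id ((\<lambda>f (h, g). (Comp C h f, g)) f)) l)"
      using Res_resolution_lincomb[OF X f l] by (simp add: degree_presheaf_def pull_def)
    have l': "set (map (map_prod id ?p) l) \<subseteq> carrier R \<times> (SIGMA i:I. Hom C (Cod C f) (c i))"
      using l p by (force simp: bij_betw_def)
    have "Rst ?P f (lincomb (Sec ?P (Cod C f)) (?e (Cod C f)) l) =
        lincomb (Sec ?P (Dom C f)) (direct_sum_basis R I (\<lambda>i. Hom C (Dom C f) (c i)))
          (map (map_prod id (\<lambda>(i, h). (i, Comp C h f))) (map (map_prod id ?p) l))"
      using coproduct_of_representables_lincomb[OF cring_R f l'] by (simp only: lincomb_map)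
    also have "\<dots> = lincomb (Sec ?P (Dom C f)) (?e (Dom C f)) (map (map_prod id ((\<lambda>f (h, g). (Comp C h f, g)) f)) l)"
      unfolding lincomb_map by (intro lincomb_cong) auto
    finally show "Rst ?P f (lincomb (Sec ?P (Cod C f)) (?e (Cod C f)) l) =
        lincomb (Sec ?P (Dom C f)) (?e (Dom C f)) (map (map_prod id ((\<lambda>f (h, g). (Comp C h f, g)) f)) l)" .
  qed
  moreover have "small \<kappa> I" unfolding I_def by (rule small_image[OF sm])
  moreover have "\<forall>i\<in>I. c i \<in> Ob C" using c valid_cellD(1) by (auto simp: I_def \<Gamma>_def)
  ultimately show ?thesis
    using is_presheaf_degree_presheaf[OF is_cpresheaf_resolution[OF X]] unfolding semi_representable_def by blast
qed

lemma complex_of_semi_representables_resolution: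
  "is_cpresheaf \<kappa> C R X \<Longrightarrow> complex_of_semi_representables \<kappa> C R (resolution X)"
  by (simp add: complex_of_semi_representables_def UCat_def is_cpresheaf_resolution semi_representable_resolution)

end

theorem proposition4p4:
  fixes \<kappa> :: "'u rel"
    and C :: "('o, 'm) category"
    and \<Lambda> :: "('r, 's) ring_scheme"
  assumes "universe \<kappa>"
    and "small_category \<kappa> C"
    and "cring \<Lambda>" and "small \<kappa> (carrier \<Lambda>)"
  shows "\<exists>Qo Qm q.
    is_functor (UCat \<kappa> C \<Lambda>) (UCat \<kappa> C \<Lambda>) Qo Qm \<and>
    is_nat_trans (UCat \<kappa> C \<Lambda>) (UCat \<kappa> C \<Lambda>) Qo Qm (\<lambda>X. X) (\<lambda>f. f) q \<and>
    (\<forall>X\<in>Ob (UCat \<kappa> C \<Lambda>). trivial_fibration \<kappa> C \<Lambda> (q X)) \<and>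
    (\<forall>X\<in>Ob (UCat \<kappa> C \<Lambda>). projective_cofibrant \<kappa> C \<Lambda> (Qo X) \<and>
       complex_of_semi_representables \<kappa> C \<Lambda> (Qo X)) \<and>
    cofibrant_replacement_functor \<kappa> C \<Lambda> Qo Qm q"
proof -
  interpret presheaf_setting C \<kappa> \<Lambda>
    using assms by (simp add: presheaf_setting_def presheaf_setting_axioms_def small_category_def)
  have "is_cpresheaf \<kappa> C \<Lambda> X" if "X \<in> Ob (UCat \<kappa> C \<Lambda>)" for X
    using that by (simp add: UCat_def)
  then show ?thesis
    unfolding cofibrant_replacement_functor_def
    by (intro exI[of _ resolution] exI[of _ resolution_arrow] exI[of _ augmentation_arrow])
      (simp add: functor_resolution nat_trans_augmentation trivial_fibration_augmentation
        projective_cofibrant_resolution complex_of_semi_representables_resolution)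
qed

end
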